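(* Let $A$ be a real $n\times n$ matrix that is diagonalizable over the complex numbers and whose eigenvalues all have positive real parts. Let $\Gamma$ be a locally compact uniform quasisimilarity group of $(\mathbb{R}^n,d_A)$. Suppose in addition that $\Gamma$ is amenable and acts cocompactly on the space of distinct pairs of $\mathbb{R}^n$. Let $\bar A$ denote the matrix obtained from the Jordan form of $A$ by replacing the eigenvalues with their real parts. Then there exists a biLipschitz map $f:(\mathbb{R}^n,d_A)\to(\mathbb{R}^n,d_{\bar A})$ such that $f\Gamma f^{-1}$ is a group of similarities of $(\mathbb{R}^n,d_{\bar A})$.
   Context: Metric $d_A$: let $\alpha_1<\alpha_2<\cdots<\alpha_r$ be the distinct real parts of the eigenvalues of $A$, and let $\mathbb{R}^n=V_1\oplus\cdots\oplus V_r$, where $V_i$ is the real $A$-invariant subspace corresponding to all eigenvalues with real part $\alpha_i$ (for the diagonal matrix $\bar A$, with diagonal entries in increasing order, $V_i$ is the eigenspace of $\alpha_i$). Writing $x=(x_1,\dots,x_r)$ with $x_i\in V_i$ and $|\cdot|$ for the Euclidean norm, $$d_A(x,x')=\max_{1\le i\le r}|x_i-x_i'|^{\alpha_1/\alpha_i}.$$ Up to biLipschitz equivalence this is the parabolic visual metric, associated with the point $\infty$, on $\partial G_A\setminus\{\infty\}=\mathbb{R}^n$, where $G_A=\mathbb{R}^n\rtimes_A\mathbb{R}$ with $t\in\mathbb{R}$ acting on $\mathbb{R}^n$ by $e^{tA}$. A bijection $F:(X,d)\to(X,d)$ is an $(M,C)$-quasisimilarity ($M\ge1$, $C>0$) if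 $\frac{C}{M}d(x_1,x_2)\le d(F(x_1),F(x_2))\le MC\,d(x_1,x_2)$ for all $x_1,x_2\in X$; it is a similarity if $M=1$. A group $\Gamma$ of quasisimilarities is uniform if there is some $M\ge1$ such that every $\gamma\in\Gamma$ is an $(M,C_\gamma)$-quasisimilarity, where $C_\gamma$ may depend on $\gamma$. "Locally compact" means that $\Gamma$ carries a locally compact group topology for which its action on $\mathbb{R}^n$ is continuous; amenability is with respect to this topology. $\Gamma$ acts cocompactly on the space of distinct pairs if there is a compact subset $Q$ of $\{(x,y)\in\mathbb{R}^n\times\mathbb{R}^n: x\ne y\}$ whose translates under the diagonal $\Gamma$-action cover that space. *)

theory Defs
  imports "HOL-Analysis.Analysis" "HOL-Algebra.Bij"
begin

abbreviation complexify :: "real^'n^'n \<Rightarrow> complex^'n^'n" where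
  "complexify A \<equiv> map_matrix complex_of_real A"

definition eigenvalues :: "real^'n^'n \<Rightarrow> complex set" where
  "eigenvalues A = {c. \<exists>v. v \<noteq> 0 \<and> complexify A *v v = c *s v}"

definition diagonal_matrix :: "'a::zero^'n^'n \<Rightarrow> bool" where
  "diagonal_matrix D \<longleftrightarrow> (\<forall>i j. i \<noteq> j \<longrightarrow> D $ i $ j = 0)"

definition complex_similar :: "complex^'n^'n \<Rightarrow> complex^'n^'n \<Rightarrow> bool" where
  "complex_similar B C \<longleftrightarrow> (\<exists>P. invertible P \<and> C = matrix_inv P ** B ** P)"

definition diagonalizable_over_complex :: "real^'n^'n \<Rightarrow> bool" where
  "diagonalizable_over_complex A \<longleftrightarrow> (\<exists>D. diagonal_matrix D \<and> complex_similar (complexify A) D)"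

text \<open>All Jordan blocks of a diagonalizable matrix have size 1, so its Jordan form is a
  diagonal matrix similar to it, determined up to the order of the diagonal entries.
  The predicate allows every order.\<close>

definition jordan_form_of_diagonalizable :: "real^'n^'n \<Rightarrow> complex^'n^'n \<Rightarrow> bool" where
  "jordan_form_of_diagonalizable A J \<longleftrightarrow> diagonal_matrix J \<and> complex_similar (complexify A) J"

definition real_part_matrix :: "complex^'n^'n \<Rightarrow> real^'n^'n" where
  "real_part_matrix J = map_matrix Re J"

definition eigen_real_parts :: "real^'n^'n \<Rightarrow> real set" where
  "eigen_real_parts A = Re ` eigenvalues A"

text \<open>The real vectors in the complex span of the eigenvectors for all eigenvalues with real
  part \<open>a\<close>. Only diagonalizable matrices are considered, so no generalized eigenvectors are
  needed.\<close>

definition real_part_subspace :: "real^'n^'n \<Rightarrow> real \<Rightarrow> (real^'n) set" where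
  "real_part_subspace A a =
     {x. (\<chi> i. complex_of_real (x $ i)) \<in>
           vec.span {v. \<exists>c. Re c = a \<and> complexify A *v v = c *s v}}"

text \<open>The components of \<open>x\<close> in the direct sum of the subspaces above; families are 0 off the
  index set \<open>eigen_real_parts A\<close> to make them unique.\<close>

definition components :: "real^'n^'n \<Rightarrow> real^'n \<Rightarrow> real \<Rightarrow> real^'n" where
  "components A x =
     (THE u. (\<forall>a \<in> eigen_real_parts A. u a \<in> real_part_subspace A a) \<and>
             (\<forall>a. a \<notin> eigen_real_parts A \<longrightarrow> u a = 0) \<and>
             x = (\<Sum>a \<in> eigen_real_parts A. u a))"

definition dist_mat :: "real^'n^'n \<Rightarrow> real^'n \<Rightarrow> real^'n \<Rightarrow> real" where
  "dist_mat A x y =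
     Max ((\<lambda>a. norm (components A x a - components A y a) powr (Min (eigen_real_parts A) / a))
            ` eigen_real_parts A)"

definition quasisimilarity :: "('a \<Rightarrow> 'a \<Rightarrow> real) \<Rightarrow> real \<Rightarrow> real \<Rightarrow> ('a \<Rightarrow> 'a) \<Rightarrow> bool" where
  "quasisimilarity d M C F \<longleftrightarrow>
     M \<ge> 1 \<and> C > 0 \<and> bij F \<and>
     (\<forall>x y. C / M * d x y \<le> d (F x) (F y) \<and> d (F x) (F y) \<le> M * C * d x y)"

definition similarity :: "('a \<Rightarrow> 'a \<Rightarrow> real) \<Rightarrow> ('a \<Rightarrow> 'a) \<Rightarrow> bool" where
  "similarity d F \<longleftrightarrow> (\<exists>C. quasisimilarity d 1 C F)"

definition uniform_quasisimilarity_group ::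
    "('a \<Rightarrow> 'a \<Rightarrow> real) \<Rightarrow> ('a \<Rightarrow> 'a) set \<Rightarrow> bool" where
  "uniform_quasisimilarity_group d \<Gamma> \<longleftrightarrow>
     subgroup \<Gamma> (BijGroup UNIV) \<and> (\<exists>M\<ge>1. \<forall>\<gamma>\<in>\<Gamma>. \<exists>C. quasisimilarity d M C \<gamma>)"

definition similarity_group :: "('a \<Rightarrow> 'a \<Rightarrow> real) \<Rightarrow> ('a \<Rightarrow> 'a) set \<Rightarrow> bool" where
  "similarity_group d \<Gamma> \<longleftrightarrow> subgroup \<Gamma> (BijGroup UNIV) \<and> (\<forall>\<gamma>\<in>\<Gamma>. similarity d \<gamma>)"

definition bilipschitz :: "('a \<Rightarrow> 'a \<Rightarrow> real) \<Rightarrow> ('b \<Rightarrow> 'b \<Rightarrow> real) \<Rightarrow> ('a \<Rightarrow> 'b) \<Rightarrow> bool" where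
  "bilipschitz d d' f \<longleftrightarrow>
     (\<exists>L\<ge>1. \<forall>x y. d x y / L \<le> d' (f x) (f y) \<and> d' (f x) (f y) \<le> L * d x y)"

definition topological_group :: "('g, 'b) monoid_scheme \<Rightarrow> 'g topology \<Rightarrow> bool" where
  "topological_group G T \<longleftrightarrow>
     group G \<and> topspace T = carrier G \<and>
     continuous_map (prod_topology T T) T (\<lambda>(g, h). g \<otimes>\<^bsub>G\<^esub> h) \<and>
     continuous_map T T (\<lambda>g. inv\<^bsub>G\<^esub> g)"

text \<open>The Hausdorff condition is part of the usual convention; it is automatic for a group acting
  faithfully and continuously on a Hausdorff space.\<close>

definition locally_compact_group :: "('g, 'b) monoid_scheme \<Rightarrow> 'g topology \<Rightarrow> bool" where
  "locally_compact_group G T \<longleftrightarrow>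
     topological_group G T \<and> locally_compact_space T \<and> Hausdorff_space T"

definition bounded_continuous :: "'g topology \<Rightarrow> ('g \<Rightarrow> real) \<Rightarrow> bool" where
  "bounded_continuous T \<phi> \<longleftrightarrow>
     continuous_map T euclideanreal \<phi> \<and> bounded (\<phi> ` topspace T)"

text \<open>A mean only depends on the values of functions on \<open>topspace T\<close>: this follows from
  linearity and positivity, the latter being required for functions nonnegative there.\<close>

definition is_mean :: "'g topology \<Rightarrow> (('g \<Rightarrow> real) \<Rightarrow> real) \<Rightarrow> bool" where
  "is_mean T m \<longleftrightarrow>
     (\<forall>\<phi> \<psi>. bounded_continuous T \<phi> \<longrightarrow> bounded_continuous T \<psi> \<longrightarrow>
        m (\<lambda>g. \<phi> g + \<psi> g) = m \<phi> + m \<psi>) \<and>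
     (\<forall>c \<phi>. bounded_continuous T \<phi> \<longrightarrow> m (\<lambda>g. c * \<phi> g) = c * m \<phi>) \<and>
     (\<forall>\<phi>. bounded_continuous T \<phi> \<longrightarrow> (\<forall>g \<in> topspace T. \<phi> g \<ge> 0) \<longrightarrow> m \<phi> \<ge> 0) \<and>
     m (\<lambda>g. 1) = 1"

text \<open>For locally compact groups, means on bounded continuous functions and means on \<open>L\<^sup>\<infinity>\<close>
  give the same notion of amenability; the former needs no Haar measure.\<close>

definition amenable_group :: "('g, 'b) monoid_scheme \<Rightarrow> 'g topology \<Rightarrow> bool" where
  "amenable_group G T \<longleftrightarrow>
     (\<exists>m. is_mean T m \<and>
        (\<forall>h \<in> carrier G. \<forall>\<phi>. bounded_continuous T \<phi> \<longrightarrow> m (\<lambda>g. \<phi> (h \<otimes>\<^bsub>G\<^esub> g)) = m \<phi>))"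

abbreviation bij_subgroup :: "('a \<Rightarrow> 'a) set \<Rightarrow> ('a \<Rightarrow> 'a) monoid" where
  "bij_subgroup \<Gamma> \<equiv> (BijGroup UNIV)\<lparr>carrier := \<Gamma>\<rparr>"

text \<open>Continuity of the action and compactness refer to the Euclidean topology of \<open>real^'n\<close>, which
  is also the topology induced by \<open>dist_mat A\<close>.\<close>

definition continuous_action ::
    "('a::topological_space \<Rightarrow> 'a) topology \<Rightarrow> bool" where
  "continuous_action T \<longleftrightarrow> continuous_map (prod_topology T euclidean) euclidean (\<lambda>(\<gamma>, x). \<gamma> x)"

definition cocompact_on_distinct_pairs :: "('a::topological_space \<Rightarrow> 'a) set \<Rightarrow> bool" where
  "cocompact_on_distinct_pairs \<Gamma> \<longleftrightarrow>
     (\<exists>Q. compact Q \<and> Q \<subseteq> {(x, y). x \<noteq> y} \<and>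
        {(x, y). x \<noteq> y} \<subseteq> (\<Union>\<gamma>\<in>\<Gamma>. map_prod \<gamma> \<gamma> ` Q))"

end

theory Submission
  imports Defs
begin

text \<open>
  Write \<open>q\<^sub>j(x, y)\<close> for the sum of \<open>|x\<^sub>k - y\<^sub>k| powr (\<alpha>\<^sub>j / \<alpha>\<^sub>k)\<close> over the coordinates with
  \<open>\<alpha>\<^sub>k \<ge> \<alpha>\<^sub>j\<close>.  A map that is Lipschitz for \<open>d\<close> is Lipschitz for every \<open>q\<^sub>j\<close>, because the coordinates of
  smaller weight can be changed in many small steps at no cost; so \<open>\<Gamma>\<close> preserves the flag of
  the \<open>V\<^sub>1 + \<dots> + V\<^sub>i\<close>.  Amenability makes the scale of an element of \<open>\<Gamma>\<close> a homomorphism, and a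
  supremum over \<open>\<Gamma>\<close> then gives pseudometrics \<open>\<rho>\<^sub>j\<close> comparable to \<open>q\<^sub>j\<close> that \<open>\<Gamma>\<close> scales exactly.

  Among all limits of zooms of \<open>\<rho>\<close> there is one that is a fixed norm along every coset of
  \<open>V\<^sub>j\<close>: choose a direction and a zoom of maximal speed in it and pass to limits.  By
  cocompactness such a limit is \<open>\<rho>\<close> in another biLipschitz chart.  In that chart the
  Mazur-Ulam theorem shows that each \<open>\<gamma>\<close> has the form
  \<open>x\<^sub>j \<mapsto> \<Lambda>\<^sub>j x\<^sub>j + B\<^sub>j(x\<^sub>j\<^sub>+\<^sub>1, \<dots>)\<close> with \<open>\<Lambda>\<^sub>j\<close> linear and conformal for the norm.  Two more averages
  over \<open>\<Gamma>\<close> finish the proof: one finds a biLipschitz change of coordinates that removes the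
  \<open>B\<^sub>j\<close>, the other a Euclidean norm for which the \<open>\<Lambda>\<^sub>j\<close> are conformal.
\<close>

section \<open>Anisotropic pseudometrics\<close>

text \<open>The obstacle is that elements of \<open>\<Gamma>\<close> are only Lipschitz and scale
  distances only up to a constant. A supremum over the group is scaled exactly only if the scale is
  a homomorphism. One character serves all levels, with factor \<open>exp (w j * chi g)\<close> on
  level \<open>j\<close>; this coupling is what finally makes the maximum over the levels scale by a
  single factor. Exact scaling alone gives no linear structure, since \<open>\<rho>\<^sub>j\<close>
  need not be invariant under translations. Differentiation is replaced by an extremal argument in a
  compact set of functions with pointwise convergence, so Tychonoff and finite intersections suffice
  and no sequence of charts is extracted. The linear part of an element is the same on all cosets,
  so the linear parts multiply like the group elements, although nothing explicit is known about the
  \<open>B\<^sub>j\<close>. All averages are means of scalar functions, taken coordinate by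
  coordinate; each asks for a bound uniform in \<open>g\<close> and for continuity in
  \<open>g\<close>. The averaged change of coordinates is triangular with identity blocks on the
  diagonal, and it is inverted level by level from the largest weight down.\<close>

lemma powr_sum_subadditive:
  fixes p :: real
  assumes "finite I" "0 < p" "p \<le> 1" "\<And>i. i \<in> I \<Longrightarrow> 0 \<le> f i"
  shows "(\<Sum>i\<in>I. f i) powr p \<le> (\<Sum>i\<in>I. f i powr p)"
proof (cases "(\<Sum>i\<in>I. f i) = 0")
  case True
  then show ?thesis by (simp add: sum_nonneg)
next
  case False
  define s where "s = (\<Sum>i\<in>I. f i)"
  have s: "s > 0"
    using False assms(4) by (simp add: s_def less_le sum_nonneg)
  \<comment> \<open>Fractions of the total lie in [0,1], where a power with exponent at most 1 only
    enlarges.\<close>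
  have "f i / s \<le> (f i / s) powr p" if "i \<in> I" for i
  proof -
    have "f i \<le> s" unfolding s_def using that assms by (intro member_le_sum) auto
    then have "(f i / s) powr 1 \<le> (f i / s) powr p"
      using assms that s by (intro powr_mono') auto
    then show ?thesis using assms that s by (cases "f i = 0") auto
  qed
  then have "(\<Sum>i\<in>I. f i / s) \<le> (\<Sum>i\<in>I. (f i / s) powr p)"
    by (rule sum_mono)
  moreover have "(\<Sum>i\<in>I. f i / s) = 1"
    using s by (simp add: s_def flip: sum_divide_distrib)
  moreover have "(\<Sum>i\<in>I. (f i / s) powr p) = (\<Sum>i\<in>I. f i powr p) / s powr p"
    using s assms by (simp add: powr_divide sum_divide_distrib)
  ultimately show ?thesis using s by (simp add: s_def field_simps)
qed

lemma powr_add_subadditive: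
  fixes p x y :: real
  assumes "0 < p" "p \<le> 1" "0 \<le> x" "0 \<le> y"
  shows "(x + y) powr p \<le> x powr p + y powr p"
  using powr_sum_subadditive[of "UNIV :: bool set" p "\<lambda>b. if b then x else y"] assms
  by (simp add: UNIV_bool add.commute)

text \<open>The weights will be the real parts of the diagonal of the Jordan form. Levels are
  indexed by coordinates and not by distinct weights, so coordinates of equal weight name the same
  level, and choices made per index have to agree on them.\<close>

locale weighted_coordinates =
  fixes w :: "'n::finite \<Rightarrow> real"
  assumes w_pos [simp]: "w i > 0"
begin

text \<open>With \<open>\<alpha> = w j\<close>, this is comparable to \<open>max\<close> of \<open>|x\<^sub>i - y\<^sub>i| powr (\<alpha> / \<alpha>\<^sub>i)\<close> over
  \<open>\<alpha>\<^sub>i \<ge> \<alpha>\<close>.  It vanishes exactly along the directions of weight less than \<open>\<alpha>\<close>.\<close>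

definition q :: "'n \<Rightarrow> real^'n \<Rightarrow> real^'n \<Rightarrow> real" where
  "q j x y = (\<Sum>k | w j \<le> w k. \<bar>x $ k - y $ k\<bar> powr (w j / w k))"

text \<open>For \<open>t > 0\<close> this is the flow of the diagonal matrix with entries
  \<open>w\<close> at time \<open>ln t\<close>; \<open>q j\<close> is homogeneous of degree
  \<open>w j\<close> under it.\<close>

definition dil :: "real \<Rightarrow> real^'n \<Rightarrow> real^'n" where
  "dil t x = (\<chi> k. t powr w k * x $ k)"

definition level :: "'n \<Rightarrow> (real^'n) set" where
  "level j = {v. \<forall>k. w k \<noteq> w j \<longrightarrow> v $ k = 0}"

definition proj :: "'n \<Rightarrow> real^'n \<Rightarrow> real^'n" where
  "proj j x = (\<chi> k. if w k = w j then x $ k else 0)"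

text \<open>The points lie in one coset of the sum of all levels of weight at most
  \<open>w j\<close>, a member of the flag that the group preserves.\<close>

definition agree_above :: "'n \<Rightarrow> real^'n \<Rightarrow> real^'n \<Rightarrow> bool" where
  "agree_above j x y \<longleftrightarrow> (\<forall>k. w k > w j \<longrightarrow> x $ k = y $ k)"

lemma w_nonneg [simp]: "w i \<ge> 0" "w i \<noteq> 0" "\<not> w i \<le> 0"
  using w_pos[of i] by linarith+

lemma exists_minimal_weight:
  obtains j0 where "w j0 = Min (range w)" "\<And>k. w j0 \<le> w k"
proof -
  have "Min (range w) \<in> range w" by (intro Min_in) auto
  then obtain j0 where "Min (range w) = w j0" by (rule rangeE)
  then show ?thesis
    using that[of j0] Min_le[of "range w"] by simp
qed

lemma q_nonneg [simp]: "q j x y \<ge> 0"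
  by (simp add: q_def sum_nonneg)

lemma q_refl [simp]: "q j x x = 0"
  by (simp add: q_def)

lemma q_commute: "q j x y = q j y x"
  by (simp add: q_def abs_minus_commute)

lemma q_triangle: "q j x z \<le> q j x y + q j y z"
proof -
  have "\<bar>x $ k - z $ k\<bar> powr (w j / w k)
      \<le> \<bar>x $ k - y $ k\<bar> powr (w j / w k) + \<bar>y $ k - z $ k\<bar> powr (w j / w k)" if "w j \<le> w k" for k
  proof -
    have "\<bar>x $ k - z $ k\<bar> powr (w j / w k) \<le> (\<bar>x $ k - y $ k\<bar> + \<bar>y $ k - z $ k\<bar>) powr (w j / w k)"
      by (intro powr_mono2) auto
    also have "\<dots> \<le> \<bar>x $ k - y $ k\<bar> powr (w j / w k) + \<bar>y $ k - z $ k\<bar> powr (w j / w k)"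
      using that by (intro powr_add_subadditive) auto
    finally show ?thesis .
  qed
  then show ?thesis
    unfolding q_def by (auto simp flip: sum.distrib intro!: sum_mono)
qed

lemma q_eq_0_iff: "q j x y = 0 \<longleftrightarrow> (\<forall>k. w j \<le> w k \<longrightarrow> x $ k = y $ k)"
  unfolding q_def by (subst sum_nonneg_eq_0_iff) auto

lemma coordinate_powr_le_q:
  assumes "w j \<le> w k"
  shows "\<bar>x $ k - y $ k\<bar> powr (w j / w k) \<le> q j x y"
  unfolding q_def using assms by (intro member_le_sum) auto

lemma coordinate_le_q_powr:
  assumes "w j \<le> w k"
  shows "\<bar>x $ k - y $ k\<bar> \<le> q j x y powr (w k / w j)"
proof -
  have "(\<bar>x $ k - y $ k\<bar> powr (w j / w k)) powr (w k / w j) \<le> q j x y powr (w k / w j)"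
    by (intro powr_mono2 coordinate_powr_le_q assms) auto
  then show ?thesis by (simp add: powr_powr)
qed

lemma coordinate_le_q:
  assumes "w k = w j"
  shows "\<bar>x $ k - y $ k\<bar> \<le> q j x y"
  using coordinate_le_q_powr[of j k x y] assms by simp

text \<open>The exponent \<open>w j / w k\<close> is at most 1, so the power may be taken inside the
  sum, where it turns \<open>w k / w l\<close> into \<open>w j / w l\<close>. This converts
  estimates at heavier levels into estimates at lighter ones.\<close>

lemma q_powr_le_q:
  assumes "w j \<le> w k"
  shows "q k x y powr (w j / w k) \<le> q j x y"
proof -
  have "q k x y powr (w j / w k)
      \<le> (\<Sum>l | w k \<le> w l. (\<bar>x $ l - y $ l\<bar> powr (w k / w l)) powr (w j / w k))"
    unfolding q_def using assms by (intro powr_sum_subadditive) auto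
  also have "\<dots> = (\<Sum>l | w k \<le> w l. \<bar>x $ l - y $ l\<bar> powr (w j / w l))"
    by (simp add: powr_powr)
  also have "\<dots> \<le> q j x y"
    unfolding q_def using assms by (intro sum_mono2) auto
  finally show ?thesis .
qed

lemma q_le_q_powr:
  assumes "w j \<le> w k"
  shows "q k x y \<le> real CARD('n) * q j x y powr (w k / w j)"
proof -
  have "\<bar>x $ l - y $ l\<bar> powr (w k / w l) \<le> q j x y powr (w k / w j)" if "w k \<le> w l" for l
  proof -
    have "(\<bar>x $ l - y $ l\<bar> powr (w j / w l)) powr (w k / w j) \<le> q j x y powr (w k / w j)"
      using that assms by (intro powr_mono2 coordinate_powr_le_q) auto
    then show ?thesis by (simp add: powr_powr)
  qed
  then have "q k x y \<le> (\<Sum>l | w k \<le> w l. q j x y powr (w k / w j))"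
    unfolding q_def by (intro sum_mono) auto
  also have "\<dots> \<le> real CARD('n) * q j x y powr (w k / w j)"
    by (auto intro!: mult_right_mono card_mono)
  finally show ?thesis .
qed

lemma q_dil:
  assumes "t > 0"
  shows "q j (p + dil t x) (p + dil t y) = t powr w j * q j x y"
proof -
  have "\<bar>(p + dil t x) $ k - (p + dil t y) $ k\<bar> powr (w j / w k)
      = t powr w j * \<bar>x $ k - y $ k\<bar> powr (w j / w k)" for k
  proof -
    have "(p + dil t x) $ k - (p + dil t y) $ k = t powr w k * (x $ k - y $ k)"
      by (simp add: dil_def algebra_simps)
    then show ?thesis
      by (simp add: abs_mult powr_mult powr_powr)
  qed
  then show ?thesis by (simp add: q_def sum_distrib_left)
qed

lemma continuous_on_q [continuous_intros]:
  assumes "continuous_on S f" "continuous_on S g"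
  shows "continuous_on S (\<lambda>s. q j (f s) (g s))"
  unfolding q_def using assms
  by (intro continuous_intros continuous_on_powr') auto

lemma continuous_on_coordinatewise_q_Lipschitz:
  fixes F :: "real^'n \<Rightarrow> real^'n"
  assumes "\<And>k x y. \<bar>F x $ k - F y $ k\<bar> \<le> C k * q k x y"
  shows "continuous_on UNIV F"
proof -
  have "((\<lambda>x. F x $ k) \<longlongrightarrow> F a $ k) (at a)" for a k
  proof -
    have "continuous_on UNIV (\<lambda>x. C k * q k x a)"
      by (intro continuous_intros)
    then have "((\<lambda>x. C k * q k x a) \<longlongrightarrow> C k * q k a a) (at a)"
      unfolding continuous_on_def by blast
    then have "((\<lambda>x. C k * q k x a) \<longlongrightarrow> 0) (at a)" by simp
    then have "((\<lambda>x. F x $ k - F a $ k) \<longlongrightarrow> 0) (at a)"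
      by (rule Lim_null_comparison[rotated]) (use assms in auto)
    then show ?thesis by (simp add: LIM_zero_iff)
  qed
  then show ?thesis
    by (simp add: continuous_on_def vec_tendstoI)
qed

lemma continuous_on_q_Lipschitz:
  fixes F :: "real^'n \<Rightarrow> real^'n"
  assumes "\<And>k x y. q k (F x) (F y) \<le> C k * q k x y"
  shows "continuous_on UNIV F"
  by (rule continuous_on_coordinatewise_q_Lipschitz) (use assms coordinate_le_q order_trans in blast)

lemma q_add_level:
  assumes "v \<in> level j"
  shows "q j x (x + v) = (\<Sum>k | w k = w j. \<bar>v $ k\<bar>)"
proof -
  have "q j x (x + v) = (\<Sum>k | w j \<le> w k. if w k = w j then \<bar>v $ k\<bar> else 0)"
    unfolding q_def by (rule sum.cong) (use assms in \<open>auto simp: level_def\<close>)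
  also have "\<dots> = (\<Sum>k | w k = w j. \<bar>v $ k\<bar>)"
    by (rule sum.mono_neutral_cong_right) auto
  finally show ?thesis .
qed

text \<open>Minimality of \<open>w j\<close> lets \<open>q j\<close> control every coordinate, so
  its balls are bounded in the Euclidean norm.\<close>

lemma compact_q_ball:
  assumes "\<And>k. w j \<le> w k"
  shows "compact {x. q j x z \<le> r}"
proof -
  have "closed {x. q j x z \<le> r}"
    by (intro closed_Collect_le continuous_intros)
  moreover have "bounded {x. q j x z \<le> r}"
  proof (cases "r \<ge> 0")
    case True
    have "norm x \<le> (\<Sum>k\<in>UNIV. \<bar>z $ k\<bar> + r powr (w k / w j))" if "q j x z \<le> r" for x
    proof -
      have "\<bar>x $ k\<bar> \<le> \<bar>z $ k\<bar> + r powr (w k / w j)" for k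
      proof -
        have "\<bar>x $ k - z $ k\<bar> \<le> q j x z powr (w k / w j)"
          by (intro coordinate_le_q_powr assms)
        also have "\<dots> \<le> r powr (w k / w j)"
          using that by (intro powr_mono2) auto
        finally show ?thesis by linarith
      qed
      then have "(\<Sum>k\<in>UNIV. \<bar>x $ k\<bar>) \<le> (\<Sum>k\<in>UNIV. \<bar>z $ k\<bar> + r powr (w k / w j))"
        by (intro sum_mono)
      then show ?thesis using norm_le_l1_cart[of x] by linarith
    qed
    then show ?thesis by (auto simp: bounded_iff)
  next
    case False
    then have "\<not> q j x z \<le> r" for x
      using q_nonneg[of j x z] by linarith
    then show ?thesis by simp
  qed
  ultimately show ?thesis by (simp add: compact_eq_bounded_closed)
qed

text \<open>Coordinates of weight less than \<open>w j\<close> can be changed at no cost, in many small steps.\<close>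

lemma q_Lipschitz_of_minimal:
  assumes j0: "\<And>k. w j0 \<le> w k" and C: "C > 0"
    and lip: "\<And>x y. q j0 (F x) (F y) \<le> C * q j0 x y"
  shows "q j (F x) (F y) \<le> real CARD('n) * C powr (w j / w j0) * q j x y"
proof -
  define K where "K = real CARD('n) * C powr (w j / w j0)"
  have K: "K \<ge> 0" using C by (simp add: K_def)
  \<comment> \<open>Changing one coordinate by \<open>c\<close> costs
    \<open>\<bar>c\<bar> powr (w j0 / w k)\<close> for \<open>q j0\<close>; the power
    \<open>w j / w j0\<close> that leads to \<open>q j\<close> produces the exponent
    \<open>w j / w k\<close>.\<close>
  have step: "q j (F x) (F (x + axis k c)) \<le> K * \<bar>c\<bar> powr (w j / w k)" for x k c
  proof -
    have "q j0 x (x + axis k c) = (\<Sum>l\<in>UNIV. if l = k then \<bar>c\<bar> powr (w j0 / w k) else 0)"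
      unfolding q_def by (rule sum.cong) (use j0 in \<open>auto simp: axis_def\<close>)
    then have e: "q j0 x (x + axis k c) = \<bar>c\<bar> powr (w j0 / w k)" by simp
    have "q j (F x) (F (x + axis k c)) \<le> real CARD('n) * q j0 (F x) (F (x + axis k c)) powr (w j / w j0)"
      by (rule q_le_q_powr) (rule j0)
    also have "\<dots> \<le> real CARD('n) * (C * \<bar>c\<bar> powr (w j0 / w k)) powr (w j / w j0)"
      using lip[of x "x + axis k c"] by (intro mult_left_mono powr_mono2) (auto simp: e)
    also have "\<dots> = K * \<bar>c\<bar> powr (w j / w k)"
      using C by (simp add: K_def powr_mult powr_powr)
    finally show ?thesis .
  qed
  have step': "q j (F x) (F (x + axis k c)) \<le> K * (if w j \<le> w k then \<bar>c\<bar> powr (w j / w k) else 0)" for x k c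
  proof (cases "w j \<le> w k")
    case True
    then show ?thesis using step by simp
  next
    case False
    define N where "N m = real (Suc m)" for m
    have many: "q j (F x) (F (x + axis k (real i * d))) \<le> real i * (K * \<bar>d\<bar> powr (w j / w k))" for i d
    proof (induction i)
      case 0
      have "axis k 0 = (0 :: real^'n)" by (simp add: vec_eq_iff axis_def)
      show ?case by (simp add: \<open>axis k 0 = 0\<close>)
    next
      case (Suc i)
      have "x + axis k (real (Suc i) * d) = (x + axis k (real i * d)) + axis k d"
        by (simp add: vec_eq_iff axis_def algebra_simps)
      then show ?case
        using q_triangle[of j "F x" "F (x + axis k (real (Suc i) * d))" "F (x + axis k (real i * d))"]
          step[of "x + axis k (real i * d)" k d] Suc by (simp add: algebra_simps)
    qed
    \<comment> \<open>Cutting the change into \<open>N m\<close> equal steps multiplies the bound by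
      \<open>N m powr (1 - w j / w k)\<close>, which tends to 0 because here
      \<open>w j > w k\<close>.\<close>
    have le: "q j (F x) (F (x + axis k c)) \<le> K * \<bar>c\<bar> powr (w j / w k) * N m powr (1 - w j / w k)" for m
    proof -
      have "q j (F x) (F (x + axis k c)) \<le> N m * (K * \<bar>c / N m\<bar> powr (w j / w k))"
        using many[of "Suc m" "c / N m"] by (simp add: N_def)
      also have "\<dots> = K * \<bar>c\<bar> powr (w j / w k) * (N m powr 1 / N m powr (w j / w k))"
        by (simp add: N_def powr_divide abs_divide)
      also have "\<dots> = K * \<bar>c\<bar> powr (w j / w k) * N m powr (1 - w j / w k)"
        by (simp add: powr_diff)
      finally show ?thesis .
    qed
    have "filterlim N at_top sequentially"
      unfolding N_def using filterlim_compose[OF filterlim_real_sequentially filterlim_Suc] by simp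
    then have "(\<lambda>m. N m powr (1 - w j / w k)) \<longlonglongrightarrow> 0"
      using False by (intro tendsto_neg_powr) auto
    then have "(\<lambda>m. K * \<bar>c\<bar> powr (w j / w k) * N m powr (1 - w j / w k)) \<longlonglongrightarrow> K * \<bar>c\<bar> powr (w j / w k) * 0"
      by (rule tendsto_mult_left)
    then have "q j (F x) (F (x + axis k c)) \<le> K * \<bar>c\<bar> powr (w j / w k) * 0"
      by (rule LIMSEQ_le_const) (use le in auto)
    then show ?thesis using False by simp
  qed
  \<comment> \<open>A path along the axes, one coordinate at a time; only coordinates of weight at
    least \<open>w j\<close> contribute.\<close>
  have "q j (F x) (F (x + (\<Sum>k\<in>I. axis k (v $ k))))
      \<le> (\<Sum>k\<in>I. K * (if w j \<le> w k then \<bar>v $ k\<bar> powr (w j / w k) else 0))" if "finite I" for I x v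
    using that
  proof (induction I arbitrary: x)
    case (insert k I)
    let ?x = "x + axis k (v $ k)"
    have "q j (F x) (F (x + (\<Sum>k\<in>insert k I. axis k (v $ k))))
      \<le> q j (F x) (F ?x) + q j (F ?x) (F (?x + (\<Sum>k\<in>I. axis k (v $ k))))"
      using insert by (simp add: q_triangle add.assoc)
    also have "\<dots> \<le> K * (if w j \<le> w k then \<bar>v $ k\<bar> powr (w j / w k) else 0)
      + (\<Sum>k\<in>I. K * (if w j \<le> w k then \<bar>v $ k\<bar> powr (w j / w k) else 0))"
      by (intro add_mono step' insert.IH)
    finally show ?case using insert by simp
  qed simp
  from this[OF finite_class.finite_UNIV, of x "y - x"]
  have "q j (F x) (F (x + (\<Sum>k\<in>UNIV. axis k ((y - x) $ k))))
    \<le> (\<Sum>k\<in>UNIV. K * (if w j \<le> w k then \<bar>(y - x) $ k\<bar> powr (w j / w k) else 0))" .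
  also have "(\<Sum>k\<in>UNIV. axis k ((y - x) $ k)) = y - x"
    by (simp add: vec_eq_iff axis_def)
  finally have "q j (F x) (F y) \<le> (\<Sum>k\<in>UNIV. K * (if w j \<le> w k then \<bar>y $ k - x $ k\<bar> powr (w j / w k) else 0))"
    by (simp only: add_diff_cancel_left' diff_add_cancel vector_minus_component add.commute[of x])
  also have "\<dots> = K * q j y x"
    unfolding q_def sum_distrib_left[symmetric] by (simp add: sum.If_cases)
  finally show ?thesis by (simp add: K_def q_commute)
qed

end

section \<open>Invariant means and the scaling character\<close>

lemma continuous_map_compose_on:
  fixes f :: "'a \<Rightarrow> 'b::topological_space" and g :: "'b \<Rightarrow> 'c::topological_space"
  assumes "continuous_map T euclidean f" "continuous_on S g" "\<And>x. x \<in> topspace T \<Longrightarrow> f x \<in> S"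
  shows "continuous_map T euclidean (\<lambda>x. g (f x))"
proof -
  have "continuous_map T (top_of_set S) f"
    using assms by (simp add: continuous_map_into_subtopology image_subset_iff)
  moreover have "continuous_map (top_of_set S) euclidean g"
    using assms by (simp add: continuous_map_iff_continuous)
  ultimately show ?thesis
    using continuous_map_compose[of T "top_of_set S" f euclidean g] by (simp add: o_def)
qed

lemma continuous_map_compose_on2:
  fixes f :: "'a \<Rightarrow> 'b::topological_space" and g :: "'a \<Rightarrow> 'c::topological_space"
    and h :: "'b \<Rightarrow> 'c \<Rightarrow> 'd::topological_space"
  assumes "continuous_map T euclidean f" "continuous_map T euclidean g"
    "continuous_on UNIV (\<lambda>z. h (fst z) (snd z))"
  shows "continuous_map T euclidean (\<lambda>x. h (f x) (g x))"
proof -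
  have "continuous_map T euclidean (\<lambda>x. (f x, g x))"
    using assms continuous_map_pairedI[of T euclidean f euclidean g]
    by simp
  from continuous_map_compose_on[OF this assms(3)] show ?thesis by simp
qed

section \<open>Bounded continuous functions\<close>

lemma bounded_continuousI:
  assumes "continuous_map T euclideanreal \<phi>" "\<And>g. g \<in> topspace T \<Longrightarrow> \<bar>\<phi> g\<bar> \<le> B"
  shows "bounded_continuous T \<phi>"
  using assms by (auto simp: bounded_continuous_def bounded_iff)

lemma bounded_continuousD:
  assumes "bounded_continuous T \<phi>"
  shows "continuous_map T euclideanreal \<phi>" "\<exists>B. \<forall>g\<in>topspace T. \<bar>\<phi> g\<bar> \<le> B"
  using assms by (auto simp: bounded_continuous_def bounded_iff)

lemma bounded_continuous_const: "bounded_continuous T (\<lambda>g. c)"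
  by (rule bounded_continuousI[where B = "\<bar>c\<bar>"]) auto

lemma bounded_continuous_add:
  assumes "bounded_continuous T \<phi>" "bounded_continuous T \<psi>"
  shows "bounded_continuous T (\<lambda>g. \<phi> g + \<psi> g)"
proof -
  obtain B B' where "\<forall>g\<in>topspace T. \<bar>\<phi> g\<bar> \<le> B" "\<forall>g\<in>topspace T. \<bar>\<psi> g\<bar> \<le> B'"
    using bounded_continuousD(2) assms by metis
  then have "\<forall>g\<in>topspace T. \<bar>\<phi> g + \<psi> g\<bar> \<le> B + B'"
    by (metis abs_triangle_ineq add_mono order_trans)
  then show ?thesis
    using bounded_continuousD(1) assms by (intro bounded_continuousI[where B = "B + B'"] continuous_intros) auto
qed

lemma bounded_continuous_cmult:
  assumes "bounded_continuous T \<phi>"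
  shows "bounded_continuous T (\<lambda>g. c * \<phi> g)"
proof -
  obtain B where "\<forall>g\<in>topspace T. \<bar>\<phi> g\<bar> \<le> B"
    using bounded_continuousD(2) assms by metis
  then have "\<forall>g\<in>topspace T. \<bar>c * \<phi> g\<bar> \<le> \<bar>c\<bar> * B"
    by (auto simp: abs_mult intro!: mult_left_mono)
  then show ?thesis
    using bounded_continuousD(1) assms
    by (intro bounded_continuousI[where B = "\<bar>c\<bar> * B"] continuous_intros) auto
qed

lemma bounded_continuous_diff:
  assumes "bounded_continuous T \<phi>" "bounded_continuous T \<psi>"
  shows "bounded_continuous T (\<lambda>g. \<phi> g - \<psi> g)"
  using bounded_continuous_add[OF assms(1) bounded_continuous_cmult[OF assms(2), of "-1"]] by simp

lemma bounded_continuous_sum: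
  assumes "\<And>i. i \<in> I \<Longrightarrow> bounded_continuous T (\<phi> i)"
  shows "bounded_continuous T (\<lambda>g. \<Sum>i\<in>I. \<phi> i g)"
  using assms
  by (induction I rule: infinite_finite_induct) (auto intro: bounded_continuous_const bounded_continuous_add)

section \<open>Calculus of means\<close>

context
  fixes T :: "'g topology" and m :: "('g \<Rightarrow> real) \<Rightarrow> real"
  assumes mean: "is_mean T m"
begin

lemma mean_add:
  "bounded_continuous T \<phi> \<Longrightarrow> bounded_continuous T \<psi> \<Longrightarrow> m (\<lambda>g. \<phi> g + \<psi> g) = m \<phi> + m \<psi>"
  using mean by (auto simp: is_mean_def)

lemma mean_cmult: "bounded_continuous T \<phi> \<Longrightarrow> m (\<lambda>g. c * \<phi> g) = c * m \<phi>"
  using mean by (auto simp: is_mean_def)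

lemma mean_diff:
  "bounded_continuous T \<phi> \<Longrightarrow> bounded_continuous T \<psi> \<Longrightarrow> m (\<lambda>g. \<phi> g - \<psi> g) = m \<phi> - m \<psi>"
  using mean_add[of \<phi> "\<lambda>g. -1 * \<psi> g"] mean_cmult[of \<psi> "-1"] bounded_continuous_cmult[of T \<psi> "-1"] by simp

lemma mean_const: "m (\<lambda>g. c) = c"
  using mean_cmult[OF bounded_continuous_const, of c 1] mean by (simp add: is_mean_def)

lemma mean_sum:
  assumes "\<And>i. i \<in> I \<Longrightarrow> bounded_continuous T (\<phi> i)"
  shows "m (\<lambda>g. \<Sum>i\<in>I. \<phi> i g) = (\<Sum>i\<in>I. m (\<phi> i))"
  using assms
  by (induction I rule: infinite_finite_induct) (auto simp: mean_const mean_add bounded_continuous_sum)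

lemma mean_mono:
  assumes "bounded_continuous T \<phi>" "bounded_continuous T \<psi>" "\<And>g. g \<in> topspace T \<Longrightarrow> \<phi> g \<le> \<psi> g"
  shows "m \<phi> \<le> m \<psi>"
proof -
  have "m (\<lambda>g. \<psi> g - \<phi> g) \<ge> 0"
    using mean bounded_continuous_diff[OF assms(2,1)] assms(3) unfolding is_mean_def by auto
  then show ?thesis using mean_diff[OF assms(2,1)] by simp
qed

text \<open>Positivity applied to both differences. Continuity and boundedness pass from
  \<open>\<phi>\<close> to \<open>\<psi>\<close> because both notions see only
  \<open>topspace T\<close>.\<close>

lemma mean_cong:
  assumes "bounded_continuous T \<phi>" "\<And>g. g \<in> topspace T \<Longrightarrow> \<phi> g = \<psi> g"
  shows "m \<phi> = m \<psi>"
proof -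
  have "continuous_map T euclideanreal \<psi>"
    using assms bounded_continuousD(1) by (metis continuous_map_eq)
  moreover have "\<psi> ` topspace T = \<phi> ` topspace T"
    using assms(2) by (simp cong: image_cong_simp)
  ultimately have "bounded_continuous T \<psi>"
    using assms(1) by (simp add: bounded_continuous_def)
  then show ?thesis
    using assms by (intro antisym mean_mono) auto
qed

lemma mean_le:
  assumes "bounded_continuous T \<phi>" "\<And>g. g \<in> topspace T \<Longrightarrow> \<phi> g \<le> B"
  shows "m \<phi> \<le> B"
  using mean_mono[OF assms(1) bounded_continuous_const assms(2)] by (simp add: mean_const)

lemma mean_ge:
  assumes "bounded_continuous T \<phi>" "\<And>g. g \<in> topspace T \<Longrightarrow> B \<le> \<phi> g"
  shows "B \<le> m \<phi>"
  using mean_mono[OF bounded_continuous_const assms(1) assms(2)] by (simp add: mean_const)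

end

text \<open>Continuity is asked of the orbit maps only; in this form it passes to the conjugate of
  the action by any homeomorphism, which is how charts are changed later.\<close>

locale amenable_action =
  fixes G :: "('g, 'b) monoid_scheme" (structure)
    and T :: "'g topology"
    and m :: "('g \<Rightarrow> real) \<Rightarrow> real"
    and act :: "'g \<Rightarrow> 'a::topological_space \<Rightarrow> 'a"
  assumes group_G: "group G"
    and topspace_T: "topspace T = carrier G"
    and continuous_inv: "continuous_map T T (\<lambda>g. inv g)"
    and mean_m: "is_mean T m"
    and mean_invariant: "\<And>h \<phi>. h \<in> carrier G \<Longrightarrow> bounded_continuous T \<phi> \<Longrightarrow> m (\<lambda>g. \<phi> (h \<otimes> g)) = m \<phi>"
    and act_mult: "\<And>g h x. g \<in> carrier G \<Longrightarrow> h \<in> carrier G \<Longrightarrow> act (g \<otimes> h) x = act g (act h x)"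
    and act_one [simp]: "\<And>x. act \<one> x = x"
    and continuous_act: "\<And>x. continuous_map T euclidean (\<lambda>g. act g x)"
begin

lemma closed_G [simp, intro]:
  "\<one> \<in> carrier G" "g \<in> carrier G \<Longrightarrow> inv g \<in> carrier G"
  "g \<in> carrier G \<Longrightarrow> h \<in> carrier G \<Longrightarrow> g \<otimes> h \<in> carrier G"
  by (simp_all add: group.inv_closed[OF group_G] monoid.m_closed[OF group.is_monoid[OF group_G]]
      monoid.one_closed[OF group.is_monoid[OF group_G]])

lemma act_inv [simp]:
  assumes "g \<in> carrier G"
  shows "act g (act (inv g) x) = x" "act (inv g) (act g x) = x"
  using assms act_mult[of g "inv g" x] act_mult[of "inv g" g x]
    group.r_inv[OF group_G] group.l_inv[OF group_G] by auto

lemma continuous_act_inv: "continuous_map T euclidean (\<lambda>g. act (inv g) x)"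
  using continuous_map_compose[OF continuous_inv continuous_act[of x]] by (simp add: o_def)

end

locale weighted_action = weighted_coordinates w + amenable_action G T m act
  for w :: "'n::finite \<Rightarrow> real" and G :: "('g, 'b) monoid_scheme" (structure)
    and T m and act :: "'g \<Rightarrow> real^'n \<Rightarrow> real^'n" +
  fixes K :: real
  assumes K1: "K \<ge> 1"

text \<open>The scale of \<open>g\<close> is only a quasimorphism; averaging its defect over \<open>G\<close> makes it a
  homomorphism.\<close>

lemma (in weighted_action) exists_scaling_character:
  assumes quasi: "\<And>g. g \<in> carrier G \<Longrightarrow> \<exists>l. \<forall>j x y.
      exp (w j * l) / K * q j x y \<le> q j (act g x) (act g y) \<and>
      q j (act g x) (act g y) \<le> K * exp (w j * l) * q j x y"
  obtains chi K' where "K' \<ge> 1"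
    "\<And>g h. g \<in> carrier G \<Longrightarrow> h \<in> carrier G \<Longrightarrow> chi (g \<otimes> h) = chi g + (chi h :: real)"
    "\<And>g j x y. g \<in> carrier G \<Longrightarrow> exp (w j * chi g) / K' * q j x y \<le> q j (act g x) (act g y)"
    "\<And>g j x y. g \<in> carrier G \<Longrightarrow> q j (act g x) (act g y) \<le> K' * exp (w j * chi g) * q j x y"
proof -
  obtain l where l: "\<And>g j x y. g \<in> carrier G \<Longrightarrow> exp (w j * l g) / K * q j x y \<le> q j (act g x) (act g y)"
    "\<And>g j x y. g \<in> carrier G \<Longrightarrow> q j (act g x) (act g y) \<le> K * exp (w j * l g) * q j x y"
    using quasi by metis
  have cont: "continuous_on UNIV (act g)" if "g \<in> carrier G" for g
    by (rule continuous_on_q_Lipschitz[where C = "\<lambda>k. K * exp (w k * l g)"]) (rule l(2)[OF that])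
  obtain j0 :: 'n where True by blast
  define u :: "real^'n" where "u = axis j0 1"
  \<comment> \<open>The length of one test segment after moving it by \<open>g\<close>: its
    logarithm is the scale of \<open>g\<close> up to a bounded error.\<close>
  define c where "c g = q j0 (act g 0) (act g u)" for g
  have u: "q j0 0 u > 0"
    using q_eq_0_iff[of j0 0 u] q_nonneg[of j0 0 u] by (auto simp: u_def less_le)
  have c_pos: "c g > 0" if "g \<in> carrier G" for g
  proof -
    have "0 < exp (w j0 * l g) / K * q j0 0 u"
      using u K1 by simp
    also have "\<dots> \<le> c g"
      unfolding c_def by (rule l(1)[OF that])
    finally show ?thesis .
  qed
  \<comment> \<open>The growth of the moved test segment under \<open>h\<close>. It stays within
    \<open>ln K\<close> of \<open>w j0 * l h\<close> for every \<open>g\<close>, so it has a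
    mean.\<close>
  define \<phi> where "\<phi> h g = ln (c (h \<otimes> g)) - ln (c g)" for h g
  have bounds: "\<bar>\<phi> h g - w j0 * l h\<bar> \<le> ln K" if "h \<in> carrier G" "g \<in> carrier G" for h g
  proof -
    have c_eq: "c (h \<otimes> g) = q j0 (act h (act g 0)) (act h (act g u))"
      using that by (simp add: c_def act_mult)
    have "ln (exp (w j0 * l h) / K * c g) \<le> ln (c (h \<otimes> g))"
      using l(1)[OF that(1), of j0 "act g 0" "act g u"] c_pos[of g] c_pos[of "h \<otimes> g"] that K1
      by (subst ln_le_cancel_iff) (auto simp: c_eq, simp add: c_def)
    moreover have "ln (c (h \<otimes> g)) \<le> ln (K * exp (w j0 * l h) * c g)"
      using l(2)[OF that(1), of j0 "act g 0" "act g u"] c_pos[of g] c_pos[of "h \<otimes> g"] that K1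
      by (subst ln_le_cancel_iff) (auto simp: c_eq, simp add: c_def)
    ultimately show ?thesis
      using c_pos[OF that(2)] K1 by (simp add: \<phi>_def ln_mult ln_div abs_le_iff)
  qed
  have bc: "bounded_continuous T (\<phi> h)" if "h \<in> carrier G" for h
  proof (rule bounded_continuousI)
    have "continuous_map T euclidean (\<lambda>g. c g)"
      unfolding c_def
      by (intro continuous_map_compose_on2[OF continuous_act continuous_act] continuous_intros)
    then have 1: "continuous_map T euclidean (\<lambda>g. ln (c g))"
      by (rule continuous_map_compose_on[where S = "{0<..}"])
        (use c_pos topspace_T in \<open>auto intro!: continuous_intros\<close>)
    have pos: "q j0 (act h (act g 0)) (act h (act g u)) > 0" if "g \<in> topspace T" for g
      using c_pos[of "h \<otimes> g"] that \<open>h \<in> carrier G\<close> by (simp add: c_def act_mult topspace_T)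
    have "continuous_map T euclidean (\<lambda>g. q j0 (act h (act g 0)) (act h (act g u)))"
      by (rule continuous_map_compose_on2[OF continuous_act continuous_act])
        (intro continuous_intros continuous_on_compose2[OF cont[OF that]] subset_UNIV)
    then have "continuous_map T euclidean (\<lambda>g. ln (q j0 (act h (act g 0)) (act h (act g u))))"
      by (rule continuous_map_compose_on[where S = "{0<..}"])
        (use pos in \<open>auto intro!: continuous_intros\<close>)
    then have 2: "continuous_map T euclidean (\<lambda>g. ln (c (h \<otimes> g)))"
      by (rule continuous_map_eq) (use that topspace_T in \<open>simp add: c_def act_mult\<close>)
    show "continuous_map T euclideanreal (\<phi> h)"
      unfolding \<phi>_def by (intro continuous_intros 1 2)
    show "\<bar>\<phi> h g\<bar> \<le> ln K + \<bar>w j0 * l h\<bar>" if "g \<in> topspace T" for g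
      using bounds[OF \<open>h \<in> carrier G\<close>, of g] that topspace_T by (auto simp: abs_le_iff)
  qed
  define chi where "chi h = m (\<phi> h) / w j0" for h
  have chi_l: "\<bar>chi h - l h\<bar> \<le> ln K / w j0" if "h \<in> carrier G" for h
  proof -
    have "m (\<phi> h) \<le> w j0 * l h + ln K"
      by (rule mean_le[OF mean_m bc[OF that]]) (use bounds[OF that] topspace_T in \<open>force simp: abs_le_iff\<close>)
    moreover have "w j0 * l h - ln K \<le> m (\<phi> h)"
      by (rule mean_ge[OF mean_m bc[OF that]]) (use bounds[OF that] topspace_T in \<open>force simp: abs_le_iff\<close>)
    ultimately have "\<bar>m (\<phi> h) - w j0 * l h\<bar> / w j0 \<le> ln K / w j0"
      by (intro divide_right_mono) auto
    moreover have "\<bar>m (\<phi> h) - w j0 * l h\<bar> / w j0 = \<bar>chi h - l h\<bar>"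
      by (subst abs_div_pos) (auto simp: chi_def diff_divide_distrib)
    ultimately show ?thesis by simp
  qed
  have hom: "chi (h \<otimes> k) = chi h + chi k" if "h \<in> carrier G" "k \<in> carrier G" for h k
  proof -
    \<comment> \<open>The cocycle identity; invariance of the mean under left translation by
      \<open>k\<close> turns it into additivity of \<open>chi\<close>.\<close>
    have *: "\<phi> (h \<otimes> k) g - \<phi> k g = \<phi> h (k \<otimes> g)" if "g \<in> topspace T" for g
      using that \<open>h \<in> carrier G\<close> \<open>k \<in> carrier G\<close> monoid.m_assoc[OF group.is_monoid[OF group_G]]
      by (simp add: \<phi>_def topspace_T)
    have "m (\<phi> (h \<otimes> k)) - m (\<phi> k) = m (\<lambda>g. \<phi> (h \<otimes> k) g - \<phi> k g)"
      using that by (intro mean_diff[OF mean_m, symmetric] bc) auto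
    also have "\<dots> = m (\<lambda>g. \<phi> h (k \<otimes> g))"
      using that * by (intro mean_cong[OF mean_m] bounded_continuous_diff bc) auto
    also have "\<dots> = m (\<phi> h)"
      using that by (intro mean_invariant bc) auto
    finally show ?thesis by (simp add: chi_def field_simps)
  qed
  define W where "W = Max (range w)"
  \<comment> \<open>The price of replacing \<open>l\<close> by \<open>chi\<close>: the two differ by
    at most \<open>ln K / w j0\<close>, and the exponent multiplies this by a weight, at most
    \<open>W\<close>.\<close>
  define K' where "K' = K * exp (W * (ln K / w j0))"
  have W: "w j \<le> W" for j by (simp add: W_def)
  have W0: "W \<ge> 0" using W[of j0] w_pos[of j0] by linarith
  have lnK: "ln K / w j0 \<ge> 0" using K1 by simp
  have K'_ge: "K * exp \<bar>w j * (l g - chi g)\<bar> \<le> K'" if "g \<in> carrier G" for g j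
  proof -
    have "\<bar>w j * (l g - chi g)\<bar> \<le> W * (ln K / w j0)"
      unfolding abs_mult by (intro mult_mono) (use W W0 chi_l[OF that] lnK in \<open>auto simp: abs_minus_commute\<close>)
    then show ?thesis using K1 by (simp add: K'_def)
  qed
  show ?thesis
  proof
    have "1 * 1 \<le> K'"
      unfolding K'_def using K1 lnK W0 by (intro mult_mono) auto
    then show "K' \<ge> 1" by simp
    show "chi (g \<otimes> h) = chi g + chi h" if "g \<in> carrier G" "h \<in> carrier G" for g h
      by (rule hom[OF that])
    fix g j x y assume g: "g \<in> carrier G"
    have e: "exp (w j * chi g) = exp (w j * l g) * exp (w j * (chi g - l g))"
      "exp (w j * l g) = exp (w j * chi g) * exp (w j * (l g - chi g))"
      by (simp_all add: algebra_simps flip: exp_add)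
    have "K * exp (w j * (chi g - l g)) \<le> K'"
      by (rule order_trans[OF _ K'_ge[OF g, of j]]) (use K1 in \<open>auto simp: algebra_simps abs_if\<close>)
    then have "exp (w j * l g) * (K * exp (w j * (chi g - l g))) \<le> exp (w j * l g) * K'"
      by (intro mult_left_mono) auto
    then have "K * exp (w j * chi g) \<le> K' * exp (w j * l g)"
      by (subst e(1)) (simp only: ac_simps)
    then have "exp (w j * chi g) / K' \<le> exp (w j * l g) / K"
      using K1 \<open>K' \<ge> 1\<close> by (simp add: field_simps)
    then have "exp (w j * chi g) / K' * q j x y \<le> exp (w j * l g) / K * q j x y"
      by (intro mult_right_mono) auto
    then show "exp (w j * chi g) / K' * q j x y \<le> q j (act g x) (act g y)"
      using l(1)[OF g, of j x y] by linarith
    have "K * exp (w j * (l g - chi g)) \<le> K'"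
      by (rule order_trans[OF _ K'_ge[OF g, of j]]) (use K1 in \<open>auto simp: algebra_simps abs_if\<close>)
    then have "exp (w j * chi g) * (K * exp (w j * (l g - chi g))) \<le> exp (w j * chi g) * K'"
      by (intro mult_left_mono) auto
    then have "K * exp (w j * l g) \<le> K' * exp (w j * chi g)"
      by (subst e(2)) (simp only: ac_simps)
    then have "K * exp (w j * l g) * q j x y \<le> K' * exp (w j * chi g) * q j x y"
      by (intro mult_right_mono) auto
    then show "q j (act g x) (act g y) \<le> K' * exp (w j * chi g) * q j x y"
      using l(2)[OF g, of j x y] by (meson order_trans)
  qed
qed

text \<open>The common base of the action before and after straightening: the character stays the
  same, while the metric estimates are stated anew in each situation.\<close>

locale graded_action = weighted_action w G T m act K
  for w :: "'n::finite \<Rightarrow> real" and G :: "('g, 'b) monoid_scheme" (structure)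
    and T m and act :: "'g \<Rightarrow> real^'n \<Rightarrow> real^'n" and K +
  fixes chi :: "'g \<Rightarrow> real"
  assumes chi_mult: "\<And>g h. g \<in> carrier G \<Longrightarrow> h \<in> carrier G \<Longrightarrow> chi (g \<otimes> h) = chi g + chi h"
begin

lemma K_pos [simp]: "K > 0" "K \<ge> 0"
  using K1 by auto

lemma chi_one [simp]: "chi \<one> = 0"
proof -
  have "\<one> \<otimes> \<one> = \<one>"
    using group.is_monoid[OF group_G] by (simp add: monoid.l_one)
  then show ?thesis
    using chi_mult[of \<one> \<one>] by simp
qed

lemma chi_inv [simp]: "g \<in> carrier G \<Longrightarrow> chi (inv g) = - chi g"
  using chi_mult[of g "inv g"] group.r_inv[OF group_G, of g] by simp

end

locale scaled_action = graded_action w G T m act K chi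
  for w :: "'n::finite \<Rightarrow> real" and G :: "('g, 'b) monoid_scheme" (structure)
    and T m and act :: "'g \<Rightarrow> real^'n \<Rightarrow> real^'n" and K chi +
  assumes q_act_ge: "\<And>g j x y. g \<in> carrier G \<Longrightarrow> exp (w j * chi g) / K * q j x y \<le> q j (act g x) (act g y)"
    and q_act_le: "\<And>g j x y. g \<in> carrier G \<Longrightarrow> q j (act g x) (act g y) \<le> K * exp (w j * chi g) * q j x y"
begin

definition rho :: "'n \<Rightarrow> real^'n \<Rightarrow> real^'n \<Rightarrow> real" where
  "rho j x y = (SUP g\<in>carrier G. exp (- (w j * chi g)) * q j (act g x) (act g y))"

lemma rho_upper:
  assumes "g \<in> carrier G"
  shows "exp (- (w j * chi g)) * q j (act g x) (act g y) \<le> K * q j x y"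
proof -
  have "exp (- (w j * chi g)) * q j (act g x) (act g y)
    \<le> exp (- (w j * chi g)) * (K * exp (w j * chi g) * q j x y)"
    by (intro mult_left_mono q_act_le assms) auto
  also have "\<dots> = K * q j x y"
    by (simp add: exp_minus)
  finally show ?thesis .
qed

lemma rho_ge:
  assumes "g \<in> carrier G"
  shows "exp (- (w j * chi g)) * q j (act g x) (act g y) \<le> rho j x y"
  unfolding rho_def using rho_upper assms by (intro cSUP_upper) (auto intro!: bdd_aboveI2)

lemma rho_leI:
  assumes "\<And>g. g \<in> carrier G \<Longrightarrow> exp (- (w j * chi g)) * q j (act g x) (act g y) \<le> B"
  shows "rho j x y \<le> B"
  unfolding rho_def using assms by (intro cSUP_least) auto

lemma rho_le_q: "rho j x y \<le> K * q j x y"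
  by (rule rho_leI) (rule rho_upper)

lemma q_le_rho: "q j x y \<le> rho j x y"
  using rho_ge[of \<one> j x y] by simp

lemma rho_commute: "rho j x y = rho j y x"
  by (simp add: rho_def q_commute)

lemma rho_triangle: "rho j x z \<le> rho j x y + rho j y z"
proof (rule rho_leI)
  fix g assume g: "g \<in> carrier G"
  have "exp (- (w j * chi g)) * q j (act g x) (act g z)
    \<le> exp (- (w j * chi g)) * (q j (act g x) (act g y) + q j (act g y) (act g z))"
    by (intro mult_left_mono q_triangle) auto
  then show "exp (- (w j * chi g)) * q j (act g x) (act g z) \<le> rho j x y + rho j y z"
    using rho_ge[OF g, of j x y] rho_ge[OF g, of j y z] by (simp add: distrib_left)
qed

text \<open>Replacing \<open>g\<close> by \<open>g \<otimes> h\<close> in the supremum gives one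
  inequality; the same inequality for \<open>inv h\<close> gives the other.\<close>

lemma rho_act:
  assumes h: "h \<in> carrier G"
  shows "rho j (act h x) (act h y) = exp (w j * chi h) * rho j x y"
proof -
  have le: "rho j (act h x) (act h y) \<le> exp (w j * chi h) * rho j x y" if h: "h \<in> carrier G" for h x y
  proof (rule rho_leI)
    fix g assume g: "g \<in> carrier G"
    have "exp (- (w j * chi g)) * q j (act g (act h x)) (act g (act h y))
      = exp (w j * chi h) * (exp (- (w j * chi (g \<otimes> h))) * q j (act (g \<otimes> h) x) (act (g \<otimes> h) y))"
      using g h by (simp add: chi_mult act_mult algebra_simps flip: exp_add)
    also have "\<dots> \<le> exp (w j * chi h) * rho j x y"
      using g h by (intro mult_left_mono rho_ge) auto
    finally show "exp (- (w j * chi g)) * q j (act g (act h x)) (act g (act h y)) \<le> exp (w j * chi h) * rho j x y" .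
  qed
  have "rho j x y \<le> exp (- (w j * chi h)) * rho j (act h x) (act h y)"
    using le[of "inv h" "act h x" "act h y"] h by simp
  then have "exp (w j * chi h) * rho j x y \<le> exp (w j * chi h) * (exp (- (w j * chi h)) * rho j (act h x) (act h y))"
    by (intro mult_left_mono) auto
  also have "\<dots> = rho j (act h x) (act h y)"
    by (simp add: exp_minus)
  finally show ?thesis using le[OF h, of x y] by simp
qed

end

section \<open>Zooming in\<close>

text \<open>Tychonoff's theorem, phrased for the topology of the function type.\<close>

lemma compact_pointwise:
  fixes S :: "'a \<Rightarrow> 'b::topological_space set"
  assumes "\<And>i. compact (S i)"
  shows "compact {f. \<forall>i. f i \<in> S i}"
proof -
  have "compactin (product_topology (\<lambda>_. euclidean) UNIV) (PiE UNIV S)"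
    using assms by (simp add: compactin_PiE)
  moreover have "PiE UNIV S = {f. \<forall>i. f i \<in> S i}" by auto
  ultimately show ?thesis by (simp add: euclidean_product_topology)
qed

lemma continuous_on_eval:
  fixes S :: "('i \<Rightarrow> 'b::topological_space) set"
  shows "continuous_on S (\<lambda>f. f i)"
  by (rule continuous_on_subset[OF continuous_on_product_coordinates subset_UNIV])

lemmas eval_intros = continuous_on_const continuous_on_eval continuous_on_add continuous_on_mult

text \<open>Distances of all levels as one function on triples, so that pointwise convergence of all
  of them at once is the topology of the function type.\<close>

type_synonym 'n lengths = "'n \<times> (real, 'n) vec \<times> (real, 'n) vec \<Rightarrow> real"

context weighted_coordinates
begin

definition admissible :: "real \<Rightarrow> 'n lengths set" where
  "admissible K = {\<sigma>. \<forall>j x y z. \<sigma> (j, x, y) = \<sigma> (j, y, x) \<and>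
     \<sigma> (j, x, z) \<le> \<sigma> (j, x, y) + \<sigma> (j, y, z) \<and> q j x y \<le> \<sigma> (j, x, y) \<and> \<sigma> (j, x, y) \<le> K * q j x y}"

text \<open>Pullback under \<open>x \<mapsto> p + dil t x\<close>, normalised so that
  \<open>q\<close> itself is fixed; the comparison with \<open>q\<close> therefore keeps its
  constants.\<close>

definition zoom :: "real^'n \<Rightarrow> real \<Rightarrow> 'n lengths \<Rightarrow> 'n lengths" where
  "zoom p t \<sigma> = (\<lambda>(j, x, y). t powr (- w j) * \<sigma> (j, p + dil t x, p + dil t y))"

definition zoom_invariant :: "'n lengths set \<Rightarrow> bool" where
  "zoom_invariant X \<longleftrightarrow> (\<forall>\<sigma>\<in>X. \<forall>p t. t > 0 \<longrightarrow> zoom p t \<sigma> \<in> X)"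

text \<open>Two conditions in one closed equation: \<open>t = 1\<close> gives independence of the
  base point, \<open>x = y\<close> gives homogeneity. All lines in direction \<open>v\<close> have
  the same constant speed.\<close>

definition straight :: "'n \<Rightarrow> real^'n \<Rightarrow> 'n lengths set" where
  "straight j v = {\<sigma>. \<forall>x y t. t \<ge> 0 \<longrightarrow> \<sigma> (j, x, x + t *\<^sub>R v) = t * \<sigma> (j, y, y + v)}"

lemma zoom_apply: "zoom p t \<sigma> (j, x, y) = t powr (- w j) * \<sigma> (j, p + dil t x, p + dil t y)"
  by (simp add: zoom_def)

lemma dil_zero [simp]: "dil t 0 = 0"
  by (simp add: dil_def vec_eq_iff)

lemma dil_one [simp]: "dil 1 x = x"
  by (simp add: dil_def vec_eq_iff)

lemma dil_add: "dil t (x + y) = dil t x + dil t y"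
  by (simp add: dil_def vec_eq_iff algebra_simps)

lemma dil_dil: "s > 0 \<Longrightarrow> t > 0 \<Longrightarrow> dil s (dil t x) = dil (s * t) x"
  by (simp add: dil_def vec_eq_iff powr_mult)

lemma dil_level:
  assumes "v \<in> level j"
  shows "dil t v = t powr w j *\<^sub>R v"
  using assms by (auto simp: dil_def vec_eq_iff level_def) (metis mult_eq_0_iff)

lemma zero_in_level [simp]: "0 \<in> level j"
  by (simp add: level_def)

lemma scaleR_in_level [simp]: "v \<in> level j \<Longrightarrow> t *\<^sub>R v \<in> level j"
  by (simp add: level_def)

lemma q_translate: "q j (z + x) (z + y) = q j x y"
  by (simp add: q_def)

lemma zoom_zoom: "s > 0 \<Longrightarrow> t > 0 \<Longrightarrow> zoom p s (zoom r t \<sigma>) = zoom (r + dil t p) (s * t) \<sigma>"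
  by (auto simp: zoom_def fun_eq_iff dil_add dil_dil powr_mult algebra_simps)

text \<open>The parameter \<open>t powr (1 / w j)\<close> is the one whose dilation multiplies level
  \<open>j\<close> by exactly \<open>t\<close>.\<close>

lemma zoom_level:
  assumes "t > 0" "v \<in> level j"
  shows "zoom p (t powr (1 / w j)) \<sigma> (j, x, x + v)
    = \<sigma> (j, p + dil (t powr (1 / w j)) x, p + dil (t powr (1 / w j)) x + t *\<^sub>R v) / t"
  using assms by (simp add: zoom_apply dil_add dil_level powr_powr add.assoc powr_minus field_simps)

lemma admissibleD:
  assumes "\<sigma> \<in> admissible K"
  shows "\<sigma> (j, x, y) = \<sigma> (j, y, x)" "\<sigma> (j, x, z) \<le> \<sigma> (j, x, y) + \<sigma> (j, y, z)"
    "q j x y \<le> \<sigma> (j, x, y)" "\<sigma> (j, x, y) \<le> K * q j x y"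
  using assms by (auto simp: admissible_def)

text \<open>The bounds confine each value to a compact interval, and the pseudometric conditions are
  closed.\<close>

lemma compact_admissible: "compact (admissible K)"
proof -
  let ?B = "{\<sigma>. \<forall>z. \<sigma> z \<in> (case z of (j, x, y) \<Rightarrow> {q j x y .. K * q j x y})}"
  have "compact ?B"
    by (rule compact_pointwise) (auto split: prod.split)
  moreover have "closed (admissible K)"
    unfolding admissible_def
    by (intro closed_Collect_all closed_Collect_conj closed_Collect_le closed_Collect_eq eval_intros)
  moreover have "admissible K \<subseteq> ?B"
    by (auto simp: admissibleD(3,4))
  ultimately show ?thesis
    using closed_Int_compact[of "admissible K" ?B] by (simp only: Int_absorb2)
qed

lemma zoom_admissible:
  assumes "\<sigma> \<in> admissible K" "t > 0"
  shows "zoom p t \<sigma> \<in> admissible K"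
proof -
  have e: "t powr (- w j) * (t powr w j * a) = a" for j a
    using assms by (simp add: powr_minus)
  have "q j x y \<le> zoom p t \<sigma> (j, x, y)" "zoom p t \<sigma> (j, x, y) \<le> K * q j x y" for j x y
  proof -
    have "t powr (- w j) * q j (p + dil t x) (p + dil t y) \<le> zoom p t \<sigma> (j, x, y)"
      unfolding zoom_apply by (intro mult_left_mono admissibleD[OF assms(1)]) auto
    then show "q j x y \<le> zoom p t \<sigma> (j, x, y)"
      using assms(2) by (simp add: q_dil e)
    have "zoom p t \<sigma> (j, x, y) \<le> t powr (- w j) * (K * q j (p + dil t x) (p + dil t y))"
      unfolding zoom_apply by (intro mult_left_mono admissibleD[OF assms(1)]) auto
    also have "\<dots> = K * (t powr (- w j) * (t powr w j * q j x y))"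
      using assms(2) by (simp add: q_dil)
    finally show "zoom p t \<sigma> (j, x, y) \<le> K * q j x y"
      by (simp only: e)
  qed
  moreover have "zoom p t \<sigma> (j, x, y) = zoom p t \<sigma> (j, y, x)" for j x y
    using admissibleD(1)[OF assms(1)] by (simp add: zoom_apply)
  moreover have "zoom p t \<sigma> (j, x, z) \<le> zoom p t \<sigma> (j, x, y) + zoom p t \<sigma> (j, y, z)" for j x y z
    unfolding zoom_apply distrib_left[symmetric] by (intro mult_left_mono admissibleD[OF assms(1)]) auto
  ultimately show ?thesis unfolding admissible_def by blast
qed

lemma continuous_on_zoom: "continuous_on UNIV (zoom p t)"
  unfolding zoom_def split_def
  by (intro continuous_on_coordinatewise_then_product eval_intros)

lemma closed_straight: "closed (straight j v)"
proof -
  have "straight j v = (\<Inter>x y. \<Inter>t\<in>{0..}. {\<sigma>. \<sigma> (j, x, x + t *\<^sub>R v) = t * \<sigma> (j, y, y + v)})"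
    by (auto simp: straight_def)
  then show ?thesis
    by (auto intro!: closed_INT closed_Collect_eq eval_intros)
qed

text \<open>A dilation acts on level \<open>j\<close> as a homothety, so it carries lines in
  direction \<open>v\<close> to lines in direction \<open>v\<close> and multiplies the parameter by
  a constant.\<close>

lemma zoom_straight:
  assumes "v \<in> level j" "\<sigma> \<in> straight j v" "s > 0"
  shows "zoom p s \<sigma> \<in> straight j v"
proof -
  have "zoom p s \<sigma> (j, x, x + t *\<^sub>R v) = t * zoom p s \<sigma> (j, y, y + v)" if "t \<ge> 0" for x y t
  proof -
    have 1: "\<sigma> (j, p + dil s z, (p + dil s z) + (s powr w j * r) *\<^sub>R v)
        = s powr w j * r * \<sigma> (j, 0, 0 + v)" if "r \<ge> 0" for z r
    proof -
      have "\<forall>x y t. t \<ge> 0 \<longrightarrow> \<sigma> (j, x, x + t *\<^sub>R v) = t * \<sigma> (j, y, y + v)"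
        using assms(2) by (simp add: straight_def)
      then show ?thesis
        using that by (metis mult_nonneg_nonneg powr_ge_zero)
    qed
    show ?thesis
      using 1[OF that, of x] 1[of 1 y]
      by (simp add: zoom_apply dil_add dil_level[OF assms(1)] dil_level[OF scaleR_in_level[OF assms(1)]]
          add.assoc mult.commute)
  qed
  then show ?thesis by (simp add: straight_def)
qed

text \<open>Among all zooms choose one whose segment from 0 to \<open>v\<close> has maximal length \<open>s\<close>, and zoom
  into that segment.  A long line in direction \<open>v\<close> then has maximal speed \<open>s\<close>, so the parallel
  lines fall short of it by a bounded total amount and hence by very little on most parts.\<close>

lemma exists_straight:
  assumes X: "compact X" "X \<noteq> {}" "X \<subseteq> admissible K" "zoom_invariant X" and v: "v \<in> level j"
  shows "X \<inter> straight j v \<noteq> {}"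
proof -
  have "\<exists>\<sigma>\<in>X. \<forall>\<tau>\<in>X. \<tau> (j, 0, v) \<le> \<sigma> (j, 0, v)"
    by (intro continuous_attains_sup X continuous_on_eval)
  then obtain \<sigma>0 where \<sigma>0: "\<sigma>0 \<in> X" and max: "\<And>\<tau>. \<tau> \<in> X \<Longrightarrow> \<tau> (j, 0, v) \<le> \<sigma>0 (j, 0, v)"
    by blast
  define s where "s = \<sigma>0 (j, 0, v)"
  have adm: "\<sigma> \<in> admissible K" if "\<sigma> \<in> X" for \<sigma>
    using X that by blast
  note sym = admissibleD(1)[OF adm] and tri = admissibleD(2)[OF adm] and le_q = admissibleD(4)[OF adm]
  have tri3: "\<sigma> (j, a, d) \<le> \<sigma> (j, a, b) + (\<sigma> (j, b, c) + \<sigma> (j, c, d))" if "\<sigma> \<in> X" for \<sigma> a b c d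
    using tri[OF that, of j a d b] tri[OF that, of j b d c] by linarith
  have refl: "\<sigma> (j, x, x) = 0" if "\<sigma> \<in> X" for \<sigma> x
    using admissibleD(3,4)[OF adm[OF that], of j x x] by simp
  have zoomX: "zoom p t \<sigma> \<in> X" if "\<sigma> \<in> X" "t > 0" for \<sigma> p t
    using X that by (auto simp: zoom_invariant_def)
  \<comment> \<open>A zoom moves the segment from \<open>x\<close> to
    \<open>x + t *\<^sub>R v\<close> to the one from 0 to \<open>v\<close>, so \<open>s\<close>
    bounds the speed everywhere and for every member of \<open>X\<close>.\<close>
  have up: "\<sigma> (j, x, x + t *\<^sub>R v) \<le> t * s" if "\<sigma> \<in> X" "t \<ge> 0" for \<sigma> x t
  proof (cases "t = 0")
    case True
    then show ?thesis using refl[OF that(1)] by simp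
  next
    case False
    then have t: "t > 0" using that by simp
    have "\<sigma> (j, x, x + t *\<^sub>R v) / t \<le> s"
      using max[OF zoomX[OF that(1), of "t powr (1 / w j)" x]] zoom_level[OF t v, of x \<sigma> 0] t
      by (simp add: s_def)
    then show ?thesis using t by (simp add: field_simps)
  qed
  \<comment> \<open>Almost full speed on the segment of half-length \<open>k + 1\<close> about
    \<open>y\<close>. Membership in all \<open>C z\<close> forces full speed on every line, and
    compactness allows finitely many conditions at a time.\<close>
  define C where "C = (\<lambda>(y, k). {\<sigma> :: 'n lengths.
    2 * real (Suc k) * s - 1 / real (Suc k) \<le> \<sigma> (j, y - real (Suc k) *\<^sub>R v, y + real (Suc k) *\<^sub>R v)})"
  have "X \<inter> (\<Inter>z\<in>UNIV. C z) \<noteq> {}"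
  proof (rule compact_imp_fip_image[OF X(1)])
    show "closed (C z)" for z
      by (cases z) (auto simp: C_def intro!: closed_Collect_le eval_intros)
  next
    fix F :: "((real^'n) \<times> nat) set" assume F: "finite F" "F \<subseteq> UNIV"
    \<comment> \<open>Half the length of a piece of the subdivision, at least as large as every
      radius that \<open>F\<close> asks for; \<open>insert 0\<close> covers the case of empty
      \<open>F\<close>.\<close>
    define k0 where "k0 = real (Suc (Max (insert 0 (snd ` F))))"
    have k0: "k0 > 0" by (simp add: k0_def)
    have k_le: "real (Suc k) \<le> k0" if "(y, k) \<in> F" for y k
    proof -
      have "k \<le> Max (insert 0 (snd ` F))"
        using that F by (intro Max_ge) force+
      then show ?thesis by (simp add: k0_def)
    qed
    \<comment> \<open>A bound for the total deficit of all the parallel lines together, whatever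
      their length. With \<open>N \<ge> B * k0\<close> pieces the average deficit of a piece is at
      most \<open>1 / k0\<close>.\<close>
    define B where "B = (\<Sum>y\<in>fst ` F. 2 * K * q j 0 y)"
    obtain n :: nat where "B * k0 \<le> real n"
      using real_arch_simple by blast
    then obtain N :: nat where N: "N > 0" "B * k0 \<le> real N"
      by (intro that[of "Suc n"]) auto
    define L where "L = 2 * k0 * real N"
    have L: "L > 0" using k0 N by (simp add: L_def)
    \<comment> \<open>Zooming out turns the maximal segment into one with endpoint
      \<open>L *\<^sub>R v\<close> that still has full speed.\<close>
    define \<sigma>1 where "\<sigma>1 = zoom 0 ((1 / L) powr (1 / w j)) \<sigma>0"
    have \<sigma>1: "\<sigma>1 \<in> X" using L by (simp add: \<sigma>1_def zoomX \<sigma>0)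
    have "\<sigma>1 (j, 0, 0 + L *\<^sub>R v) = L * s"
      unfolding \<sigma>1_def using L v by (subst zoom_level) (auto simp: s_def)
    then have long: "\<sigma>1 (j, 0, L *\<^sub>R v) = L * s" by simp
    define a where "a i = (2 * k0 * real i) *\<^sub>R v" for i :: nat
    define D where "D i y = 2 * k0 * s - \<sigma>1 (j, y + a i, y + a (Suc i))" for i y
    have a_Suc: "a (Suc i) = a i + (2 * k0) *\<^sub>R v" for i
      by (simp add: a_def algebra_simps)
    have D_nonneg: "D i y \<ge> 0" for i y
      using up[OF \<sigma>1, of "2 * k0" "y + a i"] k0 by (simp add: D_def a_Suc add.assoc)
    \<comment> \<open>Shifting the long segment by \<open>y\<close> loses at most
      \<open>K * q j 0 y\<close> at each end, independently of its length.\<close>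
    have D_sum: "(\<Sum>i<N. D i y) \<le> 2 * K * q j 0 y" for y
    proof -
      have chain: "\<sigma>1 (j, y, y + a n) \<le> (\<Sum>i<n. \<sigma>1 (j, y + a i, y + a (Suc i)))" for n
      proof (induction n)
        case 0
        then show ?case using refl[OF \<sigma>1] by (simp add: a_def)
      next
        case (Suc n)
        then show ?case using tri[OF \<sigma>1, of j y "y + a (Suc n)" "y + a n"] by simp
      qed
      have aN: "a N = L *\<^sub>R v" by (simp add: a_def L_def)
      have "L * s \<le> \<sigma>1 (j, 0, y) + \<sigma>1 (j, y, a N)"
        using tri[OF \<sigma>1, of j 0 "a N" y] long by (simp add: aN)
      also have "\<sigma>1 (j, y, a N) \<le> \<sigma>1 (j, y, y + a N) + \<sigma>1 (j, y + a N, a N)"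
        by (rule tri[OF \<sigma>1])
      also have "\<sigma>1 (j, 0, y) \<le> K * q j 0 y"
        by (rule le_q[OF \<sigma>1])
      also have "\<sigma>1 (j, y + a N, a N) \<le> K * q j 0 y"
        using le_q[OF \<sigma>1, of j "y + a N" "a N"] q_translate[of j "a N" y 0] q_commute[of j y 0]
        by (simp add: add.commute)
      finally have "L * s - 2 * K * q j 0 y \<le> \<sigma>1 (j, y, y + a N)" by simp
      then have "L * s - 2 * K * q j 0 y \<le> (\<Sum>i<N. \<sigma>1 (j, y + a i, y + a (Suc i)))"
        using chain[of N] by linarith
      then show ?thesis
        by (simp add: D_def sum_subtractf L_def algebra_simps)
    qed
    have "(\<Sum>i<N. \<Sum>y\<in>fst ` F. D i y) \<le> B"
      unfolding B_def by (subst sum.swap) (intro sum_mono D_sum)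
    \<comment> \<open>Pigeonhole: one piece is good for all the parallel lines
      simultaneously.\<close>
    then have "\<exists>i<N. (\<Sum>y\<in>fst ` F. D i y) \<le> B / real N"
    proof (rule contrapos_pp)
      assume "\<not> (\<exists>i<N. (\<Sum>y\<in>fst ` F. D i y) \<le> B / real N)"
      then have "(\<Sum>i<N. B / real N) < (\<Sum>i<N. \<Sum>y\<in>fst ` F. D i y)"
        using N by (intro sum_strict_mono) (auto simp: not_le)
      then show "\<not> (\<Sum>i<N. \<Sum>y\<in>fst ` F. D i y) \<le> B"
        using N by simp
    qed
    then obtain i where i: "(\<Sum>y\<in>fst ` F. D i y) \<le> B / real N" by blast
    have D_small: "D i y \<le> 1 / k0" if "y \<in> fst ` F" for y
    proof -
      have "D i y \<le> (\<Sum>y\<in>fst ` F. D i y)"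
        using that F D_nonneg by (intro member_le_sum) auto
      also have "\<dots> \<le> B / real N" by (rule i)
      also have "\<dots> \<le> 1 / k0" using N k0 by (simp add: field_simps)
      finally show ?thesis .
    qed
    \<comment> \<open>The midpoint of the good piece becomes the origin, without change of
      scale.\<close>
    define \<sigma>2 where "\<sigma>2 = zoom (a i + k0 *\<^sub>R v) 1 \<sigma>1"
    have \<sigma>2: "\<sigma>2 \<in> X" by (simp add: \<sigma>2_def zoomX \<sigma>1)
    have "\<sigma>2 \<in> C z" if z: "z \<in> F" for z
    proof -
      obtain y k where [simp]: "z = (y, k)" by (cases z)
      define r where "r = real (Suc k)"
      have r: "r \<le> k0" "r > 0" using k_le[of y k] z by (auto simp: r_def)
      have "\<sigma>2 (j, y - k0 *\<^sub>R v, y + k0 *\<^sub>R v) = 2 * k0 * s - D i y"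
      proof -
        have "a i + k0 *\<^sub>R v + (y - k0 *\<^sub>R v) = y + a i" by simp
        moreover have "a i + k0 *\<^sub>R v + (y + k0 *\<^sub>R v) = y + a (Suc i)"
          by (simp only: a_Suc mult_2 scaleR_left_distrib add_ac)
        ultimately show ?thesis by (simp only: \<sigma>2_def zoom_apply D_def dil_one powr_one_eq_one mult_1)
      qed
      moreover have "D i y \<le> 1 / k0"
        using z by (intro D_small) force
      moreover have "1 / k0 \<le> 1 / r"
        using r by (simp add: field_simps)
      \<comment> \<open>The two removed ends have speed at most \<open>s\<close>, so the deficit of
        a subsegment does not exceed that of the whole.\<close>
      moreover have "\<sigma>2 (j, y - k0 *\<^sub>R v, y - r *\<^sub>R v) \<le> (k0 - r) * s"
        using up[OF \<sigma>2, of "k0 - r" "y - k0 *\<^sub>R v"] r by (simp add: algebra_simps)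
      moreover have "\<sigma>2 (j, y + r *\<^sub>R v, y + k0 *\<^sub>R v) \<le> (k0 - r) * s"
        using up[OF \<sigma>2, of "k0 - r" "y + r *\<^sub>R v"] r by (simp add: algebra_simps)
      moreover have "\<sigma>2 (j, y - k0 *\<^sub>R v, y + k0 *\<^sub>R v)
          \<le> \<sigma>2 (j, y - k0 *\<^sub>R v, y - r *\<^sub>R v) + (\<sigma>2 (j, y - r *\<^sub>R v, y + r *\<^sub>R v) + \<sigma>2 (j, y + r *\<^sub>R v, y + k0 *\<^sub>R v))"
        by (rule tri3[OF \<sigma>2])
      ultimately have "2 * r * s - 1 / r \<le> \<sigma>2 (j, y - r *\<^sub>R v, y + r *\<^sub>R v)"
        by (simp add: algebra_simps)
      then show ?thesis by (simp only: C_def r_def \<open>z = (y, k)\<close> prod.case mem_Collect_eq)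
    qed
    then show "X \<inter> (\<Inter>z\<in>F. C z) \<noteq> {}"
      using \<sigma>2 by blast
  qed
  then obtain \<sigma> where \<sigma>: "\<sigma> \<in> X" "\<And>z. \<sigma> \<in> C z" by blast
  have eq: "\<sigma> (j, x, x + t *\<^sub>R v) = t * s" if t: "t \<ge> 0" for x t
  proof (rule antisym[OF up[OF \<sigma>(1) t]])
    \<comment> \<open>The segment from \<open>x\<close> to \<open>x + t *\<^sub>R v\<close> is part
      of arbitrarily long segments centred at \<open>x\<close>, whose deficits tend to 0.\<close>
    have ge: "t * s - 1 / real (Suc k) \<le> \<sigma> (j, x, x + t *\<^sub>R v)" if k: "t \<le> real k" for k
    proof -
      define r where "r = real (Suc k)"
      have r: "t \<le> r" "r > 0" using k by (auto simp: r_def)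
      have "2 * r * s - 1 / r \<le> \<sigma> (j, x - r *\<^sub>R v, x + r *\<^sub>R v)"
        using \<sigma>(2)[of "(x, k)"] by (simp only: C_def r_def prod.case mem_Collect_eq)
      moreover have "\<sigma> (j, x - r *\<^sub>R v, x) \<le> r * s"
        using up[OF \<sigma>(1), of r "x - r *\<^sub>R v"] r by simp
      moreover have "\<sigma> (j, x + t *\<^sub>R v, x + r *\<^sub>R v) \<le> (r - t) * s"
        using up[OF \<sigma>(1), of "r - t" "x + t *\<^sub>R v"] r by (simp add: algebra_simps)
      moreover have "\<sigma> (j, x - r *\<^sub>R v, x + r *\<^sub>R v)
          \<le> \<sigma> (j, x - r *\<^sub>R v, x) + (\<sigma> (j, x, x + t *\<^sub>R v) + \<sigma> (j, x + t *\<^sub>R v, x + r *\<^sub>R v))"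
        by (rule tri3[OF \<sigma>(1)])
      ultimately have "t * s - 1 / r \<le> \<sigma> (j, x, x + t *\<^sub>R v)"
        by (simp add: algebra_simps)
      then show ?thesis by (simp only: r_def)
    qed
    have "(\<lambda>k. t * s - 1 / real (Suc k)) \<longlonglongrightarrow> t * s - 0"
      by (intro tendsto_intros LIMSEQ_Suc[OF lim_1_over_n])
    moreover obtain k1 :: nat where "t \<le> real k1" using real_arch_simple by blast
    then have "\<forall>k\<ge>k1. t * s - 1 / real (Suc k) \<le> \<sigma> (j, x, x + t *\<^sub>R v)"
      using ge by (metis of_nat_le_iff order_trans)
    ultimately show "t * s \<le> \<sigma> (j, x, x + t *\<^sub>R v)"
      by (intro LIMSEQ_le_const2[where X = "\<lambda>k. t * s - 1 / real (Suc k)"]) auto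
  qed
  have "\<sigma> \<in> straight j v"
    using eq eq[of 1] by (simp add: straight_def)
  with \<sigma> show ?thesis by blast
qed

text \<open>The members of \<open>X\<close> that are straight in one direction form again a compact,
  nonempty, zoom invariant set. Finitely many directions are thus treated in turn, all of them by
  the finite intersection property.\<close>

lemma exists_all_straight:
  assumes X: "compact X" "X \<noteq> {}" "X \<subseteq> admissible K" "zoom_invariant X"
  shows "\<exists>\<sigma>\<in>X. \<forall>j. \<forall>v\<in>level j. \<sigma> \<in> straight j v"
proof -
  have "X \<inter> (\<Inter>z\<in>(SIGMA j:UNIV. level j). straight (fst z) (snd z)) \<noteq> {}"
  proof (rule compact_imp_fip_image[OF X(1)])
    show "closed (straight (fst z) (snd z))" for z
      by (rule closed_straight)
    fix F assume "finite F" "F \<subseteq> (SIGMA j:UNIV. level j)"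
    then have "compact (X \<inter> (\<Inter>z\<in>F. straight (fst z) (snd z))) \<and>
      X \<inter> (\<Inter>z\<in>F. straight (fst z) (snd z)) \<noteq> {} \<and>
      zoom_invariant (X \<inter> (\<Inter>z\<in>F. straight (fst z) (snd z)))"
    proof (induction F rule: finite_induct)
      case empty
      then show ?case using X by simp
    next
      case (insert z F)
      let ?Y = "X \<inter> (\<Inter>z\<in>F. straight (fst z) (snd z))"
      have v: "snd z \<in> level (fst z)" using insert by auto
      have Y: "compact ?Y" "?Y \<noteq> {}" "?Y \<subseteq> admissible K" "zoom_invariant ?Y"
        using insert X by auto
      have e: "X \<inter> (\<Inter>z\<in>insert z F. straight (fst z) (snd z)) = ?Y \<inter> straight (fst z) (snd z)"
        by auto
      have "zoom_invariant (?Y \<inter> straight (fst z) (snd z))"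
        using Y(4) zoom_straight[OF v] by (simp add: zoom_invariant_def)
      then show ?case
        unfolding e using exists_straight[OF Y v] Y(1) closed_straight compact_Int_closed by blast
    qed
    then show "X \<inter> (\<Inter>z\<in>F. straight (fst z) (snd z)) \<noteq> {}" by blast
  qed
  then show ?thesis by force
qed

end

section \<open>A chart in which every level is normed\<close>

lemma compact_imp_closed_pointwise:
  fixes S :: "('a \<Rightarrow> 'b::metric_space) set"
  assumes "compact S"
  shows "closed S"
proof -
  have "Hausdorff_space (euclidean :: ('a \<Rightarrow> 'b) topology)"
    unfolding euclidean_product_topology[symmetric] by (simp add: Hausdorff_space_product_topology)
  then show ?thesis
    using compactin_imp_closedin[of euclidean S] assms by simp
qed

context weighted_coordinates
begin

text \<open>Moving the endpoints changes \<open>d\<close> by at most the distances moved, which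
  \<open>q j\<close> controls and which vanish in the limit.\<close>

lemma continuous_on_pseudometric:
  assumes "\<And>x y. d x y = d y x" "\<And>x y z. d x z \<le> d x y + d y z" "\<And>x y. d x y \<le> K * q j x y"
    and "continuous_on S f" "continuous_on S g"
  shows "continuous_on S (\<lambda>s. d (f s) (g s) :: real)"
  unfolding continuous_on_def
proof
  fix s assume s: "s \<in> S"
  have "continuous_on S (\<lambda>r. K * q j (f r) (f s) + K * q j (g r) (g s))"
    by (intro continuous_intros assms)
  then have "((\<lambda>r. K * q j (f r) (f s) + K * q j (g r) (g s))
    \<longlongrightarrow> K * q j (f s) (f s) + K * q j (g s) (g s)) (at s within S)"
    using s unfolding continuous_on_def by blast
  then have lim: "((\<lambda>r. K * q j (f r) (f s) + K * q j (g r) (g s)) \<longlongrightarrow> 0) (at s within S)"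
    by simp
  have "norm (d (f r) (g r) - d (f s) (g s)) \<le> K * q j (f r) (f s) + K * q j (g r) (g s)" for r
    using assms(2)[of "f r" "g r" "f s"] assms(2)[of "f s" "g r" "g s"] assms(2)[of "f s" "g s" "f r"]
      assms(2)[of "f r" "g s" "g r"] assms(1)[of "f r" "f s"] assms(1)[of "g r" "g s"]
      assms(3)[of "f r" "f s"] assms(3)[of "g r" "g s"]
    unfolding real_norm_def abs_le_iff by linarith
  then have "((\<lambda>r. d (f r) (g r) - d (f s) (g s)) \<longlongrightarrow> 0) (at s within S)"
    by (intro Lim_null_comparison[OF _ lim]) auto
  then show "((\<lambda>r. d (f r) (g r)) \<longlongrightarrow> d (f s) (g s)) (at s within S)"
    by (simp add: LIM_zero_iff)
qed

end

lemma (in scaled_action) continuous_on_rho: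
  assumes "continuous_on S f" "continuous_on S g"
  shows "continuous_on S (\<lambda>s. rho j (f s) (g s))"
  using rho_commute rho_triangle rho_le_q assms by (rule continuous_on_pseudometric)

text \<open>A zoom together with the chart that realises it, the inverse chart and the logarithmic
  scale: carried along so that a limit of zooms still comes with a chart.\<close>

type_synonym 'n chart_data =
  "'n lengths \<times> ((real, 'n) vec \<Rightarrow> (real, 'n) vec) \<times> ((real, 'n) vec \<Rightarrow> (real, 'n) vec) \<times> real"

text \<open>Cocompactness lets \<open>G\<close> bring every zoom of \<open>rho\<close> back to unit scale, so all limits of
  zooms are \<open>rho\<close> itself in another biLipschitz chart.\<close>

lemma (in scaled_action) exists_straightening_chart:
  assumes cocompact: "compact Q" "Q \<subseteq> {(x, y). x \<noteq> y}"
    "{(x, y). x \<noteq> y} \<subseteq> (\<Union>g\<in>carrier G. map_prod (act g) (act g) ` Q)"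
  obtains F H L where "L \<ge> 1" "\<And>x. F (H x) = x" "\<And>x. H (F x) = x"
    "\<And>j x y. q j (F x) (F y) \<le> L * q j x y" "\<And>j x y. q j (H x) (H y) \<le> L * q j x y"
    "\<And>j v x y t. v \<in> level j \<Longrightarrow> t \<ge> 0 \<Longrightarrow>
      rho j (F x) (F (x + t *\<^sub>R v)) = t * rho j (F y) (F (y + v))"
proof -
  define \<rho> where "\<rho> = (\<lambda>(j, x, y). rho j x y)"
  have \<rho>: "\<rho> \<in> admissible K"
    by (simp add: \<rho>_def admissible_def rho_commute rho_triangle q_le_rho rho_le_q)
  obtain j0 where j0: "\<And>k. w j0 \<le> w k"
    using exists_minimal_weight by blast
  define u :: "real^'n" where "u = axis j0 1"
  have "u \<noteq> 0" by (simp add: u_def)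
  have sep: "q j0 x y > 0" if "x \<noteq> y" for x y
    using q_eq_0_iff[of j0 x y] q_nonneg[of j0 x y] j0 that by (auto simp: vec_eq_iff less_le)
  define q0 where "q0 = q j0 0 u"
  have q0: "q0 > 0" using sep[of 0 u] \<open>u \<noteq> 0\<close> by (simp add: q0_def)
  have Q: "Q \<noteq> {}"
    using cocompact(3) \<open>u \<noteq> 0\<close> by (auto dest: subsetD[where c = "(0, u)"])
  have contQ: "continuous_on Q (\<lambda>z. q j0 (fst z) (snd z))" "continuous_on Q (\<lambda>z. q j0 (fst z) 0)"
    by (intro continuous_intros)+
  obtain z1 where z1: "z1 \<in> Q" "\<And>z. z \<in> Q \<Longrightarrow> q j0 (fst z1) (snd z1) \<le> q j0 (fst z) (snd z)"
    using continuous_attains_inf[OF cocompact(1) Q contQ(1)] by blast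
  obtain z2 where z2: "z2 \<in> Q" "\<And>z. z \<in> Q \<Longrightarrow> q j0 (fst z) (snd z) \<le> q j0 (fst z2) (snd z2)"
    using continuous_attains_sup[OF cocompact(1) Q contQ(1)] by blast
  obtain z3 where z3: "z3 \<in> Q" "\<And>z. z \<in> Q \<Longrightarrow> q j0 (fst z) 0 \<le> q j0 (fst z3) 0"
    using continuous_attains_sup[OF cocompact(1) Q contQ(2)] by blast
  \<comment> \<open>\<open>r\<close> and \<open>R\<close> are the extreme lengths of pairs in
    \<open>Q\<close> and will confine the scale; \<open>R'\<close> bounds the distance of their
    first points from 0 and will confine the base point.\<close>
  define r where "r = q j0 (fst z1) (snd z1)"
  define R where "R = q j0 (fst z2) (snd z2)"
  define R' where "R' = q j0 (fst z3) 0"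
  have r: "r > 0" using z1(1) cocompact(2) sep by (auto simp: r_def)
  have R: "R > 0" using z2(1) cocompact(2) sep by (auto simp: R_def)
  \<comment> \<open>A bound for the logarithmic scale of a chart that takes the test pair
    \<open>(0, u)\<close> into \<open>Q\<close>. It makes \<open>L\<close> a Lipschitz constant for
    all these charts and their inverses.\<close>
  define B where "B = \<bar>ln (r / (K * q0)) / w j0\<bar> + \<bar>ln (K * R / q0) / w j0\<bar>"
  define L where "L = K * exp (Max (range w) * B)"
  have B: "B \<ge> 0" by (simp add: B_def)
  have "Max (range w) > 0"
    by (rule less_le_trans[OF w_pos[of j0]]) simp
  then have "1 * 1 \<le> L"
    unfolding L_def using K1 B by (intro mult_mono) auto
  then have L: "L \<ge> 1" by simp
  have exp_le_L: "K * exp (w j * l) \<le> L" if "\<bar>l\<bar> \<le> B" for j l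
  proof -
    have "w j * l \<le> w j * B" using that by (intro mult_left_mono) auto
    also have "\<dots> \<le> Max (range w) * B" using B by (intro mult_right_mono) auto
    finally show ?thesis by (simp add: L_def)
  qed

  \<comment> \<open>Composition is not continuous for pointwise convergence, so the last two
    conditions state that \<open>F\<close> and \<open>H\<close> are inverse by inequalities between
    single values. For \<open>y = H x\<close> the first of them reads
    \<open>q j0 (F (H x)) x \<le> 0\<close>.\<close>
  define good :: "'n chart_data \<Rightarrow> bool" where "good = (\<lambda>(\<sigma>, F, H, l).
    (\<forall>j x y. \<sigma> (j, x, y) = exp (- (w j * l)) * rho j (F x) (F y)) \<and>
    (\<forall>j x y. q j (F x) (F y) \<le> L * q j x y) \<and> (\<forall>j x y. q j (H x) (H y) \<le> L * q j x y) \<and>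
    (\<forall>x y. q j0 (F y) x \<le> L * q j0 y (H x)) \<and> (\<forall>x y. q j0 (H y) x \<le> L * q j0 y (F x)))"
  define box where "box = admissible K \<times> {F. \<forall>x. F x \<in> {z. q j0 z 0 \<le> L * q j0 x 0 + R'}}
    \<times> {H. \<forall>x. H x \<in> {z. q j0 z 0 \<le> L * q j0 x 0 + L * R'}} \<times> {-B..B}"
  have "compact box"
    unfolding box_def
    by (intro compact_Times compact_admissible compact_pointwise compact_q_ball j0 compact_Icc)
  moreover have "closed {z. good z}"
  proof -
    have cont: "continuous_on UNIV (\<lambda>z :: 'n chart_data. fst z i)"
      "continuous_on UNIV (\<lambda>z :: 'n chart_data. fst (snd z) x)"
      "continuous_on UNIV (\<lambda>z :: 'n chart_data. fst (snd (snd z)) x)"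
      "continuous_on UNIV (\<lambda>z :: 'n chart_data. snd (snd (snd z)))"
      for i x
      by (rule continuous_on_product_then_coordinatewise[OF continuous_on_fst[OF continuous_on_id]]
          continuous_on_product_then_coordinatewise[OF continuous_on_fst[OF continuous_on_snd[OF continuous_on_id]]]
          continuous_on_product_then_coordinatewise[OF continuous_on_fst[OF continuous_on_snd[OF continuous_on_snd[OF continuous_on_id]]]]
          continuous_on_snd[OF continuous_on_snd[OF continuous_on_snd[OF continuous_on_id]]])+
    show ?thesis
      unfolding good_def split_def
      by (intro closed_Collect_all closed_Collect_conj closed_Collect_le closed_Collect_eq
          continuous_on_q continuous_on_rho continuous_on_mult continuous_on_exp continuous_on_minus
          cont continuous_on_const)
  qed
  ultimately have "compact (box \<inter> {z. good z})"
    by (rule compact_Int_closed)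
  \<comment> \<open>The projection forgets the chart, but compactness ensures that every point of
    the closure still has one.\<close>
  define Z where "Z = fst ` (box \<inter> {z. good z})"
  have Z: "compact Z" unfolding Z_def
    by (intro compact_continuous_image continuous_intros \<open>compact (box \<inter> {z. good z})\<close>)

  have zoom_Z: "zoom p t \<rho> \<in> Z" if t: "t > 0" for p t
  proof -
    have "p \<noteq> p + dil t u"
      using t by (auto simp: dil_def u_def vec_eq_iff axis_def)
    then obtain g x y where g: "g \<in> carrier G" and xy: "(x, y) \<in> Q" "act g x = p" "act g y = p + dil t u"
      using cocompact(3) by (auto dest!: subsetD[where c = "(p, p + dil t u)"])
    \<comment> \<open>The inverse takes the test pair at scale \<open>t\<close> around
      \<open>p\<close> back into \<open>Q\<close>, that is, to unit scale near the origin.\<close>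
    define \<gamma> where "\<gamma> = inv g"
    have \<gamma>: "\<gamma> \<in> carrier G" using g by (simp add: \<gamma>_def)
    define F where "F x = act \<gamma> (p + dil t x)" for x
    define H where "H x = dil (1 / t) (act (inv \<gamma>) x - p)" for x
    \<comment> \<open>The scale of \<open>F\<close>: the dilation contributes \<open>ln t\<close>,
      the group element \<open>chi \<gamma>\<close>.\<close>
    define l where "l = chi \<gamma> + ln t"
    have exp_l: "exp (w j * l) = exp (w j * chi \<gamma>) * t powr w j" for j
      using t by (simp add: l_def distrib_left exp_add powr_def)
    have FH: "F (H x) = x" for x
      using t \<gamma> by (simp add: F_def H_def dil_dil)
    have HF: "H (F x) = x" for x
      using t \<gamma> by (simp add: F_def H_def dil_dil)
    have F0: "F 0 = x" "F u = y"
      using act_inv(2)[OF g, of x] act_inv(2)[OF g, of y] by (simp_all add: F_def \<gamma>_def xy)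
    have F_ge: "exp (w j * l) / K * q j x y \<le> q j (F x) (F y)" for j x y
      using q_act_ge[OF \<gamma>, of j "p + dil t x" "p + dil t y"] t
      by (simp add: F_def q_dil exp_l mult.assoc)
    have F_le: "q j (F x) (F y) \<le> K * exp (w j * l) * q j x y" for j x y
      using q_act_le[OF \<gamma>, of j "p + dil t x" "p + dil t y"] t
      by (simp add: F_def q_dil exp_l mult.assoc)
    have l: "\<bar>l\<bar> \<le> B"
    proof -
      have "exp (w j0 * l) / K * q0 \<le> R"
        using F_ge[of j0 0 u] z2(2)[OF xy(1)] by (simp add: F0 q0_def R_def)
      then have "exp (w j0 * l) \<le> K * R / q0"
        using q0 by (simp add: field_simps)
      then have "ln (exp (w j0 * l)) \<le> ln (K * R / q0)"
        by (intro ln_mono) (use R q0 in auto)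
      then have 1: "l \<le> ln (K * R / q0) / w j0"
        by (simp add: field_simps)
      have "r \<le> K * exp (w j0 * l) * q0"
        using F_le[of j0 0 u] z1(2)[OF xy(1)] by (simp add: F0 q0_def r_def)
      then have "r / (K * q0) \<le> exp (w j0 * l)"
        using q0 by (simp add: field_simps)
      then have "ln (r / (K * q0)) \<le> ln (exp (w j0 * l))"
        by (intro ln_mono) (use r q0 in auto)
      then have 2: "ln (r / (K * q0)) / w j0 \<le> l"
        by (simp add: field_simps)
      show ?thesis
        using 1 2 unfolding B_def by linarith
    qed
    have F_L: "q j (F x) (F y) \<le> L * q j x y" for j x y
      using F_le[of j x y] mult_right_mono[OF exp_le_L[OF l, of j] q_nonneg, of j x y] by linarith
    have H_L: "q j (H x) (H y) \<le> L * q j x y" for j x y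
    proof -
      have "q j (H x) (H y) \<le> K * exp (w j * (- l)) * q j x y"
        using F_ge[of j "H x" "H y"] by (simp add: FH exp_minus field_simps)
      then show ?thesis
        using mult_right_mono[OF exp_le_L[of "- l" j] q_nonneg, of j x y] l by simp
    qed
    have F0_le: "q j0 (F 0) 0 \<le> R'"
      using z3(2)[OF xy(1)] by (simp add: F0 R'_def)
    have H0_le: "q j0 (H 0) 0 \<le> L * R'"
    proof -
      have "q j0 (H 0) 0 \<le> L * q j0 0 (F 0)"
        using H_L[of j0 0 "F 0"] by (simp add: HF)
      also have "\<dots> \<le> L * R'"
        using F0_le L by (intro mult_left_mono) (auto simp: q_commute)
      finally show ?thesis .
    qed
    have zoom_eq: "zoom p t \<rho> (j, x, y) = exp (- (w j * l)) * rho j (F x) (F y)" for j x y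
      using t by (simp add: zoom_apply \<rho>_def F_def rho_act[OF \<gamma>] exp_minus exp_l powr_minus)
    have "good (zoom p t \<rho>, F, H, l)"
      using zoom_eq F_L H_L F_L[of j0 _ "H _"] H_L[of j0 _ "F _"]
      by (simp add: good_def FH HF)
    moreover have "q j0 (F x) 0 \<le> L * q j0 x 0 + R'" for x
      using q_triangle[of j0 "F x" 0 "F 0"] F_L[of j0 x 0] F0_le by linarith
    moreover have "q j0 (H x) 0 \<le> L * q j0 x 0 + L * R'" for x
      using q_triangle[of j0 "H x" 0 "H 0"] H_L[of j0 x 0] H0_le by linarith
    ultimately have "(zoom p t \<rho>, F, H, l) \<in> box \<inter> {z. good z}"
      using l zoom_admissible[OF \<rho> t] by (simp add: box_def abs_le_iff)
    then show ?thesis unfolding Z_def by (rule rev_image_eqI) simp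
  qed

  define O' where "O' = (\<lambda>(p, t). zoom p t \<rho>) ` (UNIV \<times> {0<..})"
  have "closure O' \<subseteq> Z"
    by (intro closure_minimal compact_imp_closed_pointwise Z) (auto simp: O'_def zoom_Z)
  moreover have "\<exists>\<sigma>\<in>closure O'. \<forall>j. \<forall>v\<in>level j. \<sigma> \<in> straight j v"
  proof (rule exists_all_straight)
    have "zoom 0 1 \<rho> \<in> O'"
      unfolding O'_def by (rule image_eqI[where x = "(0, 1)"]) auto
    then show "closure O' \<noteq> {}" by auto
    have "O' \<subseteq> admissible K"
      by (auto simp: O'_def zoom_admissible \<rho>)
    then show "closure O' \<subseteq> admissible K"
      by (intro closure_minimal compact_imp_closed_pointwise compact_admissible)
    then show "compact (closure O')"
      using compact_Int_closed[OF compact_admissible[of K], of "closure O'"] by (simp add: Int_absorb1)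
    show "zoom_invariant (closure O')"
      unfolding zoom_invariant_def
    proof (intro ballI allI impI)
      fix \<sigma> p and t :: real assume \<sigma>: "\<sigma> \<in> closure O'" and t: "t > 0"
      have "zoom p t \<tau> \<in> O'" if "\<tau> \<in> O'" for \<tau>
      proof -
        obtain p' t' where "\<tau> = zoom p' t' \<rho>" "t' > 0" using \<open>\<tau> \<in> O'\<close> by (auto simp: O'_def)
        then have "zoom p t \<tau> = (\<lambda>(p, t). zoom p t \<rho>) (p' + dil t' p, t * t')" "t * t' > 0"
          using t by (auto simp: zoom_zoom)
        then show ?thesis unfolding O'_def by blast
      qed
      then have "zoom p t ` O' \<subseteq> closure O'" using closure_subset by blast
      then have "zoom p t ` closure O' \<subseteq> closure O'"
        by (intro image_closure_subset continuous_on_subset[OF continuous_on_zoom]) auto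
      then show "zoom p t \<sigma> \<in> closure O'" using \<sigma> by blast
    qed
  qed
  ultimately obtain \<sigma> where "\<sigma> \<in> Z" and straight: "\<And>j v. v \<in> level j \<Longrightarrow> \<sigma> \<in> straight j v"
    by blast
  then obtain F H l where "good (\<sigma>, F, H, l)" unfolding Z_def by force
  then have \<sigma>: "\<And>j x y. \<sigma> (j, x, y) = exp (- (w j * l)) * rho j (F x) (F y)"
    and FH_L: "\<And>j x y. q j (F x) (F y) \<le> L * q j x y" "\<And>j x y. q j (H x) (H y) \<le> L * q j x y"
    and inv: "\<And>x y. q j0 (F y) x \<le> L * q j0 y (H x)" "\<And>x y. q j0 (H y) x \<le> L * q j0 y (F x)"
    by (auto simp: good_def)
  show ?thesis
  proof
    show "L \<ge> 1" by (rule L)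
    \<comment> \<open>The inequalities that replaced the inverse relation, evaluated at their own
      image points.\<close>
    have "q j0 (F (H x)) x \<le> 0" "q j0 (H (F x)) x \<le> 0" for x
      using inv(1)[of "H x" x] inv(2)[of "F x" x] by auto
    then show "F (H x) = x" "H (F x) = x" for x
      using sep[of "F (H x)" x] sep[of "H (F x)" x] by (force simp: not_le[symmetric])+
    show "q j (F x) (F y) \<le> L * q j x y" "q j (H x) (H y) \<le> L * q j x y" for j x y
      by (rule FH_L)+
    show "rho j (F x) (F (x + t *\<^sub>R v)) = t * rho j (F y) (F (y + v))"
      if "v \<in> level j" "t \<ge> 0" for j v x y t
    proof -
      have "\<sigma> (j, x, x + t *\<^sub>R v) = t * \<sigma> (j, y, y + v)"
        using straight[OF that(1)] that(2) unfolding straight_def by blast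
      then show ?thesis by (simp add: \<sigma>)
    qed
  qed
qed

section \<open>The Mazur--Ulam theorem\<close>

locale norm_on_subspace =
  fixes V :: "'a::real_vector set" and N :: "'a \<Rightarrow> real"
  assumes subspace_V: "subspace V"
    and N_add: "\<And>x y. x \<in> V \<Longrightarrow> y \<in> V \<Longrightarrow> N (x + y) \<le> N x + N y"
    and N_scale: "\<And>x t. x \<in> V \<Longrightarrow> N (t *\<^sub>R x) = \<bar>t\<bar> * N x"
    and N_eq_0: "\<And>x. x \<in> V \<Longrightarrow> N x = 0 \<Longrightarrow> x = 0"
begin

lemma V_closed [simp, intro]:
  "0 \<in> V" "x \<in> V \<Longrightarrow> y \<in> V \<Longrightarrow> x + y \<in> V" "x \<in> V \<Longrightarrow> y \<in> V \<Longrightarrow> x - y \<in> V" "x \<in> V \<Longrightarrow> t *\<^sub>R x \<in> V"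
  using subspace_V by (auto simp: subspace_0 subspace_add subspace_diff subspace_scale)

lemma N_zero [simp]: "N 0 = 0"
  using N_scale[of 0 0] by simp

lemma N_minus: "x \<in> V \<Longrightarrow> N (- x) = N x"
  using N_scale[of x "-1"] by simp

lemma N_commute: "x \<in> V \<Longrightarrow> y \<in> V \<Longrightarrow> N (x - y) = N (y - x)"
  using N_minus[of "x - y"] by simp

lemma N_nonneg: "x \<in> V \<Longrightarrow> N x \<ge> 0"
  using N_add[of x "- x"] N_minus[of x] V_closed(4)[of x "-1"] by simp

text \<open>Vaisala's proof of the Mazur-Ulam theorem: conjugating with the reflection in the midpoint
  \<open>z\<close> turns an isometry that fixes \<open>a\<close> and \<open>b\<close> into one that moves \<open>z\<close> twice as far.\<close>

lemma isometry_fixes_midpoint: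
  assumes ab: "a \<in> V" "b \<in> V"
    and g: "bij_betw g V V" "\<And>x y. x \<in> V \<Longrightarrow> y \<in> V \<Longrightarrow> N (g x - g y) = N (x - y)" "g a = a" "g b = b"
  shows "g ((1/2) *\<^sub>R (a + b)) = (1/2) *\<^sub>R (a + b)"
proof -
  define z where "z = (1/2) *\<^sub>R (a + b)"
  define \<psi> where "\<psi> x = (a + b) - x" for x
  have z: "z \<in> V" using ab by (auto simp: z_def)
  have zz: "a + b = z + z" by (simp add: z_def flip: scaleR_left_distrib)
  have \<psi>z: "\<psi> z = z" by (simp add: \<psi>_def zz)
  have \<psi>V: "\<psi> x \<in> V" if "x \<in> V" for x using ab that by (auto simp: \<psi>_def)
  have \<psi>\<psi>: "\<psi> (\<psi> x) = x" for x by (simp add: \<psi>_def)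
  have \<psi>N: "N (\<psi> x - \<psi> y) = N (x - y)" if "x \<in> V" "y \<in> V" for x y
    using N_commute[OF that] by (simp add: \<psi>_def)
  have \<psi>_bij: "bij_betw \<psi> V V"
    by (rule bij_betw_byWitness[where f' = \<psi>]) (use \<psi>V \<psi>\<psi> in auto)
  define W where "W = {g. bij_betw g V V \<and> (\<forall>x\<in>V. \<forall>y\<in>V. N (g x - g y) = N (x - y)) \<and> g a = a \<and> g b = b}"
  define S where "S = (\<lambda>g. N (g z - z)) ` W"
  have "g \<in> W" using g by (auto simp: W_def)
  have bound: "N (h z - z) \<le> 2 * N (a - z)" if "h \<in> W" for h
  proof -
    have "h z \<in> V" using that z by (auto simp: W_def bij_betw_def)
    then have "N ((h z - a) + (a - z)) \<le> N (h z - a) + N (a - z)"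
      using ab z by (intro N_add) auto
    moreover have "N (h z - h a) = N (z - a)"
      using that ab z unfolding W_def by blast
    moreover have "h a = a" using that by (simp add: W_def)
    ultimately show ?thesis using N_commute[OF z ab(1)] by simp
  qed
  then have bdd: "bdd_above S" by (auto simp: S_def intro!: bdd_aboveI)
  have double: "2 * N (h z - z) \<in> S" if h: "h \<in> W" for h
  proof -
    have bij: "bij_betw h V V" and iso: "\<And>x y. x \<in> V \<Longrightarrow> y \<in> V \<Longrightarrow> N (h x - h y) = N (x - y)"
      and fix_ab: "h a = a" "h b = b" using h by (auto simp: W_def)
    define h' where "h' = inv_into V h"
    have h'V: "h' x \<in> V" and hh': "h (h' x) = x" if "x \<in> V" for x
      using bij that by (auto simp: h'_def bij_betw_def inv_into_into f_inv_into_f)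
    have h'h: "h' (h x) = x" if "x \<in> V" for x
      using bij that by (auto simp: h'_def bij_betw_def inv_into_f_f)
    have hV: "h x \<in> V" if "x \<in> V" for x
      using bij that by (auto simp: bij_betw_def)
    have iso': "N (h' x - h' y) = N (x - y)" if "x \<in> V" "y \<in> V" for x y
      using iso[of "h' x" "h' y"] that by (simp add: h'V hh')
    define k where "k = (\<lambda>x. \<psi> (h' (\<psi> (h x))))"
    have "bij_betw k V V"
      unfolding k_def
      by (rule bij_betw_byWitness[where f' = "\<lambda>x. h' (\<psi> (h (\<psi> x)))"])
        (auto simp: \<psi>V hV h'V hh' h'h \<psi>\<psi>)
    moreover have "N (k x - k y) = N (x - y)" if "x \<in> V" "y \<in> V" for x y
      using that by (simp add: k_def \<psi>N iso iso' \<psi>V hV h'V)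
    moreover have "\<psi> a = b" "\<psi> b = a" by (simp_all add: \<psi>_def)
    moreover have "h' a = a" "h' b = b" using h'h[of a] h'h[of b] fix_ab ab by auto
    ultimately have "k \<in> W" by (simp add: W_def k_def fix_ab)
    moreover have "N (k z - z) = 2 * N (h z - z)"
    proof -
      have "N (k z - z) = N (\<psi> (h' (\<psi> (h z))) - \<psi> z)" by (simp add: k_def \<psi>z)
      also have "\<dots> = N (h' (\<psi> (h z)) - h' (h z))"
        using z by (simp add: \<psi>N h'V \<psi>V hV h'h)
      also have "\<dots> = N (\<psi> (h z) - h z)"
        using z by (simp add: iso' \<psi>V hV)
      also have "\<psi> (h z) - h z = (- 2) *\<^sub>R (h z - z)"
        by (simp add: \<psi>_def zz scaleR_2 algebra_simps)
      also have "N \<dots> = 2 * N (h z - z)"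
        using z hV by (subst N_scale) auto
      finally show ?thesis .
    qed
    ultimately show ?thesis unfolding S_def by (intro image_eqI[where x = k]) simp_all
  qed
  \<comment> \<open>\<open>S\<close> is bounded and closed under doubling, so its supremum cannot be
    positive.\<close>
  have "Sup S \<le> Sup S / 2"
  proof (rule cSup_least)
    show "S \<noteq> {}" using \<open>g \<in> W\<close> by (auto simp: S_def)
    fix s assume "s \<in> S"
    then have "2 * s \<in> S" using double by (auto simp: S_def)
    then have "2 * s \<le> Sup S" using bdd by (rule cSup_upper)
    then show "s \<le> Sup S / 2" by simp
  qed
  moreover have "N (g z - z) \<le> Sup S"
    using bdd \<open>g \<in> W\<close> by (intro cSup_upper) (auto simp: S_def)
  moreover have gz: "g z - z \<in> V" using g z by (auto simp: bij_betw_def)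
  ultimately have "N (g z - z) = 0" using N_nonneg[OF gz] by linarith
  then have "g z - z = 0" by (rule N_eq_0[OF gz])
  then show ?thesis by (simp add: z_def)
qed

text \<open>Conjugating the reflection in the image midpoint by \<open>f\<close> and composing with
  the reflection in the midpoint of \<open>a\<close> and \<open>b\<close> gives an isometry
  \<open>k\<close>, as the factor \<open>c\<close> cancels. It fixes \<open>a\<close> and
  \<open>b\<close>, hence their midpoint, which is the claim.\<close>

lemma homothety_midpoint:
  assumes c: "c > 0" and f: "bij_betw f V V" "\<And>x y. x \<in> V \<Longrightarrow> y \<in> V \<Longrightarrow> N (f x - f y) = c * N (x - y)"
    and ab: "a \<in> V" "b \<in> V"
  shows "f ((1/2) *\<^sub>R (a + b)) = (1/2) *\<^sub>R (f a + f b)"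
proof -
  define z where "z = (1/2) *\<^sub>R (a + b)"
  have z: "z \<in> V" using ab by (auto simp: z_def)
  define f' where "f' = inv_into V f"
  have f'V: "f' x \<in> V" and ff': "f (f' x) = x" if "x \<in> V" for x
    using f(1) that by (auto simp: f'_def bij_betw_def inv_into_into f_inv_into_f)
  have f'f: "f' (f x) = x" if "x \<in> V" for x
    using f(1) that by (auto simp: f'_def bij_betw_def inv_into_f_f)
  have fV: "f x \<in> V" if "x \<in> V" for x
    using f(1) that by (auto simp: bij_betw_def)
  have iso': "N (x - y) = c * N (f' x - f' y)" if "x \<in> V" "y \<in> V" for x y
    using f(2)[of "f' x" "f' y"] that by (simp add: f'V ff')
  define k where "k = (\<lambda>x. (a + b) - f' ((f a + f b) - f x))"
  have "k ((1/2) *\<^sub>R (a + b)) = (1/2) *\<^sub>R (a + b)"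
  proof (rule isometry_fixes_midpoint[OF ab])
    show "bij_betw k V V"
      unfolding k_def
      by (rule bij_betw_byWitness[where f' = "\<lambda>x. f' ((f a + f b) - f ((a + b) - x))"])
        (use ab in \<open>auto simp: f'V fV ff' f'f\<close>)
    show "k a = a" "k b = b" using ab by (simp_all add: k_def f'f)
    fix x y assume xy: "x \<in> V" "y \<in> V"
    have V: "(f a + f b) - f x \<in> V" "(f a + f b) - f y \<in> V" using xy ab fV by auto
    have "N (k x - k y) = N (f' ((f a + f b) - f y) - f' ((f a + f b) - f x))"
      by (simp add: k_def)
    also have "c * \<dots> = N (((f a + f b) - f y) - ((f a + f b) - f x))"
      using V by (intro iso'[symmetric])
    also have "\<dots> = N (f x - f y)" by simp
    also have "\<dots> = c * N (x - y)" using xy by (rule f(2))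
    finally show "N (k x - k y) = N (x - y)" using c by simp
  qed
  then have "(a + b) - f' ((f a + f b) - f z) = z" by (simp add: k_def z_def)
  moreover have "a + b = z + z" by (simp add: z_def flip: scaleR_left_distrib)
  ultimately have "f' ((f a + f b) - f z) = z" by (simp add: algebra_simps)
  then have "f z = (f a + f b) - f z"
    using ff'[of "(f a + f b) - f z"] ab z fV by auto
  then have "f z + f z = f a + f b" by (simp add: algebra_simps)
  then have "2 *\<^sub>R f z = f a + f b" by (simp add: scaleR_2)
  then have "(1/2) *\<^sub>R (2 *\<^sub>R f z) = (1/2) *\<^sub>R (f a + f b)" by simp
  then show ?thesis by (simp add: z_def)
qed

text \<open>Preservation of midpoints makes \<open>g\<close> additive, hence homogeneous for
  integers. Real factors follow from the homothety property: the defect of homogeneity stays bounded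
  when multiplied by any natural number.\<close>

theorem Mazur_Ulam:
  assumes c: "c > 0" and f: "bij_betw f V V" "\<And>x y. x \<in> V \<Longrightarrow> y \<in> V \<Longrightarrow> N (f x - f y) = c * N (x - y)"
  defines "g \<equiv> \<lambda>x. f x - f 0"
  shows "\<And>x y. x \<in> V \<Longrightarrow> y \<in> V \<Longrightarrow> g (x + y) = g x + g y"
    and "\<And>x t. x \<in> V \<Longrightarrow> g (t *\<^sub>R x) = t *\<^sub>R g x"
proof -
  have fV: "f x \<in> V" if "x \<in> V" for x
    using f(1) that by (auto simp: bij_betw_def)
  have mid: "g ((1/2) *\<^sub>R (x + y)) = (1/2) *\<^sub>R (g x + g y)" if "x \<in> V" "y \<in> V" for x y
  proof -
    have "g ((1/2) *\<^sub>R (x + y)) = (1/2) *\<^sub>R (f x + f y) - f 0"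
      by (simp only: g_def homothety_midpoint[OF c f that])
    also have "f 0 = (1/2) *\<^sub>R (f 0 + f 0)" by (simp flip: scaleR_2)
    finally show ?thesis by (simp add: g_def algebra_simps)
  qed
  have g0: "g 0 = 0" by (simp add: g_def)
  have half: "g ((1/2) *\<^sub>R x) = (1/2) *\<^sub>R g x" if "x \<in> V" for x
    using mid[of x 0] that g0 by simp
  have add: "g (x + y) = g x + g y" if "x \<in> V" "y \<in> V" for x y
  proof -
    have "(1/2) *\<^sub>R g (x + y) = (1/2) *\<^sub>R (g x + g y)"
      using half[of "x + y"] mid[of x y] that by auto
    then show ?thesis by simp
  qed
  then show "\<And>x y. x \<in> V \<Longrightarrow> y \<in> V \<Longrightarrow> g (x + y) = g x + g y" .
  have gV: "g x \<in> V" if "x \<in> V" for x using fV that by (auto simp: g_def)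
  have minus: "g (- x) = - g x" if "x \<in> V" for x
  proof -
    have "- x \<in> V" using V_closed(4)[OF that, of "-1"] by simp
    then have "g x + g (- x) = 0" using add[of x "- x"] that g0 by simp
    then show ?thesis by (simp add: add_eq_0_iff)
  qed
  have nat: "g (real n *\<^sub>R x) = real n *\<^sub>R g x" if "x \<in> V" for n x
  proof (induction n)
    case (Suc n)
    have "g (x + real n *\<^sub>R x) = g x + g (real n *\<^sub>R x)" using that by (intro add) auto
    then show ?case using Suc by (simp add: algebra_simps)
  qed (simp add: g0)
  have int: "g (real_of_int k *\<^sub>R x) = real_of_int k *\<^sub>R g x" if "x \<in> V" for k x
  proof (cases "k \<ge> 0")
    case True
    then show ?thesis using nat[OF that, of "nat k"] by simp
  next
    case False
    define n where "n = nat (- k)"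
    have k: "real_of_int k = - real n" using False by (simp add: n_def)
    show ?thesis unfolding k using nat[OF that, of n] minus[of "real n *\<^sub>R x"] that by simp
  qed
  have N_g: "N (g x) = c * N x" if "x \<in> V" for x
    using f(2)[OF that, of 0] by (simp add: g_def)
  show "g (t *\<^sub>R x) = t *\<^sub>R g x" if x: "x \<in> V" for x t
  proof -
    define e where "e = g (t *\<^sub>R x) - t *\<^sub>R g x"
    have e: "e \<in> V" using x gV by (auto simp: e_def)
    have "real n * N e \<le> 2 * c * N x" for n
    proof -
      \<comment> \<open>The integer part of \<open>n * t\<close> contributes no error, so the defect
        at scale \<open>n\<close> comes from the remainder \<open>r\<close> alone and has a bound
        independent of \<open>n\<close>.\<close>
      define k where "k = \<lfloor>real n * t\<rfloor>"
      define r where "r = real n * t - real_of_int k"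
      have r: "\<bar>r\<bar> \<le> 1" by (simp add: r_def k_def) linarith
      have "g (real n *\<^sub>R (t *\<^sub>R x)) = real n *\<^sub>R g (t *\<^sub>R x)"
        using x by (intro nat) auto
      moreover have "real n *\<^sub>R (t *\<^sub>R x) = real_of_int k *\<^sub>R x + r *\<^sub>R x"
        by (simp add: r_def algebra_simps)
      moreover have "g (real_of_int k *\<^sub>R x + r *\<^sub>R x) = real_of_int k *\<^sub>R g x + g (r *\<^sub>R x)"
        using x by (subst add) (auto simp: int)
      ultimately have "real n *\<^sub>R e = g (r *\<^sub>R x) + (- r) *\<^sub>R g x"
        by (simp add: e_def r_def algebra_simps)
      then have "real n * N e = N (g (r *\<^sub>R x) + (- r) *\<^sub>R g x)"
        using N_scale[OF e, of "real n"] by simp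
      also have "\<dots> \<le> N (g (r *\<^sub>R x)) + N ((- r) *\<^sub>R g x)"
        using x gV by (intro N_add) (auto simp del: scaleR_minus_left)
      also have "\<dots> = \<bar>r\<bar> * (2 * c * N x)"
        using x gV by (simp add: N_g N_scale del: scaleR_minus_left)
      also have "\<dots> \<le> 1 * (2 * c * N x)"
        using r c N_nonneg[OF x] by (intro mult_right_mono) auto
      finally show ?thesis by simp
    qed
    then have "\<not> N e > 0"
      using reals_Archimedean3[of "N e"] by (meson not_le)
    then have "N e = 0" using N_nonneg[OF e] by linarith
    then have "e = 0" by (rule N_eq_0[OF e])
    then show ?thesis by (simp add: e_def)
  qed
qed

end

section \<open>Conformal linear parts\<close>

text \<open>Through matrix entries, continuity in \<open>g\<close> and averaging over
  \<open>g\<close> of linear maps reduce to finitely many scalar functions.\<close>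

lemma linear_coordinate_expansion:
  fixes f :: "real^'n \<Rightarrow> real^'m"
  assumes "linear f"
  shows "f v $ i = (\<Sum>k\<in>UNIV. v $ k * f (axis k 1) $ i)"
proof -
  have "v = (\<Sum>k\<in>UNIV. v $ k *\<^sub>R axis k 1)"
    using basis_expansion[of v] by (simp add: scalar_mult_eq_scaleR)
  then have "f v = (\<Sum>k\<in>UNIV. v $ k *\<^sub>R f (axis k 1))"
    using assms by (metis (no_types, lifting) linear_sum linear_cmul sum.cong)
  then show ?thesis by simp
qed

section \<open>Projections to the levels\<close>

context weighted_coordinates
begin

lemma proj_apply: "proj j x $ k = (if w k = w j then x $ k else 0)"
  by (simp add: proj_def)

lemma proj_in_level [simp]: "proj j x \<in> level j"
  by (simp add: level_def proj_apply)

lemma proj_level: "v \<in> level j \<Longrightarrow> proj j v = v"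
  by (auto simp: level_def proj_apply vec_eq_iff)

lemma linear_proj: "linear (proj j)"
  by (rule linearI) (auto simp: proj_apply vec_eq_iff)

lemmas proj_add = linear_add[OF linear_proj]
  and proj_diff = linear_diff[OF linear_proj]
  and proj_scaleR = linear_cmul[OF linear_proj]
  and proj_zero [simp] = linear_0[OF linear_proj]

lemma proj_eq_iff: "proj j x = proj j y \<longleftrightarrow> (\<forall>k. w k = w j \<longrightarrow> x $ k = y $ k)"
  by (auto simp: proj_apply vec_eq_iff)

lemma eq_if_proj_eq: "(\<And>j. proj j x = proj j y) \<Longrightarrow> x = y"
  unfolding proj_eq_iff by (auto intro: vec_eq_iff[THEN iffD2])

lemma proj_cong_weight: "w k = w j \<Longrightarrow> proj k x = proj j x"
  by (simp add: proj_apply vec_eq_iff)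

lemma proj_proj: "proj j (proj k x) = (if w j = w k then proj j x else 0)"
  by (auto simp: proj_apply vec_eq_iff)

lemma subspace_level: "subspace (level j)"
  by (auto simp: subspace_def level_def)

lemma q_proj_le: "q j 0 (proj j (x - y)) \<le> q j x y"
proof -
  have "q j 0 (0 + proj j (x - y)) = (\<Sum>k | w k = w j. \<bar>x $ k - y $ k\<bar>)"
    by (subst q_add_level) (auto simp: proj_apply)
  also have "\<dots> = (\<Sum>k | w k = w j. \<bar>x $ k - y $ k\<bar> powr (w j / w k))"
    by (rule sum.cong) auto
  also have "\<dots> \<le> q j x y"
    unfolding q_def by (intro sum_mono2) auto
  finally show ?thesis by simp
qed

lemma agree_above_sym: "agree_above j x y \<Longrightarrow> agree_above j y x"
  by (simp add: agree_above_def)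

lemma agree_above_trans: "agree_above j x y \<Longrightarrow> agree_above j y z \<Longrightarrow> agree_above j x z"
  by (simp add: agree_above_def)

lemma agree_above_add_level [simp]: "v \<in> level j \<Longrightarrow> agree_above j x (x + v)"
  by (auto simp: agree_above_def level_def)

lemma q_eq_0_if_agree:
  assumes "agree_above j x y" "proj j x = proj j y"
  shows "q j x y = 0"
  using assms unfolding q_eq_0_iff agree_above_def proj_eq_iff by (metis order_le_less)

end

text \<open>The situation in the straightening chart. Here \<open>rho\<close> is the exactly scaled
  length seen through the chart, so its comparison with \<open>q\<close> costs a constant on both
  sides.\<close>

locale straight_action = graded_action w G T m act K chi
  for w :: "'n::finite \<Rightarrow> real" and G :: "('g, 'b) monoid_scheme" (structure)
    and T m and act :: "'g \<Rightarrow> real^'n \<Rightarrow> real^'n" and K chi +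
  fixes rho :: "'n \<Rightarrow> real^'n \<Rightarrow> real^'n \<Rightarrow> real"
  assumes rho_commute: "\<And>j x y. rho j x y = rho j y x"
    and rho_triangle: "\<And>j x y z. rho j x z \<le> rho j x y + rho j y z"
    and q_le_rho: "\<And>j x y. q j x y \<le> K * rho j x y"
    and rho_le_q: "\<And>j x y. rho j x y \<le> K * q j x y"
    and rho_act: "\<And>g j x y. g \<in> carrier G \<Longrightarrow> rho j (act g x) (act g y) = exp (w j * chi g) * rho j x y"
    and rho_straight: "\<And>j v x y t. v \<in> level j \<Longrightarrow> t \<ge> 0 \<Longrightarrow> rho j x (x + t *\<^sub>R v) = t * rho j y (y + v)"
begin

definition N :: "'n \<Rightarrow> real^'n \<Rightarrow> real" where
  "N j v = rho j 0 v"

lemma rho_level: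
  assumes "v \<in> level j"
  shows "rho j x (x + v) = N j v"
  using rho_straight[OF assms, of 1 x 0] by (simp add: N_def)

sublocale norm_on_level: norm_on_subspace "level j" "N j" for j
proof
  show "subspace (level j)" by (rule subspace_level)
  show "N j (x + y) \<le> N j x + N j y" if "x \<in> level j" "y \<in> level j" for x y
    using rho_triangle[of j 0 "x + y" x] rho_level[OF that(2), of x] by (simp add: N_def)
  show "N j (t *\<^sub>R x) = \<bar>t\<bar> * N j x" if x: "x \<in> level j" for x t
  proof (cases "t \<ge> 0")
    case True
    then show ?thesis using rho_straight[OF x True, of 0 0] by (simp add: N_def)
  next
    case False
    \<comment> \<open>Straightness speaks of nonnegative multiples only; a negative multiple of
      \<open>x\<close> is a positive multiple of \<open>- x\<close>, whose segment from
      \<open>x\<close> leads back to 0.\<close>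
    have mx: "- x \<in> level j" using x by (simp add: level_def)
    have "N j (t *\<^sub>R x) = rho j 0 (0 + (- t) *\<^sub>R (- x))" by (simp add: N_def)
    also have "\<dots> = (- t) * rho j x (x + - x)"
      using False by (intro rho_straight[OF mx]) auto
    also have "\<dots> = \<bar>t\<bar> * N j x"
      using False rho_commute[of j x 0] by (simp add: N_def)
    finally show ?thesis .
  qed
  show "x = 0" if "x \<in> level j" "N j x = 0" for x
  proof -
    have "q j 0 x \<le> 0" using q_le_rho[of j 0 x] that(2) by (simp add: N_def)
    then have "q j 0 x = 0" using q_nonneg[of j 0 x] by linarith
    then have "w j \<le> w k \<longrightarrow> x $ k = 0" for k by (simp add: q_eq_0_iff)
    then have "x $ k = 0" for k
      using that(1) by (cases "w k = w j") (simp_all add: level_def)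
    then show ?thesis by (simp add: vec_eq_iff)
  qed
qed

lemma coordinate_le_N:
  assumes "w k = w j"
  shows "\<bar>v $ k\<bar> \<le> K * N j (proj j v)"
  using coordinate_le_q[OF assms, of "proj j v" 0] q_le_rho[of j 0 "proj j v"] assms
  by (simp add: N_def proj_apply q_commute)

lemma N_le_q: "N j v \<le> K * q j 0 v"
  by (simp add: N_def rho_le_q)

lemma rho_nonneg: "rho j x y \<ge> 0"
proof -
  have "0 \<le> K * rho j x y" using q_le_rho[of j x y] q_nonneg[of j x y] by linarith
  then show ?thesis using K_pos(1) by (simp only: zero_le_mult_iff) linarith
qed

lemma rho_eq_0_iff: "rho j x y = 0 \<longleftrightarrow> q j x y = 0"
proof
  show "q j x y = 0" if "rho j x y = 0"
    using q_le_rho[of j x y] q_nonneg[of j x y] by (simp add: that)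
  show "rho j x y = 0" if "q j x y = 0"
    using rho_le_q[of j x y] rho_nonneg[of j x y] by (simp add: that)
qed

text \<open>Coordinates of smaller weight are invisible to \<open>rho j\<close>, so \<open>y\<close>
  may be replaced by a point that differs from \<open>x\<close> within level \<open>j\<close>
  only.\<close>

lemma rho_agree_above:
  assumes "agree_above j x y"
  shows "rho j x y = N j (proj j (y - x))"
proof -
  define z where "z = x + proj j (y - x)"
  have "q j z y = 0"
    by (intro q_eq_0_if_agree)
       (use assms in \<open>auto simp: z_def agree_above_def proj_apply proj_eq_iff\<close>)
  then have "rho j z y = 0" by (simp add: rho_eq_0_iff)
  then have "rho j x y = rho j x z"
    using rho_triangle[of j x y z] rho_triangle[of j x z y] rho_commute[of j y z] by simp
  also have "\<dots> = N j (proj j (y - x))"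
    unfolding z_def by (rule rho_level) simp
  finally show ?thesis .
qed

lemma q_act_le:
  assumes "g \<in> carrier G"
  shows "q j (act g x) (act g y) \<le> K * K * exp (w j * chi g) * q j x y"
proof -
  have "q j (act g x) (act g y) \<le> K * (exp (w j * chi g) * rho j x y)"
    using q_le_rho[of j "act g x" "act g y"] assms by (simp add: rho_act)
  also have "\<dots> \<le> K * (exp (w j * chi g) * (K * q j x y))"
    by (intro mult_left_mono rho_le_q) auto
  finally show ?thesis by (simp add: ac_simps)
qed

lemma act_q_eq_0:
  assumes "g \<in> carrier G" "q j x y = 0"
  shows "q j (act g x) (act g y) = 0"
  using assms rho_act[OF assms(1), of j x y] by (simp flip: rho_eq_0_iff)

text \<open>The cosets are cut out by the vanishing of \<open>q k\<close> for the larger weights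
  \<open>w k\<close>, and exact scaling preserves zero distances.\<close>

lemma act_agree_above:
  assumes g: "g \<in> carrier G" and "agree_above j x y"
  shows "agree_above j (act g x) (act g y)"
  unfolding agree_above_def
proof (intro allI impI)
  fix k assume "w k > w j"
  then have "q k x y = 0"
    using assms(2) unfolding q_eq_0_iff agree_above_def by auto
  then have "q k (act g x) (act g y) = 0" by (rule act_q_eq_0[OF g])
  then show "act g x $ k = act g y $ k" unfolding q_eq_0_iff by blast
qed

lemma act_proj_eq:
  assumes "g \<in> carrier G" "agree_above j x y" "proj j x = proj j y"
  shows "proj j (act g x) = proj j (act g y)"
  using act_q_eq_0[OF assms(1) q_eq_0_if_agree[OF assms(2,3)]]
  unfolding q_eq_0_iff proj_eq_iff by auto

text \<open>The map induced by \<open>g\<close> between the level-\<open>j\<close> directions at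
  \<open>x\<close> and at its image, read modulo the lighter levels.\<close>

definition disp :: "'g \<Rightarrow> 'n \<Rightarrow> real^'n \<Rightarrow> real^'n \<Rightarrow> real^'n" where
  "disp g j x u = proj j (act g (x + u)) - proj j (act g x)"

lemma disp_homothety:
  assumes g: "g \<in> carrier G" and u: "u \<in> level j" "v \<in> level j"
  shows "N j (disp g j x u - disp g j x v) = exp (w j * chi g) * N j (u - v)"
proof -
  have ag: "agree_above j (x + v) (x + u)"
    using u by (meson agree_above_add_level agree_above_sym agree_above_trans)
  have "N j (disp g j x u - disp g j x v) = rho j (act g (x + v)) (act g (x + u))"
    by (subst rho_agree_above[OF act_agree_above[OF g ag]]) (simp add: disp_def proj_diff)
  also have "\<dots> = exp (w j * chi g) * N j (proj j (u - v))"
    by (simp add: rho_act[OF g] rho_agree_above[OF ag])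
  also have "proj j (u - v) = u - v"
    using u by (simp add: proj_diff proj_level)
  finally show ?thesis .
qed

lemma disp_in_level: "disp g j x u \<in> level j"
  by (simp add: disp_def norm_on_level.V_closed)

text \<open>A preimage of \<open>v\<close> is found by pulling back with \<open>inv g\<close> and
  projecting to level \<open>j\<close>; the lighter coordinates lost in the projection do not affect
  the level-\<open>j\<close> part of the image.\<close>

lemma bij_disp:
  assumes g: "g \<in> carrier G"
  shows "bij_betw (disp g j x) (level j) (level j)"
  unfolding bij_betw_def
proof
  show "inj_on (disp g j x) (level j)"
  proof (rule inj_onI)
    fix u v assume uv: "u \<in> level j" "v \<in> level j" "disp g j x u = disp g j x v"
    then have "exp (w j * chi g) * N j (u - v) = 0"
      using disp_homothety[OF g uv(1,2), of x] by simp
    then show "u = v"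
      using norm_on_level.N_eq_0[of "u - v" j] uv by (simp add: norm_on_level.V_closed)
  qed
  have "v \<in> disp g j x ` level j" if v: "v \<in> level j" for v
  proof
    define z where "z = act (inv g) (act g x + v)"
    define u where "u = proj j (z - x)"
    have gz: "act g z = act g x + v" using g by (simp add: z_def)
    have xz: "agree_above j x z"
      using act_agree_above[of "inv g" j "act g x" "act g x + v"] v g by (simp add: z_def)
    have "proj j (act g (x + u)) = proj j (act g z)"
      by (rule act_proj_eq[OF g])
         (use xz in \<open>auto simp: u_def agree_above_def proj_eq_iff proj_apply\<close>)
    then show "v = disp g j x u"
      using v by (simp add: disp_def gz proj_add proj_level)
    show "u \<in> level j" by (simp add: u_def)
  qed
  then show "disp g j x ` level j = level j"
    by (auto simp: disp_in_level)
qed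

lemma disp_linear:
  assumes g: "g \<in> carrier G"
  shows "u \<in> level j \<Longrightarrow> v \<in> level j \<Longrightarrow> disp g j x (u + v) = disp g j x u + disp g j x v"
    and "u \<in> level j \<Longrightarrow> disp g j x (t *\<^sub>R u) = t *\<^sub>R disp g j x u"
proof -
  have "disp g j x 0 = 0" by (simp add: disp_def)
  then show "u \<in> level j \<Longrightarrow> v \<in> level j \<Longrightarrow> disp g j x (u + v) = disp g j x u + disp g j x v"
    "u \<in> level j \<Longrightarrow> disp g j x (t *\<^sub>R u) = t *\<^sub>R disp g j x u"
    using norm_on_level.Mazur_Ulam[where c = "exp (w j * chi g)" and f = "disp g j x" and j = j,
        OF _ bij_disp[OF g] disp_homothety[OF g]]
    by simp_all
qed

text \<open>Two linear maps at bounded distance from each other coincide.\<close>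

lemma disp_base_point:
  assumes g: "g \<in> carrier G" and u: "u \<in> level j"
  shows "disp g j x u = disp g j y u"
proof -
  \<comment> \<open>Translating both base points by the same multiple of \<open>u\<close> leaves
    \<open>q j\<close> unchanged, so the bound is independent of the multiple.\<close>
  define B where "B = 2 * (K * K * exp (w j * chi g) * q j x y)"
  have "(disp g j x u - disp g j y u) $ k = 0" for k
  proof (cases "w k = w j")
    case True
    have "real n * \<bar>(disp g j x u - disp g j y u) $ k\<bar> \<le> B" for n
    proof -
      let ?v = "real n *\<^sub>R u"
      have "real n * \<bar>(disp g j x u - disp g j y u) $ k\<bar> = \<bar>(real n *\<^sub>R disp g j x u - real n *\<^sub>R disp g j y u) $ k\<bar>"
        by (simp add: abs_mult flip: right_diff_distrib)
      also have "\<dots> = \<bar>(disp g j x ?v - disp g j y ?v) $ k\<bar>"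
        by (simp add: disp_linear(2)[OF g u])
      also have "\<dots> \<le> \<bar>act g (x + ?v) $ k - act g (y + ?v) $ k\<bar> + \<bar>act g x $ k - act g y $ k\<bar>"
        using True by (simp add: disp_def proj_apply)
      also have "\<dots> \<le> q j (act g (x + ?v)) (act g (y + ?v)) + q j (act g x) (act g y)"
        by (intro add_mono coordinate_le_q True)
      also have "\<dots> \<le> B"
        using q_act_le[OF g, of j x y] q_act_le[OF g, of j "x + ?v" "y + ?v"] q_translate[of j ?v x y]
        by (simp add: B_def add.commute)
      finally show ?thesis .
    qed
    then have "\<not> \<bar>(disp g j x u - disp g j y u) $ k\<bar> > 0"
      using reals_Archimedean3[of "\<bar>(disp g j x u - disp g j y u) $ k\<bar>"] by (meson not_le)
    then show ?thesis by linarith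
  next
    case False
    then show ?thesis by (simp add: disp_def proj_apply)
  qed
  then have "disp g j x u - disp g j y u = 0" unfolding vec_eq_iff by simp
  then show ?thesis by simp
qed

text \<open>The block diagonal map with the linear parts of all levels as blocks: each coordinate is
  computed from the level to which it belongs.\<close>

definition Lam :: "'g \<Rightarrow> real^'n \<Rightarrow> real^'n" where
  "Lam g z = (\<chi> i. act g (proj i z) $ i - act g 0 $ i)"

lemma proj_Lam_eq_disp: "proj j (Lam g z) = disp g j 0 (proj j z)"
proof -
  have "proj j (Lam g z) $ k = disp g j 0 (proj j z) $ k" for k
  proof (cases "w k = w j")
    case True
    then show ?thesis
      using proj_cong_weight[OF True, of z] by (simp add: disp_def Lam_def proj_apply)
  qed (simp add: disp_def proj_apply)
  then show ?thesis by (simp add: vec_eq_iff)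
qed

lemma proj_act_diff:
  assumes g: "g \<in> carrier G" and xy: "agree_above j x y"
  shows "proj j (act g y) - proj j (act g x) = proj j (Lam g (y - x))"
proof -
  have "proj j (act g (x + proj j (y - x))) = proj j (act g y)"
    by (rule act_proj_eq[OF g]) (use xy in \<open>auto simp: agree_above_def proj_eq_iff proj_apply\<close>)
  then have "proj j (act g y) - proj j (act g x) = disp g j x (proj j (y - x))"
    by (simp add: disp_def)
  also have "\<dots> = proj j (Lam g (y - x))"
    unfolding proj_Lam_eq_disp by (rule disp_base_point[OF g]) simp
  finally show ?thesis .
qed

lemma linear_Lam:
  assumes g: "g \<in> carrier G"
  shows "linear (Lam g)"
proof (rule linearI)
  show "Lam g (x + y) = Lam g x + Lam g y" for x y
    by (rule eq_if_proj_eq) (simp add: proj_Lam_eq_disp proj_add disp_linear(1)[OF g])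
  show "Lam g (t *\<^sub>R x) = t *\<^sub>R Lam g x" for t x
    by (rule eq_if_proj_eq) (simp add: proj_Lam_eq_disp proj_scaleR disp_linear(2)[OF g])
qed

lemma Lam_proj:
  assumes g: "g \<in> carrier G"
  shows "Lam g (proj j z) = proj j (Lam g z)"
proof (rule eq_if_proj_eq)
  have d0: "disp g k 0 0 = 0" for k by (simp add: disp_def)
  fix k
  have "proj k (Lam g (proj j z)) = disp g k 0 (if w k = w j then proj k z else 0)"
    by (simp only: proj_Lam_eq_disp proj_proj)
  also have "\<dots> = proj k (proj j (Lam g z))"
    by (subst proj_proj) (simp add: proj_Lam_eq_disp d0)
  finally show "proj k (Lam g (proj j z)) = proj k (proj j (Lam g z))" .
qed

text \<open>A chain rule. After \<open>h\<close> the linear part of \<open>g\<close> is met at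
  \<open>act h 0\<close> instead of 0, which makes no difference because it does not depend on the
  base point.\<close>

lemma Lam_mult:
  assumes g: "g \<in> carrier G" and h: "h \<in> carrier G"
  shows "Lam (g \<otimes> h) z = Lam g (Lam h z)"
proof (rule eq_if_proj_eq)
  fix j
  have "agree_above j 0 (proj j z)"
    using agree_above_add_level[of "proj j z" j 0] by simp
  then have ag: "agree_above j (act h 0) (act h (proj j z))"
    by (rule act_agree_above[OF h])
  have "proj j (Lam (g \<otimes> h) z) = proj j (act g (act h (proj j z))) - proj j (act g (act h 0))"
    using g h by (simp add: proj_Lam_eq_disp disp_def act_mult)
  also have "\<dots> = proj j (Lam g (act h (proj j z) - act h 0))"
    by (rule proj_act_diff[OF g ag])
  also have "\<dots> = proj j (Lam g (Lam h z))"
    by (simp add: proj_Lam_eq_disp proj_diff) (simp add: disp_def)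
  finally show "proj j (Lam (g \<otimes> h) z) = proj j (Lam g (Lam h z))" .
qed

lemma Lam_one: "Lam \<one> z = z"
  by (simp add: Lam_def vec_eq_iff proj_apply)

lemma N_Lam:
  assumes g: "g \<in> carrier G"
  shows "N j (proj j (Lam g z)) = exp (w j * chi g) * N j (proj j z)"
  using disp_homothety[OF g, of "proj j z" j 0 0]
  by (simp add: proj_Lam_eq_disp disp_def)

lemma continuous_map_coordinate:
  assumes "continuous_map T euclidean (f :: 'g \<Rightarrow> real^'n)"
  shows "continuous_map T euclideanreal (\<lambda>g. f g $ i)"
  by (rule continuous_map_compose_on[OF assms, where S = UNIV]) (intro continuous_intros, simp)

lemma continuous_Lam: "continuous_map T euclideanreal (\<lambda>g. Lam g z $ i)"
  unfolding Lam_def by (simp, intro continuous_map_diff continuous_map_coordinate continuous_act)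

lemma continuous_Lam_inv: "continuous_map T euclideanreal (\<lambda>g. Lam (inv g) z $ i)"
  using continuous_map_compose[OF continuous_inv continuous_Lam] by (simp add: o_def)

end

section \<open>Removing the translation parts\<close>

text \<open>Completing the square.\<close>

lemma positive_form_sum_of_squares:
  fixes B :: "real^'n \<Rightarrow> real^'n \<Rightarrow> real"
  assumes "finite I" and "\<And>u v. B u v = B v u" and "\<And>u. linear (B u)"
    and "\<And>v. (\<forall>k. k \<notin> I \<longrightarrow> v $ k = 0) \<Longrightarrow> v \<noteq> 0 \<Longrightarrow> B v v > 0"
  shows "\<exists>s. (\<forall>i. linear (s i)) \<and> (\<forall>z. (\<forall>k. k \<notin> I \<longrightarrow> z $ k = 0) \<longrightarrow> B z z = (\<Sum>i\<in>I. (s i z :: real)\<^sup>2))"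
  using assms
proof (induction I arbitrary: B rule: finite_induct)
  case empty
  have "B z z = 0" if "\<forall>k. z $ k = 0" for z
  proof -
    have "z = 0" using that by (simp add: vec_eq_iff)
    then show ?thesis using linear_0[OF empty(2)] by simp
  qed
  then show ?case by (intro exI[of _ "\<lambda>i z. 0"]) (auto intro: linearI)
next
  case (insert k I)
  note sym = insert.prems(1) and lin = insert.prems(2) and pos = insert.prems(3)
  note add = linear_add[OF lin] and diff = linear_diff[OF lin] and scale = linear_cmul[OF lin]
  define e :: "real^'n" where "e = axis k 1"
  define b where "b = B e e"
  have b: "b > 0"
    unfolding b_def by (rule pos) (auto simp: e_def axis_def vec_eq_iff)
  \<comment> \<open>Removing the square of the form \<open>B e\<close> leaves a form for which
    \<open>e\<close> is null, while it stays positive on vectors supported in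
    \<open>I\<close>.\<close>
  define B' where "B' u v = B u v - B e u * B e v / b" for u v
  have sym': "B' u v = B' v u" for u v
    using sym[of u v] by (simp add: B'_def)
  have lin': "linear (B' u)" for u
    by (rule linearI) (simp_all add: B'_def add scale add_divide_distrib algebra_simps)
  have B'e: "B' u e = 0" for u
    using b sym[of e u] by (simp add: B'_def b_def)
  have complete: "B' v v = B (v - (B e v / b) *\<^sub>R e) (v - (B e v / b) *\<^sub>R e)" for v
  proof -
    let ?c = "B e v / b"
    have "B (v - ?c *\<^sub>R e) (v - ?c *\<^sub>R e) = B (v - ?c *\<^sub>R e) v - ?c * B (v - ?c *\<^sub>R e) e"
      by (simp add: diff scale)
    also have "B (v - ?c *\<^sub>R e) v = B v v - ?c * B e v"
      using sym[of "v - ?c *\<^sub>R e" v] sym[of v e] by (simp add: diff scale)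
    also have "B (v - ?c *\<^sub>R e) e = B e v - ?c * b"
      using sym[of "v - ?c *\<^sub>R e" e] by (simp add: diff scale b_def)
    finally show ?thesis using b by (simp add: B'_def)
  qed
  have pos': "B' v v > 0" if v: "\<forall>l. l \<notin> I \<longrightarrow> v $ l = 0" "v \<noteq> 0" for v
    unfolding complete
  proof (rule pos)
    let ?c = "B e v / b"
    show "\<forall>l. l \<notin> insert k I \<longrightarrow> (v - ?c *\<^sub>R e) $ l = 0"
      using v by (auto simp: e_def axis_def)
    show "v - ?c *\<^sub>R e \<noteq> 0"
    proof
      assume h: "v - ?c *\<^sub>R e = 0"
      then have "(v - ?c *\<^sub>R e) $ k = 0" by simp
      then have "?c = 0" using v(1) insert.hyps by (simp add: e_def)
      have "v = 0" using h unfolding \<open>?c = 0\<close> by simp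
      then show False using v(2) by simp
    qed
  qed
  obtain s where s: "\<And>i. linear (s i)"
    "\<And>z. (\<forall>k. k \<notin> I \<longrightarrow> z $ k = 0) \<Longrightarrow> B' z z = (\<Sum>i\<in>I. (s i z)\<^sup>2)"
    using insert.IH[OF sym' lin' pos'] by blast
  \<comment> \<open>The inductive squares are valid on vectors supported in \<open>I\<close>, so
    coordinate \<open>k\<close> is cleared first; \<open>B'\<close> does not notice this because
    \<open>e\<close> is null for it.\<close>
  define t where "t i z = (if i = k then B e z / sqrt b else s i (z - z $ k *\<^sub>R e))" for i z
  have "linear (t i)" for i
  proof (cases "i = k")
    case True
    then show ?thesis
      by (intro linearI) (auto simp: t_def add scale add_divide_distrib)
  next
    case False
    have "s i (x + y - (x $ k + y $ k) *\<^sub>R e) = s i (x - x $ k *\<^sub>R e) + s i (y - y $ k *\<^sub>R e)" for x y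
      by (simp flip: linear_add[OF s(1)] add: algebra_simps)
    moreover have "s i (r *\<^sub>R x - (r * x $ k) *\<^sub>R e) = r * s i (x - x $ k *\<^sub>R e)" for r x
      using linear_cmul[OF s(1), of i r "x - x $ k *\<^sub>R e"] by (simp add: algebra_simps)
    ultimately show ?thesis using False by (intro linearI) (auto simp: t_def)
  qed
  moreover have "B z z = (\<Sum>i\<in>insert k I. (t i z)\<^sup>2)" if z: "\<forall>l. l \<notin> insert k I \<longrightarrow> z $ l = 0" for z
  proof -
    let ?y = "z - z $ k *\<^sub>R e"
    have "B' z z = B' ?y ?y"
      using sym'[of z e] sym'[of ?y z]
      by (simp add: linear_diff[OF lin'] linear_cmul[OF lin'] B'e)
    also have "\<dots> = (\<Sum>i\<in>I. (s i ?y)\<^sup>2)"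
      by (rule s(2)) (use z in \<open>auto simp: e_def axis_def\<close>)
    also have "\<dots> = (\<Sum>i\<in>I. (t i z)\<^sup>2)"
      by (rule sum.cong) (use insert.hyps in \<open>auto simp: t_def\<close>)
    finally have "B z z = (B e z)\<^sup>2 / b + (\<Sum>i\<in>I. (t i z)\<^sup>2)"
      by (simp add: B'_def power2_eq_square)
    also have "(B e z)\<^sup>2 / b = (t k z)\<^sup>2"
      using b by (simp add: t_def power_divide)
    finally show ?thesis using insert.hyps by simp
  qed
  ultimately show ?case by blast
qed

context weighted_coordinates
begin

definition q_Lipschitz :: "(real^'n \<Rightarrow> real^'n) \<Rightarrow> bool" where
  "q_Lipschitz F \<longleftrightarrow> (\<exists>C>0. \<forall>j x y. q j (F x) (F y) \<le> C * q j x y)"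

text \<open>A bound of coordinate \<open>k\<close> by \<open>q k\<close> becomes, after the power
  \<open>w j / w k\<close>, a bound by \<open>q j\<close>; summing over \<open>k\<close> gives
  \<open>q j\<close> of the images.\<close>

lemma q_Lipschitz_if_coordinatewise:
  assumes "\<And>i x y. \<bar>F x $ i - F y $ i\<bar> \<le> C i * q i x y"
  shows "q_Lipschitz F"
proof -
  define D where "D i = max 1 (C i)" for i
  define L where "L = (\<Sum>j\<in>UNIV. \<Sum>k\<in>UNIV. D k powr (w j / w k))"
  have D: "D i \<ge> 1" for i by (simp add: D_def)
  have "q j (F x) (F y) \<le> L * q j x y" for j x y
  proof -
    have "\<bar>F x $ k - F y $ k\<bar> powr (w j / w k) \<le> D k powr (w j / w k) * q j x y" if "w j \<le> w k" for k
    proof -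
      have "\<bar>F x $ k - F y $ k\<bar> \<le> D k * q k x y"
        using assms[of x k y] mult_right_mono[of "C k" "D k" "q k x y"] by (simp add: D_def)
      then have "\<bar>F x $ k - F y $ k\<bar> powr (w j / w k) \<le> (D k * q k x y) powr (w j / w k)"
        by (intro powr_mono2) auto
      also have "\<dots> = D k powr (w j / w k) * q k x y powr (w j / w k)"
        using D[of k] by (simp add: powr_mult)
      also have "\<dots> \<le> D k powr (w j / w k) * q j x y"
        by (intro mult_left_mono q_powr_le_q that) auto
      finally show ?thesis .
    qed
    then have "q j (F x) (F y) \<le> (\<Sum>k | w j \<le> w k. D k powr (w j / w k) * q j x y)"
      unfolding q_def[of j "F x"] by (intro sum_mono) auto
    also have "\<dots> \<le> (\<Sum>k\<in>UNIV. D k powr (w j / w k) * q j x y)"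
      by (intro sum_mono2) auto
    also have "\<dots> = (\<Sum>k\<in>UNIV. D k powr (w j / w k)) * q j x y"
      by (simp add: sum_distrib_right)
    also have "\<dots> \<le> L * q j x y"
      unfolding L_def by (intro mult_right_mono member_le_sum[where f = "\<lambda>j. \<Sum>k\<in>UNIV. D k powr (w j / w k)"] sum_nonneg) auto
    finally show ?thesis .
  qed
  then have "q j (F x) (F y) \<le> max 1 L * q j x y" for j x y
    using mult_right_mono[of L "max 1 L" "q j x y"] by (meson max.cobounded2 order_trans q_nonneg)
  then show ?thesis unfolding q_Lipschitz_def by (intro exI[of _ "max 1 L"]) auto
qed

lemma q_Lipschitz_compose:
  assumes "q_Lipschitz F" "q_Lipschitz H"
  shows "q_Lipschitz (\<lambda>x. F (H x))"
proof -
  obtain C D where C: "C > 0" "\<And>j x y. q j (F x) (F y) \<le> C * q j x y"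
    and D: "D > 0" "\<And>j x y. q j (H x) (H y) \<le> D * q j x y"
    using assms unfolding q_Lipschitz_def by blast
  have "q j (F (H x)) (F (H y)) \<le> C * D * q j x y" for j x y
    using C(2)[of j "H x" "H y"] mult_left_mono[OF D(2)[of j x y] less_imp_le[OF C(1)]] by (simp add: mult.assoc)
  then show ?thesis unfolding q_Lipschitz_def using C(1) D(1) by (intro exI[of _ "C * D"]) auto
qed

end

section \<open>The average of the orbit of the identity\<close>

context straight_action
begin

lemma continuous_Lam_comp:
  assumes "continuous_map T euclidean v"
  shows "continuous_map T euclideanreal (\<lambda>g. Lam g (v g) $ i)"
proof (rule continuous_map_eq)
  show "continuous_map T euclideanreal (\<lambda>g. \<Sum>k\<in>UNIV. v g $ k * Lam g (axis k 1) $ i)"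
    by (intro continuous_map_sum continuous_map_real_mult continuous_map_coordinate[OF assms] continuous_Lam) auto
  show "(\<Sum>k\<in>UNIV. v g $ k * Lam g (axis k 1) $ i) = Lam g (v g) $ i" if "g \<in> topspace T" for g
    using linear_coordinate_expansion[OF linear_Lam, of g "v g" i] that by (simp add: topspace_T)
qed

text \<open>Differences of values are taken because they have bounds uniform in \<open>g\<close>;
  the arbitrary translation of each affine map drops out.\<close>

definition pulled :: "real^'n \<Rightarrow> real^'n \<Rightarrow> 'n \<Rightarrow> 'g \<Rightarrow> real" where
  "pulled x y i g = Lam g (act (inv g) x - act (inv g) y) $ i"

text \<open>One factor \<open>K\<close> comes from coordinates against \<open>N\<close>, one from
  \<open>N\<close> against \<open>q\<close>, two from the action on \<open>q\<close>; the
  exponentials of \<open>chi g\<close> and \<open>chi (inv g)\<close> cancel.\<close>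

lemma pulled_bound:
  assumes g: "g \<in> carrier G"
  shows "\<bar>pulled x y i g\<bar> \<le> K ^ 4 * q i x y"
proof -
  let ?d = "act (inv g) x - act (inv g) y"
  have "\<bar>pulled x y i g\<bar> \<le> K * (exp (w i * chi g) * N i (proj i ?d))"
    using coordinate_le_N[of i i "Lam g ?d"] by (simp add: pulled_def N_Lam[OF g])
  also have "\<dots> \<le> K * (exp (w i * chi g) * (K * q i 0 (proj i ?d)))"
    by (intro mult_left_mono N_le_q) auto
  also have "\<dots> \<le> K * (exp (w i * chi g) * (K * q i (act (inv g) x) (act (inv g) y)))"
    by (intro mult_left_mono q_proj_le) auto
  also have "\<dots> \<le> K * (exp (w i * chi g) * (K * (K * K * exp (w i * chi (inv g)) * q i x y)))"
    using g by (intro mult_left_mono q_act_le) auto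
  also have "\<dots> = K ^ 4 * q i x y"
    using g by (simp add: power4_eq_xxxx exp_minus field_simps)
  finally show ?thesis .
qed

lemma bounded_continuous_pulled: "bounded_continuous T (pulled x y i)"
proof (rule bounded_continuousI)
  have "continuous_map T euclidean (\<lambda>g. act (inv g) x - act (inv g) y)"
    by (intro continuous_map_diff continuous_act_inv)
  then show "continuous_map T euclideanreal (pulled x y i)"
    unfolding pulled_def by (rule continuous_Lam_comp)
  show "\<bar>pulled x y i g\<bar> \<le> K ^ 4 * q i x y" if "g \<in> topspace T" for g
    using pulled_bound that by (simp add: topspace_T)
qed

text \<open>The mean of the orbit of the identity under the affine action that sends \<open>h\<close> to
  \<open>Lam g \<circ> h \<circ> act (inv g)\<close>; it is a fixed point up to translations.\<close>

definition avg :: "real^'n \<Rightarrow> real^'n" where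
  "avg x = (\<chi> i. m (pulled x 0 i))"

lemma avg_diff: "(avg x - avg y) $ i = m (pulled x y i)"
proof -
  have "m (pulled x 0 i) - m (pulled y 0 i) = m (\<lambda>g. pulled x 0 i g - pulled y 0 i g)"
    by (intro mean_diff[OF mean_m, symmetric] bounded_continuous_pulled)
  also have "\<dots> = m (pulled x y i)"
  proof (rule mean_cong[OF mean_m])
    show "bounded_continuous T (\<lambda>g. pulled x 0 i g - pulled y 0 i g)"
      by (intro bounded_continuous_diff bounded_continuous_pulled)
    show "pulled x 0 i g - pulled y 0 i g = pulled x y i g" if "g \<in> topspace T" for g
      using that linear_diff[OF linear_Lam, of g] by (simp add: pulled_def topspace_T)
  qed
  finally show ?thesis by (simp add: avg_def)
qed

lemma avg_le: "\<bar>avg x $ i - avg y $ i\<bar> \<le> K ^ 4 * q i x y"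
proof -
  have b: "pulled x y i g \<le> K ^ 4 * q i x y" "- (K ^ 4 * q i x y) \<le> pulled x y i g" if "g \<in> topspace T" for g
    using pulled_bound[of g x y i] that unfolding topspace_T by linarith+
  have "m (pulled x y i) \<le> K ^ 4 * q i x y"
    by (rule mean_le[OF mean_m bounded_continuous_pulled b(1)])
  moreover have "- (K ^ 4 * q i x y) \<le> m (pulled x y i)"
    by (rule mean_ge[OF mean_m bounded_continuous_pulled b(2)])
  ultimately show ?thesis using avg_diff[of x y i] by simp
qed

text \<open>Within such a coset the linear part of \<open>g\<close> undoes \<open>inv g\<close>
  exactly, so the averaged function is constant. Hence \<open>avg\<close> is triangular with
  identity diagonal blocks.\<close>

lemma avg_agree_above:
  assumes "agree_above i x y"
  shows "avg x $ i - avg y $ i = x $ i - y $ i"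
proof -
  have "pulled x y i g = x $ i - y $ i" if "g \<in> topspace T" for g
  proof -
    have g: "g \<in> carrier G" "inv g \<in> carrier G" using that by (auto simp: topspace_T)
    have "agree_above i (act (inv g) y) (act (inv g) x)"
      by (rule act_agree_above[OF g(2) agree_above_sym[OF assms]])
    from proj_act_diff[OF g(1) this]
    have "proj i x - proj i y = proj i (Lam g (act (inv g) x - act (inv g) y))"
      using g by simp
    then have "(proj i x - proj i y) $ i = proj i (Lam g (act (inv g) x - act (inv g) y)) $ i" by simp
    then show ?thesis by (simp add: proj_apply pulled_def)
  qed
  then have "m (pulled x y i) = m (\<lambda>g. x $ i - y $ i)"
    by (intro mean_cong[OF mean_m] bounded_continuous_pulled)
  then show ?thesis using avg_diff[of x y i] by (simp add: mean_const[OF mean_m])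
qed

lemma act_inv_mult:
  assumes "g \<in> carrier G" "h \<in> carrier G"
  shows "act (inv (h \<otimes> g)) (act h x) = act (inv g) x"
  using assms by (simp add: group.inv_mult_group[OF group_G] act_mult)

text \<open>Substituting \<open>h \<otimes> g\<close> for \<open>g\<close> in the mean produces a
  factor \<open>Lam h\<close>, which leaves the mean entry by entry. In the coordinates
  \<open>avg\<close>, every \<open>h\<close> is thus affine with linear part
  \<open>Lam h\<close>.\<close>

lemma avg_act:
  assumes h: "h \<in> carrier G"
  shows "avg (act h x) - avg (act h y) = Lam h (avg x - avg y)"
proof -
  have "(avg (act h x) - avg (act h y)) $ i = Lam h (avg x - avg y) $ i" for i
  proof -
    have bc: "bounded_continuous T (\<lambda>g. \<Sum>k\<in>UNIV. Lam h (axis k 1) $ i * pulled x y k g)"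
      by (intro bounded_continuous_sum bounded_continuous_cmult bounded_continuous_pulled)
    have "(avg (act h x) - avg (act h y)) $ i = m (\<lambda>g. pulled (act h x) (act h y) i (h \<otimes> g))"
      unfolding avg_diff by (rule mean_invariant[OF h bounded_continuous_pulled, symmetric])
    also have "\<dots> = m (\<lambda>g. \<Sum>k\<in>UNIV. Lam h (axis k 1) $ i * pulled x y k g)"
    proof (rule mean_cong[OF mean_m bc, symmetric])
      fix g assume "g \<in> topspace T"
      then have g: "g \<in> carrier G" by (simp add: topspace_T)
      have "pulled (act h x) (act h y) i (h \<otimes> g) = Lam h (Lam g (act (inv g) x - act (inv g) y)) $ i"
        using g h by (simp add: pulled_def act_inv_mult Lam_mult)
      also have "\<dots> = (\<Sum>k\<in>UNIV. Lam h (axis k 1) $ i * pulled x y k g)"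
        by (subst linear_coordinate_expansion[OF linear_Lam[OF h]]) (simp add: pulled_def mult.commute)
      finally show "(\<Sum>k\<in>UNIV. Lam h (axis k 1) $ i * pulled x y k g) = pulled (act h x) (act h y) i (h \<otimes> g)" ..
    qed
    also have "\<dots> = (\<Sum>k\<in>UNIV. Lam h (axis k 1) $ i * m (pulled x y k))"
      by (subst mean_sum[OF mean_m])
         (auto simp: mean_cmult[OF mean_m] bounded_continuous_pulled intro!: bounded_continuous_cmult)
    also have "\<dots> = Lam h (avg x - avg y) $ i"
      by (subst linear_coordinate_expansion[OF linear_Lam[OF h]])
         (simp only: avg_diff mult.commute)
    finally show ?thesis .
  qed
  then show ?thesis unfolding vec_eq_iff by blast
qed

text \<open>Downward induction on the weight, measured by the number of heavier coordinates:
  \<open>avg\<close> is the identity along the level modulo heavier coordinates, and the influence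
  of these is bounded by the induction hypothesis.\<close>

lemma avg_ge: "\<exists>C. \<forall>x y. \<bar>x $ i - y $ i\<bar> \<le> C * q i (avg x) (avg y)"
proof (induction i rule: measure_induct_rule[where f = "\<lambda>i. card {k. w k > w i}"])
  case (less i)
  have "\<exists>C. \<forall>x y. \<bar>x $ k - y $ k\<bar> \<le> C * q k (avg x) (avg y)" if "w k > w i" for k
    using that by (intro less psubset_card_mono) auto
  then obtain C where C: "\<And>k x y. w k > w i \<Longrightarrow> \<bar>x $ k - y $ k\<bar> \<le> C k * q k (avg x) (avg y)"
    by metis
  define D where "D k = max 0 (C k)" for k
  have D: "D k \<ge> 0" "\<bar>x $ k - y $ k\<bar> \<le> D k * q k (avg x) (avg y)" if "w k > w i" for k x y
    using C[OF that, of x y] mult_right_mono[of "C k" "D k" "q k (avg x) (avg y)"] by (auto simp: D_def)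
  define S where "S = (\<Sum>k | w k > w i. D k powr (w i / w k))"
  have "\<bar>x $ i - y $ i\<bar> \<le> (1 + K ^ 4 * S) * q i (avg x) (avg y)" for x y
  proof -
    \<comment> \<open>An intermediate point: from \<open>x\<close> to \<open>z\<close> the map
      \<open>avg\<close> is exact in coordinate \<open>i\<close>, and \<open>z\<close> differs from
      \<open>y\<close> only in heavier coordinates.\<close>
    define z :: "real^'n" where "z = (\<chi> k. if w k > w i then x $ k else y $ k)"
    have "q i y z = (\<Sum>k | w i \<le> w k. if w k > w i then \<bar>y $ k - x $ k\<bar> powr (w i / w k) else 0)"
      unfolding q_def by (rule sum.cong) (auto simp: z_def)
    also have "\<dots> = (\<Sum>k | w k > w i. \<bar>x $ k - y $ k\<bar> powr (w i / w k))"
      by (rule sum.mono_neutral_cong_right) (auto simp: abs_minus_commute)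
    also have "\<dots> \<le> (\<Sum>k | w k > w i. D k powr (w i / w k) * q i (avg x) (avg y))"
    proof (rule sum_mono)
      fix k assume "k \<in> {k. w k > w i}"
      then have k: "w k > w i" by simp
      have "\<bar>x $ k - y $ k\<bar> powr (w i / w k) \<le> (D k * q k (avg x) (avg y)) powr (w i / w k)"
        by (intro powr_mono2 D k) auto
      also have "\<dots> = D k powr (w i / w k) * q k (avg x) (avg y) powr (w i / w k)"
        using D(1)[OF k] by (simp add: powr_mult)
      also have "\<dots> \<le> D k powr (w i / w k) * q i (avg x) (avg y)"
        using k by (intro mult_left_mono q_powr_le_q) auto
      finally show "\<bar>x $ k - y $ k\<bar> powr (w i / w k) \<le> D k powr (w i / w k) * q i (avg x) (avg y)" .
    qed
    also have "\<dots> = S * q i (avg x) (avg y)"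
      by (simp add: S_def sum_distrib_right)
    finally have yz: "q i y z \<le> S * q i (avg x) (avg y)" .
    have "x $ i - y $ i = x $ i - z $ i" by (simp add: z_def)
    also have "\<dots> = avg x $ i - avg z $ i"
      by (rule avg_agree_above[symmetric]) (simp add: agree_above_def z_def)
    finally have "\<bar>x $ i - y $ i\<bar> \<le> \<bar>avg x $ i - avg y $ i\<bar> + \<bar>avg y $ i - avg z $ i\<bar>" by linarith
    also have "\<dots> \<le> q i (avg x) (avg y) + K ^ 4 * q i y z"
      by (intro add_mono coordinate_le_q avg_le) simp
    also have "\<dots> \<le> q i (avg x) (avg y) + K ^ 4 * (S * q i (avg x) (avg y))"
      using yz by (intro add_left_mono mult_left_mono) auto
    finally show ?thesis by (simp add: algebra_simps)
  qed
  then show ?case by blast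
qed

text \<open>Back substitution from the largest weight down. A shift within level \<open>i\<close>
  changes the coordinates of \<open>avg\<close> at that level by exactly the shift and leaves the
  heavier ones alone.\<close>

lemma surj_avg: "surj avg"
proof -
  have "\<exists>x. \<forall>k. w i \<le> w k \<longrightarrow> avg x $ k = y $ k" for i y
  proof (induction i rule: measure_induct_rule[where f = "\<lambda>i. card {k. w k > w i}"])
    case (less i)
    have "\<exists>x. \<forall>k. w i < w k \<longrightarrow> avg x $ k = y $ k"
    proof (cases "{k. w k > w i} = {}")
      case True
      then show ?thesis by auto
    next
      case False
      \<comment> \<open>The next larger weight; the induction hypothesis for it covers all heavier
        coordinates.\<close>
      define M where "M = Min (w ` {k. w k > w i})"
      have "M \<in> w ` {k. w k > w i}"
        unfolding M_def using False by (intro Min_in) auto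
      then obtain i' where i': "M = w i'" "w i' > w i" by auto
      then have "card {k. w k > w i'} < card {k. w k > w i}"
        by (intro psubset_card_mono) auto
      from less[OF this] obtain x where x: "\<And>k. w i' \<le> w k \<Longrightarrow> avg x $ k = y $ k" by blast
      have "w i' \<le> w k" if "w i < w k" for k
        using that unfolding i'(1)[symmetric] M_def by (intro Min_le) auto
      then show ?thesis using x by blast
    qed
    then obtain x where x: "\<And>k. w i < w k \<Longrightarrow> avg x $ k = y $ k" by blast
    define z where "z = x + proj i (y - avg x)"
    have "avg z $ k = y $ k" if "w i \<le> w k" for k
    proof (cases "w k = w i")
      case True
      have "agree_above k z x"
        using True by (simp add: z_def agree_above_def proj_apply)
      then have "avg z $ k - avg x $ k = z $ k - x $ k" by (rule avg_agree_above)
      then show ?thesis using True by (simp add: z_def proj_apply)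
    next
      case False
      then have k: "w i < w k" using that by simp
      have "q k z x = 0"
        using k by (auto simp: q_eq_0_iff z_def proj_apply)
      then have "avg z $ k = avg x $ k" using avg_le[of z k x] by simp
      then show ?thesis using x[OF k] by simp
    qed
    then show ?case by blast
  qed
  note * = this
  obtain i where "\<And>k. w i \<le> w k" using exists_minimal_weight by blast
  then have "\<exists>x. avg x = y" for y using *[of i y] by (auto simp: vec_eq_iff)
  then show ?thesis unfolding surj_def by metis
qed

lemma inj_avg: "inj avg"
proof (rule injI)
  fix x y assume xy: "avg x = avg y"
  have "x $ i = y $ i" for i
    using avg_ge[of i] xy by (metis abs_le_zero_iff eq_iff_diff_eq_0 mult_zero_right q_refl)
  then show "x = y" by (simp add: vec_eq_iff)
qed

end

section \<open>A conformal inner product\<close>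

context weighted_coordinates
begin

lemma norm_proj_le: "norm (proj j z) \<le> (\<Sum>k | w k = w j. \<bar>z $ k\<bar>)"
proof -
  have "norm (proj j z) \<le> (\<Sum>k\<in>UNIV. \<bar>proj j z $ k\<bar>)" by (rule norm_le_l1_cart)
  also have "\<dots> = (\<Sum>k | w k = w j. \<bar>z $ k\<bar>)"
    by (rule sum.mono_neutral_cong_right) (auto simp: proj_apply)
  finally show ?thesis .
qed

lemma norm_proj_square: "(norm (proj j z))\<^sup>2 = (\<Sum>k | w k = w j. (z $ k)\<^sup>2)"
proof -
  have "(norm (proj j z))\<^sup>2 = (\<Sum>k\<in>UNIV. (proj j z $ k)\<^sup>2)"
    by (simp add: norm_vec_def L2_set_def sum_nonneg)
  also have "\<dots> = (\<Sum>k | w k = w j. (z $ k)\<^sup>2)"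
    by (rule sum.mono_neutral_cong_right) (auto simp: proj_apply)
  finally show ?thesis .
qed

lemma norm_proj_diff_le_q: "norm (proj j x - proj j y) \<le> q j x y"
proof -
  have "norm (proj j x - proj j y) \<le> (\<Sum>k | w k = w j. \<bar>x $ k - y $ k\<bar> powr (w j / w k))"
    using norm_proj_le[of j "x - y"] by (simp add: proj_diff)
  also have "\<dots> \<le> q j x y"
    unfolding q_def by (intro sum_mono2) auto
  finally show ?thesis .
qed

end

context straight_action
begin

text \<open>Continuity of the character is read off from a test segment whose
  \<open>rho\<close>-length is scaled exactly.\<close>

lemma continuous_exp_chi: "continuous_map T euclideanreal (\<lambda>g. exp (w i * chi g))"
proof -
  define u :: "real^'n" where "u = axis i 1"
  have u: "rho i 0 u \<noteq> 0"
    unfolding rho_eq_0_iff q_eq_0_iff by (auto simp: u_def)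
  have rho_cont: "continuous_on UNIV (\<lambda>z. rho i (fst z) (snd z))"
    by (rule continuous_on_pseudometric[OF rho_commute rho_triangle rho_le_q]) (intro continuous_intros)+
  have "continuous_map T euclideanreal (\<lambda>g. rho i (act g 0) (act g u))"
    by (rule continuous_map_compose_on2[OF continuous_act continuous_act rho_cont])
  then have "continuous_map T euclideanreal (\<lambda>g. rho i (act g 0) (act g u) * (1 / rho i 0 u))"
    by (intro continuous_map_real_mult) auto
  then show ?thesis
    by (rule continuous_map_eq) (use u in \<open>auto simp: rho_act topspace_T\<close>)
qed

text \<open>Coordinates of the inverse linear part, normalised to be an isometry of the norm
  \<open>N\<close> on the level of \<open>i\<close>.\<close>

definition rescaled :: "'n \<Rightarrow> real^'n \<Rightarrow> 'g \<Rightarrow> real" where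
  "rescaled i u g = exp (w i * chi g) * Lam (inv g) u $ i"

text \<open>Weyl's averaging trick with a mean in place of Haar measure: the Euclidean inner product
  of level \<open>j\<close>, pulled back by all normalised linear parts.\<close>

definition form :: "'n \<Rightarrow> real^'n \<Rightarrow> real^'n \<Rightarrow> real" where
  "form j u v = m (\<lambda>g. \<Sum>i | w i = w j. rescaled i u g * rescaled i v g)"

lemma N_rescaled:
  assumes g: "g \<in> carrier G"
  shows "N j (proj j (exp (w j * chi g) *\<^sub>R Lam (inv g) u)) = N j (proj j u)"
  using g by (simp add: proj_scaleR norm_on_level.N_scale N_Lam exp_minus)

lemma rescaled_le:
  assumes g: "g \<in> carrier G"
  shows "\<bar>rescaled i u g\<bar> \<le> K * N i (proj i u)"
  using coordinate_le_N[of i i "exp (w i * chi g) *\<^sub>R Lam (inv g) u"] by (simp add: N_rescaled[OF g] rescaled_def)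

lemma bounded_continuous_rescaled_mult: "bounded_continuous T (\<lambda>g. rescaled i u g * rescaled i v g)"
proof (rule bounded_continuousI)
  show "continuous_map T euclideanreal (\<lambda>g. rescaled i u g * rescaled i v g)"
    unfolding rescaled_def by (intro continuous_map_real_mult continuous_exp_chi continuous_Lam_inv)
  show "\<bar>rescaled i u g * rescaled i v g\<bar> \<le> (K * N i (proj i u)) * (K * N i (proj i v))" if "g \<in> topspace T" for g
    using that unfolding abs_mult topspace_T
    by (intro mult_mono rescaled_le) (auto intro!: mult_nonneg_nonneg norm_on_level.N_nonneg)
qed

lemma bounded_continuous_form: "bounded_continuous T (\<lambda>g. \<Sum>i | w i = w j. rescaled i u g * rescaled i v g)"
  by (intro bounded_continuous_sum bounded_continuous_rescaled_mult)

lemma form_commute: "form j u v = form j v u"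
  unfolding form_def by (simp add: mult.commute)

lemma rescaled_linear:
  assumes "g \<in> carrier G"
  shows "rescaled i (u + v) g = rescaled i u g + rescaled i v g" "rescaled i (t *\<^sub>R u) g = t * rescaled i u g"
  using assms linear_add[OF linear_Lam, of "inv g"] linear_cmul[OF linear_Lam, of "inv g"]
  by (simp_all add: rescaled_def distrib_left)

lemma linear_form: "linear (form j u)"
proof (rule linearI)
  show "form j u (x + y) = form j u x + form j u y" for x y
    unfolding form_def
    by (subst mean_add[OF mean_m bounded_continuous_form bounded_continuous_form, symmetric],
        rule mean_cong[OF mean_m bounded_continuous_form])
       (simp add: topspace_T rescaled_linear distrib_left sum.distrib)
  show "form j u (t *\<^sub>R x) = t *\<^sub>R form j u x" for t x
    unfolding form_def real_scaleR_def
    by (subst mean_cmult[OF mean_m bounded_continuous_form, symmetric],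
        rule mean_cong[OF mean_m bounded_continuous_form])
       (simp add: topspace_T rescaled_linear sum_distrib_left mult.left_commute)
qed

text \<open>The averaged maps preserve \<open>N\<close>, so the comparison of \<open>N\<close> with
  coordinates passes to the mean. \<open>K\<close> enters squared from that comparison, the
  dimension from Cauchy-Schwarz in one direction and from counting terms in the other.\<close>

lemma form_bounds:
  shows "(N j (proj j u))\<^sup>2 \<le> (K\<^sup>2 * real CARD('n)) * form j u u"
    and "form j u u \<le> (K\<^sup>2 * real CARD('n)) * (N j (proj j u))\<^sup>2"
proof -
  let ?I = "{i. w i = w j}"
  have Kn: "K\<^sup>2 * real CARD('n) > 0" by (intro mult_pos_pos zero_less_power K_pos(1)) simp
  have card: "real (card ?I) \<le> real CARD('n)" by (simp add: card_mono)
  have lower: "(N j (proj j u))\<^sup>2 / (K\<^sup>2 * real CARD('n)) \<le> (\<Sum>i\<in>?I. rescaled i u g * rescaled i u g)"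
    if "g \<in> topspace T" for g
  proof -
    have g: "g \<in> carrier G" using that by (simp add: topspace_T)
    let ?v = "exp (w j * chi g) *\<^sub>R Lam (inv g) u"
    have "N j (proj j u) \<le> K * q j 0 (proj j ?v)"
      using N_le_q[of j "proj j ?v"] by (simp only: N_rescaled[OF g])
    also have "q j 0 (proj j ?v) = (\<Sum>i\<in>?I. \<bar>rescaled i u g\<bar>)"
      using q_add_level[of "proj j ?v" j 0] by (simp add: proj_apply rescaled_def)
    finally have "(N j (proj j u))\<^sup>2 \<le> (K * (\<Sum>i\<in>?I. \<bar>rescaled i u g\<bar>))\<^sup>2"
      by (intro power_mono norm_on_level.N_nonneg) auto
    also have "\<dots> = K\<^sup>2 * (\<Sum>i\<in>?I. \<bar>rescaled i u g\<bar>)\<^sup>2"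
      by (simp add: power_mult_distrib)
    also have "\<dots> \<le> K\<^sup>2 * ((\<Sum>i\<in>?I. \<bar>rescaled i u g\<bar>\<^sup>2) * real (card ?I))"
      by (intro mult_left_mono sum_squared_le_sum_of_squares) auto
    also have "\<dots> \<le> K\<^sup>2 * ((\<Sum>i\<in>?I. \<bar>rescaled i u g\<bar>\<^sup>2) * real CARD('n))"
      using card by (intro mult_left_mono) (auto intro: sum_nonneg)
    finally show ?thesis
      by (simp add: field_simps power2_eq_square)
  qed
  have "(N j (proj j u))\<^sup>2 / (K\<^sup>2 * real CARD('n)) \<le> form j u u"
    unfolding form_def by (rule mean_ge[OF mean_m bounded_continuous_form lower])
  then show "(N j (proj j u))\<^sup>2 \<le> (K\<^sup>2 * real CARD('n)) * form j u u"
    using Kn by (simp only: pos_divide_le_eq mult.commute)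
  show "form j u u \<le> (K\<^sup>2 * real CARD('n)) * (N j (proj j u))\<^sup>2"
    unfolding form_def
  proof (rule mean_le[OF mean_m bounded_continuous_form])
    fix g assume "g \<in> topspace T"
    then have g: "g \<in> carrier G" by (simp add: topspace_T)
    have "rescaled i u g * rescaled i u g \<le> (K * N j (proj j u))\<^sup>2" if "i \<in> ?I" for i
    proof -
      have i: "w i = w j" using that by simp
      have "\<bar>rescaled i u g\<bar> \<le> K * N j (proj j u)"
        using coordinate_le_N[OF i, of "exp (w j * chi g) *\<^sub>R Lam (inv g) u"] i
        by (simp add: N_rescaled[OF g] rescaled_def)
      then have "\<bar>rescaled i u g\<bar>\<^sup>2 \<le> (K * N j (proj j u))\<^sup>2" by (intro power_mono) auto
      then show ?thesis by (simp add: power2_eq_square)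
    qed
    then have "(\<Sum>i\<in>?I. rescaled i u g * rescaled i u g) \<le> real (card ?I) * (K * N j (proj j u))\<^sup>2"
      using sum_bounded_above[of ?I "\<lambda>i. rescaled i u g * rescaled i u g"] by simp
    also have "\<dots> \<le> real CARD('n) * (K * N j (proj j u))\<^sup>2"
      using card by (intro mult_right_mono) auto
    finally show "(\<Sum>i\<in>?I. rescaled i u g * rescaled i u g) \<le> (K\<^sup>2 * real CARD('n)) * (N j (proj j u))\<^sup>2"
      by (simp add: power_mult_distrib mult_ac)
  qed
qed

text \<open>In the rescaled coordinates at \<open>h \<otimes> g\<close> the map \<open>Lam h\<close>
  cancels against its inverse and leaves only the factor \<open>exp (w i * chi h)\<close>;
  invariance of the mean removes the \<open>h\<close>.\<close>

lemma form_Lam: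
  assumes h: "h \<in> carrier G"
  shows "form j (Lam h u) (Lam h v) = (exp (w j * chi h))\<^sup>2 * form j u v"
proof -
  have rescaled_Lam: "rescaled i (Lam h u) (h \<otimes> g) = exp (w i * chi h) * rescaled i u g" if g: "g \<in> carrier G" for i u g
  proof -
    have "Lam (inv h) (Lam h u) = u"
      using h by (simp add: Lam_one group.l_inv[OF group_G] flip: Lam_mult)
    then have "Lam (inv (h \<otimes> g)) (Lam h u) = Lam (inv g) u"
      using g h by (simp add: group.inv_mult_group[OF group_G] Lam_mult)
    then show ?thesis using g h by (simp add: rescaled_def chi_mult distrib_left exp_add)
  qed
  have "form j (Lam h u) (Lam h v)
    = m (\<lambda>g. \<Sum>i | w i = w j. rescaled i (Lam h u) (h \<otimes> g) * rescaled i (Lam h v) (h \<otimes> g))"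
    unfolding form_def by (rule mean_invariant[OF h bounded_continuous_form, symmetric])
  also have "\<dots> = m (\<lambda>g. (exp (w j * chi h))\<^sup>2 * (\<Sum>i | w i = w j. rescaled i u g * rescaled i v g))"
    by (rule mean_cong[OF mean_m, symmetric], intro bounded_continuous_cmult bounded_continuous_form)
       (auto simp: topspace_T rescaled_Lam sum_distrib_left power2_eq_square mult_ac intro!: sum.cong)
  also have "\<dots> = (exp (w j * chi h))\<^sup>2 * form j u v"
    unfolding form_def by (rule mean_cmult[OF mean_m bounded_continuous_form])
  finally show ?thesis .
qed

lemma form_cong_weight: "w i = w j \<Longrightarrow> form i = form j"
  by (intro ext) (simp add: form_def)

text \<open>On each level the form is a sum of squares of as many linear forms as the level has
  coordinates; these become the new coordinates.\<close>

lemma exists_isometrizing_linear_map: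
  obtains S where "linear S" "\<And>j z. (norm (proj j (S z)))\<^sup>2 = form j (proj j z) (proj j z)"
proof -
  define P where "P B I s \<longleftrightarrow> (\<forall>i. linear (s i)) \<and>
      (\<forall>z. (\<forall>k. k \<notin> I \<longrightarrow> z $ k = 0) \<longrightarrow> B z z = (\<Sum>i\<in>I. (s i z :: real)\<^sup>2))"
    for B :: "real^'n \<Rightarrow> real^'n \<Rightarrow> real" and I :: "'n set" and s
  define I where "I j = {i. w i = w j}" for j
  have ex: "\<exists>s. P (form j) (I j) s" for j
    unfolding P_def
  proof (rule positive_form_sum_of_squares[where B = "form j"])
    fix v :: "real^'n" assume v: "\<forall>k. k \<notin> I j \<longrightarrow> v $ k = 0" "v \<noteq> 0"
    then have vj: "v \<in> level j" by (auto simp: level_def I_def)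
    then have "N j v > 0"
      using norm_on_level.N_eq_0[OF vj] norm_on_level.N_nonneg[OF vj] v(2) by (auto simp: less_le)
    then have "0 < (K\<^sup>2 * real CARD('n)) * form j v v"
      using form_bounds(1)[of j v] vj by (simp add: proj_level) (meson less_le_trans zero_less_power)
    moreover have "K\<^sup>2 * real CARD('n) > 0" by (intro mult_pos_pos zero_less_power K_pos(1)) simp
    ultimately show "form j v v > 0" by (meson less_imp_le mult_nonneg_nonpos not_le)
  qed (auto simp: form_commute linear_form)
  text \<open>Coordinates of equal weight have to use the same choice.\<close>
  define s where "s j = (SOME s. P (form j) (I j) s)" for j
  have s: "P (form j) (I j) (s j)" for j
    unfolding s_def by (rule someI_ex[OF ex])
  have s_cong: "s i = s j" if "w i = w j" for i j
    using that by (simp add: s_def I_def form_cong_weight[OF that])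
  define S where "S z = (\<chi> i. s i i (proj i z))" for z
  have "linear S"
  proof (rule linearI)
    have lin: "linear (s i i)" for i using s[of i] by (simp add: P_def)
    show "S (x + y) = S x + S y" for x y
      by (simp add: S_def vec_eq_iff proj_add linear_add[OF lin])
    show "S (t *\<^sub>R x) = t *\<^sub>R S x" for t x
      by (simp add: S_def vec_eq_iff proj_scaleR linear_cmul[OF lin])
  qed
  moreover have "(norm (proj j (S z)))\<^sup>2 = form j (proj j z) (proj j z)" for j z
  proof -
    have "(norm (proj j (S z)))\<^sup>2 = (\<Sum>i\<in>I j. (s i i (proj i z))\<^sup>2)"
      by (simp add: norm_proj_square I_def S_def)
    also have "\<dots> = (\<Sum>i\<in>I j. (s j i (proj j z))\<^sup>2)"
    proof (rule sum.cong)
      fix i assume "i \<in> I j"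
      then have "w i = w j" by (simp add: I_def)
      then show "(s i i (proj i z))\<^sup>2 = (s j i (proj j z))\<^sup>2"
        using s_cong proj_cong_weight by metis
    qed simp
    also have "\<dots> = form j (proj j z) (proj j z)"
      using s[of j] by (auto simp: P_def I_def proj_apply)
    finally show ?thesis .
  qed
  ultimately show ?thesis by (rule that)
qed

text \<open>The chart is \<open>S\<close> after \<open>avg\<close>: the latter makes the group act
  by affine maps with linear parts \<open>Lam h\<close>, the former makes these conformal for the
  Euclidean norm.\<close>

theorem exists_similarity_chart:
  obtains f f' where "\<And>x. f (f' x) = x" "\<And>x. f' (f x) = x" "q_Lipschitz f" "q_Lipschitz f'"
    "\<And>h j x y. h \<in> carrier G \<Longrightarrow>
      norm (proj j (f (act h x)) - proj j (f (act h y))) = exp (w j * chi h) * norm (proj j (f x) - proj j (f y))"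
proof -
  obtain S where S: "linear S" "\<And>j z. (norm (proj j (S z)))\<^sup>2 = form j (proj j z) (proj j z)"
    using exists_isometrizing_linear_map by blast
  \<comment> \<open>The square root of the constant in \<open>form_bounds\<close>.\<close>
  define c where "c = K * sqrt (real CARD('n))"
  have c2: "c\<^sup>2 = K\<^sup>2 * real CARD('n)" by (simp add: c_def power_mult_distrib)
  have c: "c > 0" by (simp add: c_def)
  have S_le: "norm (proj j (S z)) \<le> c * N j (proj j z)" for j z
  proof (rule power2_le_imp_le)
    show "(norm (proj j (S z)))\<^sup>2 \<le> (c * N j (proj j z))\<^sup>2"
      using form_bounds(2)[of j "proj j z"] by (simp add: S(2) power_mult_distrib c2 proj_proj)
    show "0 \<le> c * N j (proj j z)"
      using c by (intro mult_nonneg_nonneg norm_on_level.N_nonneg) auto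
  qed
  have S_ge: "N j (proj j z) \<le> c * norm (proj j (S z))" for j z
  proof (rule power2_le_imp_le)
    show "(N j (proj j z))\<^sup>2 \<le> (c * norm (proj j (S z)))\<^sup>2"
      using form_bounds(1)[of j "proj j z"] by (simp add: S(2) power_mult_distrib c2 proj_proj)
    show "0 \<le> c * norm (proj j (S z))" using c by simp
  qed
  have "inj S"
  proof (rule inj_onI)
    fix x y assume "S x = S y"
    then have *: "S (x - y) = 0" by (simp add: linear_diff[OF S(1)])
    have "N j (proj j (x - y)) \<le> 0" for j
      using S_ge[of j "x - y"] by (simp add: *)
    then have p0: "proj j (x - y) = 0" for j
      by (intro norm_on_level.N_eq_0 antisym norm_on_level.N_nonneg) auto
    have "x - y = 0" by (rule eq_if_proj_eq) (simp only: p0 proj_zero)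
    then show "x = y" by simp
  qed
  have "surj S" using linear_injective_imp_surjective[OF S(1) \<open>inj S\<close>] by simp
  define S' where "S' = inv_into UNIV S"
  have S': "S (S' x) = x" "S' (S x) = x" for x
    using \<open>surj S\<close> \<open>inj S\<close> by (auto simp: S'_def surj_f_inv_f)
  define avg' where "avg' = inv_into UNIV avg"
  have avg': "avg (avg' x) = x" "avg' (avg x) = x" for x
    using surj_avg inj_avg by (auto simp: avg'_def surj_f_inv_f)
  have "q_Lipschitz avg"
    by (rule q_Lipschitz_if_coordinatewise) (rule avg_le)
  obtain C where C: "\<And>i x y. \<bar>x $ i - y $ i\<bar> \<le> C i * q i (avg x) (avg y)"
    using avg_ge by metis
  have "q_Lipschitz avg'"
    by (rule q_Lipschitz_if_coordinatewise[where C = C]) (use C[of "avg' _" _ "avg' _"] in \<open>simp add: avg'\<close>)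
  have S_diff: "proj j (S x) - proj j (S y) = proj j (S (x - y))" for j x y
    by (simp add: linear_diff[OF S(1)] proj_diff)
  have "\<bar>S x $ i - S y $ i\<bar> \<le> (c * K) * q i x y" for i x y
  proof -
    have "\<bar>S x $ i - S y $ i\<bar> \<le> norm (proj i (S (x - y)))"
      using component_le_norm_cart[of "proj i (S (x - y))" i] by (simp add: proj_apply linear_diff[OF S(1)])
    also have "\<dots> \<le> c * N i (proj i (x - y))" by (rule S_le)
    also have "\<dots> \<le> c * (K * q i 0 (proj i (x - y)))"
      using c by (intro mult_left_mono N_le_q) auto
    also have "\<dots> \<le> c * (K * q i x y)"
      using c by (intro mult_left_mono q_proj_le) auto
    finally show ?thesis by simp
  qed
  then have "q_Lipschitz S" by (rule q_Lipschitz_if_coordinatewise)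
  have "\<bar>x $ i - y $ i\<bar> \<le> (K * c) * q i (S x) (S y)" for i x y
  proof -
    have "\<bar>x $ i - y $ i\<bar> \<le> K * N i (proj i (x - y))"
      using coordinate_le_N[of i i "x - y"] by simp
    also have "\<dots> \<le> K * (c * norm (proj i (S x) - proj i (S y)))"
      unfolding S_diff by (intro mult_left_mono S_ge) auto
    also have "\<dots> \<le> K * (c * q i (S x) (S y))"
      using c by (intro mult_left_mono norm_proj_diff_le_q) auto
    finally show ?thesis by simp
  qed
  from this[of "S' _" _ "S' _"] have "q_Lipschitz S'"
    by (intro q_Lipschitz_if_coordinatewise[where C = "\<lambda>_. K * c"]) (simp add: S')
  show ?thesis
  proof
    show "S (avg (avg' (S' x))) = x" "avg' (S' (S (avg x))) = x" for x
      by (simp_all add: S' avg')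
    show "q_Lipschitz (\<lambda>x. S (avg x))" "q_Lipschitz (\<lambda>x. avg' (S' x))"
      using q_Lipschitz_compose[OF \<open>q_Lipschitz S\<close> \<open>q_Lipschitz avg\<close>]
        q_Lipschitz_compose[OF \<open>q_Lipschitz avg'\<close> \<open>q_Lipschitz S'\<close>] .
    fix h j x y assume h: "h \<in> carrier G"
    have "(norm (proj j (S (avg (act h x))) - proj j (S (avg (act h y)))))\<^sup>2
      = form j (Lam h (proj j (avg x - avg y))) (Lam h (proj j (avg x - avg y)))"
      by (simp only: S_diff avg_act[OF h] S(2) Lam_proj[OF h])
    also have "\<dots> = (exp (w j * chi h))\<^sup>2 * form j (proj j (avg x - avg y)) (proj j (avg x - avg y))"
      by (rule form_Lam[OF h])
    also have "\<dots> = (exp (w j * chi h) * norm (proj j (S (avg x)) - proj j (S (avg y))))\<^sup>2"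
      by (simp only: S_diff S(2) power_mult_distrib)
    finally show "norm (proj j (S (avg (act h x))) - proj j (S (avg (act h y))))
      = exp (w j * chi h) * norm (proj j (S (avg x)) - proj j (S (avg y)))"
      by (rule power2_eq_imp_eq) auto
  qed
qed

end

text \<open>Conjugation by the straightening chart gives a straight action with constant
  \<open>K * L\<close> and the same character; its similarity chart is then composed with the
  straightening one.\<close>

theorem (in scaled_action) exists_similarity_chart:
  assumes cocompact: "compact Q" "Q \<subseteq> {(x, y). x \<noteq> y}"
    "{(x, y). x \<noteq> y} \<subseteq> (\<Union>g\<in>carrier G. map_prod (act g) (act g) ` Q)"
  obtains f f' where "\<And>x. f (f' x) = x" "\<And>x. f' (f x) = x" "q_Lipschitz f" "q_Lipschitz f'"
    "\<And>h j x y. h \<in> carrier G \<Longrightarrow>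
      norm (proj j (f (act h x)) - proj j (f (act h y))) = exp (w j * chi h) * norm (proj j (f x) - proj j (f y))"
proof (rule exists_straightening_chart[OF cocompact])
  fix F H L
  assume L: "L \<ge> 1" and FH: "\<And>x. F (H x) = x" "\<And>x. H (F x) = x"
    and FL: "\<And>j x y. q j (F x) (F y) \<le> L * q j x y" and HL: "\<And>j x y. q j (H x) (H y) \<le> L * q j x y"
    and straight: "\<And>j v x y t. v \<in> level j \<Longrightarrow> t \<ge> 0 \<Longrightarrow>
      rho j (F x) (F (x + t *\<^sub>R v)) = t * rho j (F y) (F (y + v))"
  define act' where "act' g x = H (act g (F x))" for g x
  have contH: "continuous_on UNIV H"
    by (rule continuous_on_q_Lipschitz[where C = "\<lambda>_. L"]) (rule HL)
  have KL: "1 \<le> K * L" using mult_mono[OF K1 L] by simp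
  have "amenable_action G T m act'"
  proof (rule amenable_action.intro)
    show "act' (g \<otimes> h) x = act' g (act' h x)" if "g \<in> carrier G" "h \<in> carrier G" for g h x
      using that by (simp add: act'_def FH act_mult)
    show "act' \<one> x = x" for x by (simp add: act'_def FH)
    show "continuous_map T euclidean (\<lambda>g. act' g x)" for x
      unfolding act'_def by (rule continuous_map_compose_on[OF continuous_act contH]) simp
  qed (rule group_G topspace_T continuous_inv mean_m mean_invariant; assumption)+
  then interpret st: straight_action w G T m act' "K * L" chi "\<lambda>j x y. rho j (F x) (F y)"
  proof (intro straight_action.intro graded_action.intro weighted_action.intro weighted_coordinates_axioms
      straight_action_axioms.intro graded_action_axioms.intro weighted_action_axioms.intro)
    show "1 \<le> K * L" by (rule KL)
    show "rho j (F x) (F y) = rho j (F y) (F x)" for j x y by (rule rho_commute)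
    show "rho j (F x) (F z) \<le> rho j (F x) (F y) + rho j (F y) (F z)" for j x y z by (rule rho_triangle)
    show "q j x y \<le> K * L * rho j (F x) (F y)" for j x y
    proof -
      have "q j x y \<le> L * q j (F x) (F y)"
        using HL[of j "F x" "F y"] by (simp add: FH)
      also have "\<dots> \<le> L * rho j (F x) (F y)"
        using L by (intro mult_left_mono q_le_rho) auto
      also have "\<dots> \<le> (K * L) * rho j (F x) (F y)"
        using L K1 order_trans[OF q_nonneg q_le_rho] by (intro mult_right_mono) auto
      finally show ?thesis .
    qed
    show "rho j (F x) (F y) \<le> K * L * q j x y" for j x y
    proof -
      have "rho j (F x) (F y) \<le> K * q j (F x) (F y)" by (rule rho_le_q)
      also have "\<dots> \<le> K * (L * q j x y)" by (intro mult_left_mono FL) auto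
      finally show ?thesis by simp
    qed
    show "rho j (F (act' g x)) (F (act' g y)) = exp (w j * chi g) * rho j (F x) (F y)"
      if "g \<in> carrier G" for g j x y
      using that by (simp add: act'_def FH rho_act)
    show "rho j (F x) (F (x + t *\<^sub>R v)) = t * rho j (F y) (F (y + v))"
      if "v \<in> level j" "t \<ge> 0" for j v x y t
      by (rule straight[OF that])
  qed (assumption, rule chi_mult)
  have lip: "q_Lipschitz F" "q_Lipschitz H"
    unfolding q_Lipschitz_def using FL HL L by (auto intro!: exI[of _ L])
  show thesis
  proof (rule st.exists_similarity_chart)
    fix f f' assume f: "\<And>x. f (f' x) = x" "\<And>x. f' (f x) = x" "q_Lipschitz f" "q_Lipschitz f'"
      "\<And>h j x y. h \<in> carrier G \<Longrightarrow>
        norm (proj j (f (act' h x)) - proj j (f (act' h y))) = exp (w j * chi h) * norm (proj j (f x) - proj j (f y))"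
    show thesis
    proof (rule that)
      show "f (H (F (f' x))) = x" "F (f' (f (H x))) = x" for x by (simp_all add: FH f)
      show "q_Lipschitz (\<lambda>x. f (H x))" "q_Lipschitz (\<lambda>x. F (f' x))"
        using q_Lipschitz_compose[OF f(3) lip(2)] q_Lipschitz_compose[OF lip(1) f(4)] .
      show "norm (proj j (f (H (act h x))) - proj j (f (H (act h y))))
        = exp (w j * chi h) * norm (proj j (f (H x)) - proj j (f (H y)))" if "h \<in> carrier G" for h j x y
        using f(5)[OF that, of j "H x" "H y"] by (simp add: act'_def FH)
    qed
  qed
qed

section \<open>Real structure of a complex eigenbasis\<close>

lemma matrix_inv_invertible:
  assumes "invertible (M :: 'a::semiring_1^'n^'n)"
  shows "M ** matrix_inv M = mat 1" "matrix_inv M ** M = mat 1"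
proof -
  have "M ** matrix_inv M = mat 1 \<and> matrix_inv M ** M = mat 1"
    using assms unfolding invertible_def matrix_inv_def by (rule someI_ex)
  then show "M ** matrix_inv M = mat 1" "matrix_inv M ** M = mat 1" by blast+
qed

definition cvec :: "real^'n \<Rightarrow> complex^'n" where
  "cvec x = (\<chi> i. complex_of_real (x $ i))"

lemma cvec_nth [simp]: "cvec x $ i = complex_of_real (x $ i)"
  by (simp add: cvec_def)

lemma cvec_eq_iff: "cvec x = cvec y \<longleftrightarrow> x = y"
  by (simp add: vec_eq_iff)

text \<open>Projection to a level named by its weight, over any coefficients, since both real and
  complex coordinates are split.\<close>

definition restr :: "('n \<Rightarrow> real) \<Rightarrow> real \<Rightarrow> 'a::zero^'n \<Rightarrow> 'a^'n" where
  "restr w a y = (\<chi> i. if w i = a then y $ i else 0)"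

lemma restr_nth: "restr w a y $ i = (if w i = a then y $ i else 0)"
  by (simp add: restr_def)

lemma sum_restr:
  fixes y :: "'a::comm_monoid_add^'n"
  shows "(\<Sum>a\<in>range w. restr w a y) = y"
  by (simp add: vec_eq_iff restr_nth sum.delta)

locale eigenbasis =
  fixes A :: "real^'n^'n" and J P :: "complex^'n^'n"
  assumes P: "invertible P" and J: "diagonal_matrix J" and AP: "complexify A ** P = P ** J"
begin

definition w :: "'n \<Rightarrow> real" where
  "w i = Re (J $ i $ i)"

definition coords :: "complex^'n \<Rightarrow> complex^'n" where
  "coords v = matrix_inv P *v v"

lemma P_coords [simp]: "P *v coords v = v"
  by (simp add: coords_def matrix_vector_mul_assoc matrix_inv_invertible[OF P])

lemma coords_P [simp]: "coords (P *v v) = v"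
  by (simp add: coords_def matrix_vector_mul_assoc matrix_inv_invertible[OF P])

lemma coords_linear: "coords (x + y) = coords x + coords y" "coords (c *s x) = c *s coords x"
  "coords 0 = 0" "coords (sum f S) = (\<Sum>a\<in>S. coords (f a))"
  unfolding coords_def
  by (simp_all add: vec.add vec.scale vec.zero vec.sum)

lemma coords_eq_iff: "coords x = coords y \<longleftrightarrow> x = y"
  by (metis P_coords)

lemma J_mult: "(J *v u) $ i = J $ i $ i * u $ i"
proof -
  have "(J *v u) $ i = (\<Sum>j\<in>UNIV. J $ i $ j * u $ j)"
    by (simp add: matrix_vector_mult_def)
  also have "\<dots> = (\<Sum>j\<in>UNIV. if j = i then J $ i $ i * u $ i else 0)"
    by (rule sum.cong) (use J in \<open>auto simp: diagonal_matrix_def\<close>)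
  finally show ?thesis by simp
qed

lemma eigenvector_iff:
  "complexify A *v v = c *s v \<longleftrightarrow> (\<forall>i. coords v $ i \<noteq> 0 \<longrightarrow> J $ i $ i = c)"
proof -
  have "complexify A *v v = P *v (J *v coords v)"
    using AP by (metis P_coords matrix_vector_mul_assoc)
  then have "coords (complexify A *v v) = J *v coords v" by simp
  then have "complexify A *v v = c *s v \<longleftrightarrow> J *v coords v = c *s coords v"
    by (metis coords_eq_iff coords_linear(2))
  also have "\<dots> \<longleftrightarrow> (\<forall>i. coords v $ i \<noteq> 0 \<longrightarrow> J $ i $ i = c)"
    by (auto simp: vec_eq_iff J_mult)
  finally show ?thesis .
qed

lemma coords_column: "coords (column i P) = axis i 1"
proof -
  have "P *v axis i 1 = column i P"
    by (simp add: matrix_vector_mult_def column_def axis_def vec_eq_iff if_distrib cong: if_cong)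
  then show ?thesis by (metis coords_P)
qed

lemma eigenvector_column: "complexify A *v (column i P) = (J $ i $ i) *s column i P"
proof -
  show ?thesis by (simp add: eigenvector_iff coords_column axis_def)
qed

lemma eigenvalues_eq: "eigenvalues A = range (\<lambda>i. J $ i $ i)"
proof
  show "range (\<lambda>i. J $ i $ i) \<subseteq> eigenvalues A"
  proof
    fix c assume "c \<in> range (\<lambda>i. J $ i $ i)"
    then obtain i where c: "c = J $ i $ i" by blast
    have "coords (column i P) $ i = 1" by (simp add: coords_column)
    then have "column i P \<noteq> 0" using coords_linear(3) by auto
    then show "c \<in> eigenvalues A" unfolding eigenvalues_def using eigenvector_column c by blast
  qed
  show "eigenvalues A \<subseteq> range (\<lambda>i. J $ i $ i)"
  proof
    fix c assume "c \<in> eigenvalues A"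
    then obtain v where v: "v \<noteq> 0" "complexify A *v v = c *s v" by (auto simp: eigenvalues_def)
    have "coords v \<noteq> 0" using v(1) coords_eq_iff[of v 0] by (simp add: coords_linear)
    then obtain i where "coords v $ i \<noteq> 0" by (auto simp: vec_eq_iff)
    then have "J $ i $ i = c" using v(2) eigenvector_iff[of v c] by blast
    then show "c \<in> range (\<lambda>i. J $ i $ i)" by auto
  qed
qed

lemma eigen_real_parts_eq: "eigen_real_parts A = range w"
  by (auto simp: eigen_real_parts_def eigenvalues_eq w_def image_image)

lemma span_eigenvectors:
  "v \<in> vec.span {v. \<exists>c. Re c = a \<and> complexify A *v v = c *s v} \<longleftrightarrow> (\<forall>i. w i \<noteq> a \<longrightarrow> coords v $ i = 0)"
    (is "v \<in> vec.span ?E \<longleftrightarrow> _")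
proof
  have "vec.span ?E \<subseteq> {v. \<forall>i. w i \<noteq> a \<longrightarrow> coords v $ i = 0}"
  proof (rule vec.span_minimal)
    show "?E \<subseteq> {v. \<forall>i. w i \<noteq> a \<longrightarrow> coords v $ i = 0}"
      unfolding eigenvector_iff w_def by blast
    show "vec.subspace {v. \<forall>i. w i \<noteq> a \<longrightarrow> coords v $ i = 0}"
      by (rule vec.subspaceI) (auto simp: coords_linear)
  qed
  then show "\<forall>i. w i \<noteq> a \<longrightarrow> coords v $ i = 0" if "v \<in> vec.span ?E" using that by blast
next
  assume v: "\<forall>i. w i \<noteq> a \<longrightarrow> coords v $ i = 0"
  have "v = (\<Sum>i\<in>UNIV. coords v $ i *s column i P)"
    by (metis P_coords matrix_mult_sum)
  also have "\<dots> \<in> vec.span ?E"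
  proof (rule vec.span_sum)
    fix i
    show "coords v $ i *s column i P \<in> vec.span ?E"
    proof (cases "w i = a")
      case True
      then have "column i P \<in> ?E" using eigenvector_column unfolding w_def by blast
      then show ?thesis by (intro vec.span_scale vec.span_base)
    next
      case False
      then show ?thesis using v by (simp add: vec.span_zero)
    qed
  qed
  finally show "v \<in> vec.span ?E" .
qed

lemma mem_real_part_subspace: "x \<in> real_part_subspace A a \<longleftrightarrow> (\<forall>i. w i \<noteq> a \<longrightarrow> coords (cvec x) $ i = 0)"
  unfolding real_part_subspace_def cvec_def[symmetric] by (simp add: span_eigenvectors)

lemma subspace_real_part_subspace: "subspace (real_part_subspace A a)"
proof -
  have "cvec (0 :: real^'n) = 0" "cvec (x + y) = cvec x + cvec y" "cvec (r *\<^sub>R x) = complex_of_real r *s cvec x"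
    for x y :: "real^'n" and r
    by (simp_all add: vec_eq_iff)
  then show ?thesis by (auto simp: subspace_def mem_real_part_subspace coords_linear)
qed

text \<open>The eigenspaces of \<open>A\<close> for conjugate eigenvalues are conjugate, so real and imaginary
  parts of eigenvectors belong to the complex span.\<close>

lemma Re_Im_column_mem:
  "(\<chi> k. Re (P $ k $ i)) \<in> real_part_subspace A (w i)"
  "(\<chi> k. Im (P $ k $ i)) \<in> real_part_subspace A (w i)"
proof -
  let ?E = "{v. \<exists>c. Re c = w i \<and> complexify A *v v = c *s v}"
  define p where "p = column i P"
  define p' where "p' = (\<chi> k. cnj (p $ k))"
  have Ap: "complexify A *v p = (J $ i $ i) *s p"
    unfolding p_def by (rule eigenvector_column)
  have "complexify A *v p' = cnj (J $ i $ i) *s p'"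
  proof -
    have "(complexify A *v p') $ k = cnj ((complexify A *v p) $ k)" for k
      by (simp add: matrix_vector_mult_def p'_def)
    then show ?thesis by (simp add: Ap vec_eq_iff p'_def)
  qed
  then have "p' \<in> ?E" by (intro CollectI exI[of _ "cnj (J $ i $ i)"]) (simp add: w_def)
  moreover have "p \<in> ?E" using Ap by (intro CollectI exI[of _ "J $ i $ i"]) (simp add: w_def)
  ultimately have p: "p \<in> vec.span ?E" "p' \<in> vec.span ?E"
    by (auto intro: vec.span_base)
  have "cvec (\<chi> k. Re (P $ k $ i)) = (1/2) *s (p + p')"
    by (auto simp: vec_eq_iff p_def p'_def column_def complex_eq_iff)
  then have "cvec (\<chi> k. Re (P $ k $ i)) \<in> vec.span ?E"
    using p by (auto intro!: vec.span_scale vec.span_add)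
  then show "(\<chi> k. Re (P $ k $ i)) \<in> real_part_subspace A (w i)"
    by (simp add: real_part_subspace_def cvec_def)
  have "cvec (\<chi> k. Im (P $ k $ i)) = (- \<i> / 2) *s (p - p')"
    by (auto simp: vec_eq_iff p_def p'_def column_def complex_eq_iff)
  then have "cvec (\<chi> k. Im (P $ k $ i)) \<in> vec.span ?E"
    using p by (auto intro!: vec.span_scale vec.span_diff simp del: vec.scale_minus_left)
  then show "(\<chi> k. Im (P $ k $ i)) \<in> real_part_subspace A (w i)"
    by (simp add: real_part_subspace_def cvec_def)
qed

text \<open>\<open>det (Re P + z Im P)\<close> is a polynomial in \<open>z\<close> that does not vanish at \<open>\<i>\<close>, hence neither at
  some real \<open>t\<close>.\<close>

lemma exists_adapted_real_basis:
  obtains Q :: "real^'n^'n" where "invertible Q" "\<And>i. column i Q \<in> real_part_subspace A (w i)"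
proof -
  define M where "M z = (\<chi> k l. complex_of_real (Re (P $ k $ l)) + z * complex_of_real (Im (P $ k $ l)))" for z
  \<comment> \<open>The Leibniz expansion of the determinant, with linear polynomials as matrix
    entries.\<close>
  define p where "p = (\<Sum>\<pi> | \<pi> permutes (UNIV :: 'n set). [:of_int (sign \<pi>):] *
      (\<Prod>k\<in>UNIV. [:complex_of_real (Re (P $ k $ \<pi> k)), complex_of_real (Im (P $ k $ \<pi> k)):]))"
  have p: "poly p z = det (M z)" for z
    by (simp add: p_def det_def M_def poly_sum poly_prod)
  have "M \<i> = P" by (simp add: M_def vec_eq_iff flip: complex_eq)
  then have "poly p \<i> \<noteq> 0"
    using P by (simp add: p invertible_det_nz)
  then have "p \<noteq> 0" by auto
  then have "finite {z. poly p z = 0}" by (rule poly_roots_finite)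
  moreover have "infinite (range complex_of_real)"
    by (metis finite_imageD infinite_UNIV_char_0 inj_of_real)
  ultimately have "\<not> range complex_of_real \<subseteq> {z. poly p z = 0}"
    using finite_subset[of "range complex_of_real" "{z. poly p z = 0}"] by meson
  then obtain t where t: "poly p (complex_of_real t) \<noteq> 0" by auto
  define Q where "Q = (\<chi> k l. Re (P $ k $ l) + t * Im (P $ k $ l))"
  have "det (M (complex_of_real t)) = complex_of_real (det Q)"
    by (simp add: M_def Q_def det_def)
  then have "det Q \<noteq> 0" using t by (auto simp: p)
  then have "invertible Q" by (simp add: invertible_det_nz)
  moreover have "column i Q \<in> real_part_subspace A (w i)" for i
  proof -
    have "column i Q = (\<chi> k. Re (P $ k $ i)) + t *\<^sub>R (\<chi> k. Im (P $ k $ i))"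
      by (simp add: vec_eq_iff column_def Q_def)
    then show ?thesis
      using Re_Im_column_mem by (simp add: subspace_add subspace_scale subspace_real_part_subspace)
  qed
  ultimately show ?thesis by (rule that)
qed

text \<open>An adapted real basis exhibits a decomposition, and the definite description then asks
  for uniqueness, which comes from the complex eigenbasis.\<close>

lemma components_eq:
  assumes Q: "invertible Q" "\<And>i. column i Q \<in> real_part_subspace A (w i)"
  shows "components A x a = (if a \<in> range w then Q *v restr w a (matrix_inv Q *v x) else 0)"
proof -
  define y where "y = matrix_inv Q *v x"
  define u where "u = (\<lambda>a. if a \<in> range w then Q *v restr w a y else 0)"
  have Qy: "Q *v y = x"
    by (simp add: y_def matrix_vector_mul_assoc matrix_inv_invertible[OF Q(1)])
  have "components A x = u"
    unfolding components_def eigen_real_parts_eq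
  proof (rule the_equality, intro conjI ballI allI impI)
    show "u a \<in> real_part_subspace A a" if "a \<in> range w" for a
    proof -
      have "Q *v restr w a y = (\<Sum>i\<in>UNIV. restr w a y $ i *\<^sub>R column i Q)"
        by (simp add: matrix_mult_sum scalar_mult_eq_scaleR)
      also have "\<dots> \<in> real_part_subspace A a"
      proof (intro subspace_sum subspace_real_part_subspace)
        show "restr w a y $ i *\<^sub>R column i Q \<in> real_part_subspace A a" for i
          using Q(2)[of i]
          by (cases "w i = a") (simp_all add: restr_nth subspace_0 subspace_scale subspace_real_part_subspace)
      qed
      finally show ?thesis using that by (simp add: u_def)
    qed
    show "u a = 0" if "a \<notin> range w" for a using that by (simp add: u_def)
    have "(\<Sum>a\<in>range w. u a) = (\<Sum>a\<in>range w. Q *v restr w a y)"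
      by (simp add: u_def)
    also have "\<dots> = Q *v (\<Sum>a\<in>range w. restr w a y)"
      by (simp only: vec.sum)
    finally show "x = (\<Sum>a\<in>range w. u a)" by (simp add: sum_restr Qy)
    note u = \<open>\<And>a. a \<in> range w \<Longrightarrow> u a \<in> real_part_subspace A a\<close> \<open>\<And>a. a \<notin> range w \<Longrightarrow> u a = 0\<close>
      \<open>x = (\<Sum>a\<in>range w. u a)\<close>
    \<comment> \<open>In complex eigencoordinates the subspaces are coordinate subspaces with
      disjoint supports, so each summand is forced.\<close>
    have determined: "coords (cvec (v a)) = restr w a (coords (cvec x))"
      if v: "\<And>a. a \<in> range w \<Longrightarrow> v a \<in> real_part_subspace A a" "x = (\<Sum>a\<in>range w. v a)"
        and a: "a \<in> range w" for v a
    proof -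
      have z: "coords (cvec (v b)) $ i = 0" if "b \<in> range w" "w i \<noteq> b" for b i
        using v(1)[OF that(1)] that(2) by (simp add: mem_real_part_subspace)
      have "coords (cvec x) $ i = coords (cvec (v (w i))) $ i" for i
      proof -
        have "cvec x = (\<Sum>b\<in>range w. cvec (v b))"
          using v(2) by (simp add: vec_eq_iff)
        then have "coords (cvec x) $ i = (\<Sum>b\<in>range w. coords (cvec (v b)) $ i)"
          by (simp add: coords_linear)
        also have "\<dots> = (\<Sum>b\<in>range w. if b = w i then coords (cvec (v (w i))) $ i else 0)"
          by (rule sum.cong) (auto simp: z)
        finally show ?thesis by simp
      qed
      then show ?thesis using z[OF a] by (auto simp: vec_eq_iff restr_nth)
    qed
    fix v assume v: "(\<forall>a\<in>range w. v a \<in> real_part_subspace A a) \<and> (\<forall>a. a \<notin> range w \<longrightarrow> v a = 0) \<and>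
      x = (\<Sum>a\<in>range w. v a)"
    show "v = u"
    proof
      fix a
      show "v a = u a"
      proof (cases "a \<in> range w")
        case True
        have "coords (cvec (v a)) = coords (cvec (u a))"
          using determined[of v a] determined[of u a] v u True by simp
        then show ?thesis by (simp only: coords_eq_iff cvec_eq_iff)
      next
        case False
        then show ?thesis using v u by simp
      qed
    qed
  qed
  then show ?thesis by (simp add: u_def y_def)
qed

lemma dist_mat_eq:
  assumes Q: "invertible Q" "\<And>i. column i Q \<in> real_part_subspace A (w i)"
  shows "dist_mat A x y =
    Max ((\<lambda>a. norm (Q *v restr w a (matrix_inv Q *v x - matrix_inv Q *v y)) powr (Min (range w) / a)) ` range w)"
proof -
  have "components A x a - components A y a = Q *v restr w a (matrix_inv Q *v x - matrix_inv Q *v y)"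
    if "a \<in> range w" for a
  proof -
    have "restr w a (matrix_inv Q *v x - matrix_inv Q *v y)
        = restr w a (matrix_inv Q *v x) - restr w a (matrix_inv Q *v y)"
      by (simp add: vec_eq_iff restr_nth)
    then show ?thesis using that by (simp add: components_eq[OF Q] vec.diff)
  qed
  then show ?thesis
    by (simp add: dist_mat_def eigen_real_parts_eq cong: image_cong)
qed

end

text \<open>A diagonal matrix has the standard basis both as complex eigenbasis and as adapted real
  basis.\<close>

lemma dist_mat_real_diagonal:
  fixes D :: "real^'n^'n"
  assumes D: "diagonal_matrix D"
  defines "d \<equiv> \<lambda>i. D $ i $ i"
  shows "dist_mat D x y = Max ((\<lambda>a. norm (restr d a (x - y)) powr (Min (range d) / a)) ` range d)"
proof -
  interpret eigenbasis D "complexify D" "mat 1"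
  proof
    show "invertible (mat 1 :: complex^'n^'n)" by (auto simp: invertible_def intro: exI[of _ "mat 1"])
  qed (use D in \<open>simp_all add: diagonal_matrix_def\<close>)
  have w_eq: "w = d"
    by (simp add: fun_eq_iff w_def d_def)
  have mat1: "invertible (mat 1 :: real^'n^'n)" by (auto simp: invertible_def intro: exI[of _ "mat 1"])
  have inv1: "matrix_inv (mat 1 :: real^'n^'n) = mat 1"
    using matrix_inv_invertible(1)[OF mat1] by simp
  have "column i (mat 1) \<in> real_part_subspace D (d i)" for i
    using Re_Im_column_mem(1)[of i] by (simp add: w_eq column_def mat_def if_distrib[of Re] cong: if_cong)
  then show ?thesis
    using dist_mat_eq[OF mat1, of x y] by (simp add: w_eq inv1)
qed

section \<open>The conjugacy\<close>

lemma bij_subgroup_facts: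
  fixes \<Gamma> :: "('a \<Rightarrow> 'a) set"
  assumes "subgroup \<Gamma> (BijGroup UNIV)"
  shows "group (bij_subgroup \<Gamma>)"
    and "\<And>g h. g \<in> \<Gamma> \<Longrightarrow> h \<in> \<Gamma> \<Longrightarrow> g \<otimes>\<^bsub>bij_subgroup \<Gamma>\<^esub> h = g \<circ> h"
    and "\<one>\<^bsub>bij_subgroup \<Gamma>\<^esub> = id"
    and "\<And>g. g \<in> \<Gamma> \<Longrightarrow> bij g"
proof -
  show "group (bij_subgroup \<Gamma>)"
    by (rule subgroup.subgroup_is_group[OF assms group_BijGroup])
  have sub: "\<Gamma> \<subseteq> Bij UNIV"
    using subgroup.subset[OF assms] by (simp add: BijGroup_def)
  then show "g \<otimes>\<^bsub>bij_subgroup \<Gamma>\<^esub> h = g \<circ> h" if "g \<in> \<Gamma>" "h \<in> \<Gamma>" for g h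
    using that by (auto simp: BijGroup_def compose_def fun_eq_iff)
  show "\<one>\<^bsub>bij_subgroup \<Gamma>\<^esub> = id"
    by (simp add: BijGroup_def fun_eq_iff)
  show "bij g" if "g \<in> \<Gamma>" for g
    using sub that by (auto simp: Bij_def)
qed

lemma subgroup_conjugate_BijGroup:
  assumes \<Gamma>: "subgroup \<Gamma> (BijGroup UNIV)" and f: "bij f"
  shows "subgroup ((\<lambda>\<gamma>. f \<circ> \<gamma> \<circ> inv_into UNIV f) ` \<Gamma>) (BijGroup UNIV)"
proof -
  let ?\<phi> = "\<lambda>\<gamma>. f \<circ> \<gamma> \<circ> inv_into UNIV f"
  have bij: "bij (?\<phi> \<gamma>)" if "bij \<gamma>" for \<gamma>
    using f that bij_imp_bij_inv by (intro bij_comp) auto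
  have "?\<phi> \<in> hom (BijGroup UNIV) (BijGroup UNIV)"
  proof (rule homI)
    show "?\<phi> \<gamma> \<in> carrier (BijGroup UNIV)" if "\<gamma> \<in> carrier (BijGroup UNIV)" for \<gamma>
      using that bij by (auto simp: BijGroup_def Bij_def)
    show "?\<phi> (\<gamma> \<otimes>\<^bsub>BijGroup UNIV\<^esub> \<delta>) = ?\<phi> \<gamma> \<otimes>\<^bsub>BijGroup UNIV\<^esub> ?\<phi> \<delta>"
      if "\<gamma> \<in> carrier (BijGroup UNIV)" "\<delta> \<in> carrier (BijGroup UNIV)" for \<gamma> \<delta>
      using that bij f by (auto simp: BijGroup_def Bij_def compose_def fun_eq_iff bij_is_inj)
  qed
  then have "group_hom (BijGroup UNIV) (BijGroup UNIV) ?\<phi>"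
    by (simp add: group_hom_def group_hom_axioms_def group_BijGroup)
  then show ?thesis
    using \<Gamma> by (rule group_hom.subgroup_img_is_subgroup)
qed

section \<open>Comparison of the metrics with \<open>q\<close>\<close>

context weighted_coordinates
begin

lemma proj_eq_restr: "proj j = restr w (w j)"
  by (simp add: fun_eq_iff proj_def restr_def)

text \<open>The common shape of both metrics: \<open>Q\<close> is an adapted basis for
  \<open>A\<close> and the identity matrix for \<open>Abar\<close>.\<close>

definition max_dist :: "real^'n^'n \<Rightarrow> real^'n \<Rightarrow> real" where
  "max_dist Q z = Max ((\<lambda>a. norm (Q *v restr w a z) powr (Min (range w) / a)) ` range w)"

lemma max_dist_comparable_q:
  fixes Q :: "real^'n^'n"
  assumes Q: "invertible Q" and j0: "w j0 = Min (range w)"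
  obtains c where "c \<ge> 1"
    "\<And>x y. max_dist Q (x - y) \<le> c * q j0 x y"
    "\<And>x y. q j0 x y \<le> c * max_dist Q (x - y)"
proof -
  have min: "w j0 \<le> w k" for k by (simp add: j0)
  obtain b where b: "b > 0" "\<And>z. norm (Q *v z) \<le> norm z * b"
    using bounded_linear.pos_bounded[OF matrix_vector_mul_bounded_linear[of Q]] by blast
  obtain b' where b': "b' > 0" "\<And>z. norm (matrix_inv Q *v z) \<le> norm z * b'"
    using bounded_linear.pos_bounded[OF matrix_vector_mul_bounded_linear[of "matrix_inv Q"]] by blast
  \<comment> \<open>Dominates both operator bounds; the summand 1 keeps powers of \<open>c\<close>
    with exponent at most 1 below \<open>c\<close>.\<close>
  define c where "c = 1 + b + b'"
  have c: "c \<ge> 1" using b b' by (simp add: c_def)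
  have cb: "norm (Q *v z) \<le> c * norm z" for z
    using b(2)[of z] mult_left_mono[of b c "norm z"] b' by (simp add: c_def mult.commute)
  have cb': "norm z \<le> c * norm (Q *v z)" for z
  proof -
    have "norm z = norm (matrix_inv Q *v (Q *v z))"
      by (simp add: matrix_vector_mul_assoc matrix_inv_invertible[OF Q])
    also have "\<dots> \<le> c * norm (Q *v z)"
      using b'(2)[of "Q *v z"] mult_left_mono[of b' c "norm (Q *v z)"] b by (simp add: c_def mult.commute)
    finally show ?thesis .
  qed
  have c_powr: "c powr (w j0 / w k) \<le> c" for k
  proof -
    have "c powr (w j0 / w k) \<le> c powr 1"
      using c min by (intro powr_mono) auto
    then show ?thesis using c by simp
  qed
  have "max_dist Q (x - y) \<le> c * q j0 x y" for x y
    unfolding max_dist_def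
  proof (intro Max.boundedI)
    fix t assume "t \<in> (\<lambda>a. norm (Q *v restr w a (x - y)) powr (Min (range w) / a)) ` range w"
    then obtain j where t: "t = norm (Q *v proj j (x - y)) powr (w j0 / w j)"
      by (auto simp: proj_eq_restr j0)
    have "norm (Q *v proj j (x - y)) \<le> c * norm (proj j (x - y))"
      by (rule cb)
    also have "\<dots> \<le> c * (\<Sum>k | w k = w j. \<bar>(x - y) $ k\<bar>)"
      using c by (intro mult_left_mono norm_proj_le) auto
    finally have "norm (Q *v proj j (x - y)) \<le> c * (\<Sum>k | w k = w j. \<bar>x $ k - y $ k\<bar>)"
      by simp
    then have "t \<le> (c * (\<Sum>k | w k = w j. \<bar>x $ k - y $ k\<bar>)) powr (w j0 / w j)"
      unfolding t by (intro powr_mono2) auto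
    also have "\<dots> = c powr (w j0 / w j) * (\<Sum>k | w k = w j. \<bar>x $ k - y $ k\<bar>) powr (w j0 / w j)"
      using c by (simp add: powr_mult sum_nonneg)
    also have "\<dots> \<le> c * (\<Sum>k | w k = w j. \<bar>x $ k - y $ k\<bar> powr (w j0 / w j))"
      using c min by (intro mult_mono c_powr powr_sum_subadditive) auto
    also have "(\<Sum>k | w k = w j. \<bar>x $ k - y $ k\<bar> powr (w j0 / w j))
      = (\<Sum>k | w k = w j. \<bar>x $ k - y $ k\<bar> powr (w j0 / w k))"
      by (rule sum.cong) auto
    also have "\<dots> \<le> q j0 x y"
      unfolding q_def using min by (intro sum_mono2) auto
    finally show "t \<le> c * q j0 x y" using c by simp
  qed auto
  moreover have "q j0 x y \<le> (real CARD('n) * c) * max_dist Q (x - y)" for x y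
  proof -
    have "\<bar>x $ k - y $ k\<bar> powr (w j0 / w k) \<le> c * max_dist Q (x - y)" for k
    proof -
      have "\<bar>x $ k - y $ k\<bar> \<le> norm (proj k (x - y))"
        using component_le_norm_cart[of "proj k (x - y)" k] by (simp add: proj_apply)
      also have "\<dots> \<le> c * norm (Q *v proj k (x - y))" by (rule cb')
      finally have "\<bar>x $ k - y $ k\<bar> powr (w j0 / w k) \<le> (c * norm (Q *v proj k (x - y))) powr (w j0 / w k)"
        by (intro powr_mono2) auto
      also have "\<dots> = c powr (w j0 / w k) * norm (Q *v proj k (x - y)) powr (w j0 / w k)"
        using c by (simp add: powr_mult)
      also have "\<dots> \<le> c * max_dist Q (x - y)"
      proof (rule mult_mono)
        show "norm (Q *v proj k (x - y)) powr (w j0 / w k) \<le> max_dist Q (x - y)"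
          unfolding max_dist_def by (intro Max_ge) (auto simp: proj_eq_restr j0)
      qed (use c c_powr in auto)
      finally show ?thesis .
    qed
    then have "q j0 x y \<le> (\<Sum>k | w j0 \<le> w k. c * max_dist Q (x - y))"
      unfolding q_def by (intro sum_mono)
    then show ?thesis using min by simp
  qed
  moreover have "c * q j0 x y \<le> (real CARD('n) * c) * q j0 x y" for x y
    using c by (intro mult_right_mono) (auto simp: Suc_leI)
  moreover have "real CARD('n) * c \<ge> 1"
    using c mult_mono[of 1 "real CARD('n)" 1 c] by (simp add: Suc_leI)
  ultimately show ?thesis
    using that[of "real CARD('n) * c"] by (meson order_trans)
qed

text \<open>\<open>\<Phi>\<close> passes to adapted coordinates, where \<open>d\<close> is the
  lightest \<open>q\<close> up to \<open>c\<close>. The result is stated level by level, from which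
  any metric built from the norms of the levels can be treated.\<close>

theorem conjugate_to_similarities:
  fixes \<Gamma> :: "(real^'n \<Rightarrow> real^'n) set" and d :: "real^'n \<Rightarrow> real^'n \<Rightarrow> real"
  assumes j0: "\<And>k. w j0 \<le> w k"
    and \<Phi>\<Psi>: "\<And>x. \<Phi> (\<Psi> x) = x" "\<And>x. \<Psi> (\<Phi> x) = x" "continuous_on UNIV \<Phi>" "continuous_on UNIV \<Psi>"
    and c: "c \<ge> 1" "\<And>x y. d x y \<le> c * q j0 (\<Phi> x) (\<Phi> y)" "\<And>x y. q j0 (\<Phi> x) (\<Phi> y) \<le> c * d x y"
    and unif: "uniform_quasisimilarity_group d \<Gamma>"
    and top: "topological_group (bij_subgroup \<Gamma>) T"
    and cont: "continuous_action T"
    and amen: "amenable_group (bij_subgroup \<Gamma>) T"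
    and coco: "cocompact_on_distinct_pairs \<Gamma>"
  obtains F F' L s where "L \<ge> 1" "\<And>x. F (F' x) = x" "\<And>x. F' (F x) = x"
    "\<And>x y. q j0 (F x) (F y) \<le> L * d x y" "\<And>x y. d x y \<le> L * q j0 (F x) (F y)"
    "\<And>\<gamma> j x y. \<gamma> \<in> \<Gamma> \<Longrightarrow>
      norm (proj j (F (\<gamma> x) - F (\<gamma> y))) = exp (w j * s \<gamma>) * norm (proj j (F x - F y))"
proof -
  let ?G = "bij_subgroup \<Gamma>"
  have sub: "subgroup \<Gamma> (BijGroup UNIV)"
    using unif by (simp add: uniform_quasisimilarity_group_def)
  note G = bij_subgroup_facts[OF sub]
  obtain M where M: "M \<ge> 1" "\<And>\<gamma>. \<gamma> \<in> \<Gamma> \<Longrightarrow> \<exists>C. quasisimilarity d M C \<gamma>"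
    using unif by (auto simp: uniform_quasisimilarity_group_def)
  obtain m where m: "is_mean T m"
    "\<And>h \<phi>. h \<in> \<Gamma> \<Longrightarrow> bounded_continuous T \<phi> \<Longrightarrow> m (\<lambda>g. \<phi> (h \<otimes>\<^bsub>?G\<^esub> g)) = m \<phi>"
    using amen by (auto simp: amenable_group_def)
  define act where "act \<gamma> x = \<Phi> (\<gamma> (\<Psi> x))" for \<gamma> :: "real^'n \<Rightarrow> real^'n" and x
  \<comment> \<open>Two factors \<open>c\<close> come from passing between \<open>d\<close> and
    \<open>q j0\<close>, \<open>M\<close> from the quasisimilarities; the power and the dimension
    come from passing from \<open>q j0\<close> to every other \<open>q j\<close>.\<close>
  define E where "E = real CARD('n) * (c * c * M) powr (Max (range w) / w j0)"
  have ccM: "c * c * M \<ge> 1"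
    using mult_mono[of 1 "c * c" 1 M] mult_mono[of 1 c 1 c] c M by simp
  have E_le: "real CARD('n) * (c * c * M) powr (w j / w j0) \<le> E" for j
    unfolding E_def using ccM by (intro mult_left_mono powr_mono divide_right_mono) auto
  have "(c * c * M) powr (Max (range w) / w j0) \<ge> (c * c * M) powr 0"
    using ccM by (intro powr_mono divide_nonneg_nonneg order_trans[OF w_nonneg(1)[of j0]]) auto
  then have "1 * 1 \<le> E"
    unfolding E_def using ccM c(1) M(1) by (intro mult_mono) (auto simp: Suc_leI)
  then have E1: "E \<ge> 1" by simp
  have "amenable_action ?G T m act"
  proof (rule amenable_action.intro)
    show "group ?G" by (rule G)
    show "topspace T = carrier ?G" "continuous_map T T (\<lambda>g. inv\<^bsub>?G\<^esub> g)"
      using top by (auto simp: topological_group_def)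
    show "is_mean T m" by (rule m)
    show "m (\<lambda>g. \<phi> (h \<otimes>\<^bsub>?G\<^esub> g)) = m \<phi>" if "h \<in> carrier ?G" "bounded_continuous T \<phi>" for h \<phi>
      using that by (intro m) auto
    show "act (g \<otimes>\<^bsub>?G\<^esub> h) x = act g (act h x)" if "g \<in> carrier ?G" "h \<in> carrier ?G" for g h x
      using that G(2) by (simp add: act_def \<Phi>\<Psi>)
    show "act \<one>\<^bsub>?G\<^esub> x = x" for x
      unfolding G(3) by (simp add: act_def \<Phi>\<Psi>)
    show "continuous_map T euclidean (\<lambda>g. act g x)" for x
    proof -
      have "continuous_map T (prod_topology T euclidean) (\<lambda>g. (g, \<Psi> x))"
        by (intro continuous_map_pairedI) auto
      from continuous_map_compose[OF this cont[unfolded continuous_action_def]]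
      have "continuous_map T euclidean (\<lambda>g. g (\<Psi> x))" by (simp add: o_def)
      then show ?thesis
        unfolding act_def by (rule continuous_map_compose_on[OF _ \<Phi>\<Psi>(3)]) simp
    qed
  qed
  then interpret wa: weighted_action w ?G T m act E
    by (intro weighted_action.intro weighted_coordinates_axioms weighted_action_axioms.intro E1)
  have quasi: "\<exists>l. \<forall>j x y. exp (w j * l) / E * q j x y \<le> q j (act g x) (act g y) \<and>
      q j (act g x) (act g y) \<le> E * exp (w j * l) * q j x y" if g: "g \<in> carrier ?G" for g
  proof -
    obtain C where C: "C > 0" "\<And>x y. C / M * d x y \<le> d (g x) (g y)" "\<And>x y. d (g x) (g y) \<le> M * C * d x y"
      using M(2)[of g] g by (auto simp: quasisimilarity_def)
    have M0: "M > 0" and c0: "c > 0" using M c by auto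
    have up: "q j0 (act g x) (act g y) \<le> (c * c * M * C) * q j0 x y" for x y
    proof -
      have "q j0 (act g x) (act g y) \<le> c * d (g (\<Psi> x)) (g (\<Psi> y))"
        unfolding act_def by (rule c)
      also have "\<dots> \<le> c * (M * C * d (\<Psi> x) (\<Psi> y))"
        using c0 by (intro mult_left_mono C) auto
      also have "\<dots> \<le> c * (M * C * (c * q j0 (\<Phi> (\<Psi> x)) (\<Phi> (\<Psi> y))))"
        using c0 M0 C(1) by (intro mult_left_mono c) auto
      finally show ?thesis by (simp add: \<Phi>\<Psi> mult_ac)
    qed
    have down: "q j0 x y \<le> (c * c * M / C) * q j0 (act g x) (act g y)" for x y
    proof -
      have "q j0 x y \<le> c * d (\<Psi> x) (\<Psi> y)"
        using c(3)[of "\<Psi> x" "\<Psi> y"] by (simp add: \<Phi>\<Psi>)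
      also have "\<dots> \<le> c * (M / C * d (g (\<Psi> x)) (g (\<Psi> y)))"
        using C(2)[of "\<Psi> x" "\<Psi> y"] C(1) M0 c0 by (intro mult_left_mono) (auto simp: field_simps)
      also have "\<dots> \<le> c * (M / C * (c * q j0 (act g x) (act g y)))"
        unfolding act_def using c0 M0 C(1) by (intro mult_left_mono c) auto
      finally show ?thesis by (simp add: mult_ac)
    qed
    \<comment> \<open>\<open>C\<close> scales \<open>d\<close> and hence \<open>q j0\<close>, which
      is homogeneous of degree \<open>w j0\<close>.\<close>
    define l where "l = ln C / w j0"
    have C_powr: "C powr (w j / w j0) = exp (w j * l)" "(1 / C) powr (w j / w j0) = exp (- (w j * l))" for j
      using C(1) by (simp_all add: powr_def l_def ln_div)
    show ?thesis
    proof (intro exI[of _ l] allI conjI)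
      fix j x y
      have "q j (act g x) (act g y) \<le> real CARD('n) * (c * c * M * C) powr (w j / w j0) * q j x y"
        using C(1) ccM by (intro q_Lipschitz_of_minimal[OF j0 _ up]) auto
      also have "\<dots> = real CARD('n) * (c * c * M) powr (w j / w j0) * exp (w j * l) * q j x y"
        using C(1) ccM by (simp add: powr_mult C_powr)
      also have "\<dots> \<le> E * exp (w j * l) * q j x y"
        by (intro mult_right_mono E_le) auto
      finally show "q j (act g x) (act g y) \<le> E * exp (w j * l) * q j x y" .
      \<comment> \<open>The lower bound is the upper bound for the inverse, whose scale is
        \<open>1 / C\<close>.\<close>
      have "q j (act (inv\<^bsub>?G\<^esub> g) (act g x)) (act (inv\<^bsub>?G\<^esub> g) (act g y))
        \<le> real CARD('n) * (c * c * M * (1 / C)) powr (w j / w j0) * q j (act g x) (act g y)"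
      proof (rule q_Lipschitz_of_minimal[OF j0])
        show "0 < c * c * M * (1 / C)" using C(1) c0 M0 by simp
        show "q j0 (act (inv\<^bsub>?G\<^esub> g) x) (act (inv\<^bsub>?G\<^esub> g) y) \<le> c * c * M * (1 / C) * q j0 x y" for x y
          using down[of "act (inv\<^bsub>?G\<^esub> g) x" "act (inv\<^bsub>?G\<^esub> g) y"] wa.act_inv(1)[OF g] by simp
      qed
      then have "q j x y \<le> real CARD('n) * (c * c * M * (1 / C)) powr (w j / w j0) * q j (act g x) (act g y)"
        using wa.act_inv(2)[OF g] by simp
      also have "\<dots> = real CARD('n) * (c * c * M) powr (w j / w j0) * exp (- (w j * l)) * q j (act g x) (act g y)"
        by (subst powr_mult) (simp_all only: C_powr mult.assoc)
      also have "\<dots> \<le> E * exp (- (w j * l)) * q j (act g x) (act g y)"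
        by (intro mult_right_mono E_le) auto
      finally show "exp (w j * l) / E * q j x y \<le> q j (act g x) (act g y)"
        using E1 by (simp add: exp_minus field_simps)
    qed
  qed
  obtain chi K where K: "K \<ge> 1"
    and chi: "\<And>g h. g \<in> carrier ?G \<Longrightarrow> h \<in> carrier ?G \<Longrightarrow> chi (g \<otimes>\<^bsub>?G\<^esub> h) = chi g + (chi h :: real)"
    and q_ge: "\<And>g j x y. g \<in> carrier ?G \<Longrightarrow> exp (w j * chi g) / K * q j x y \<le> q j (act g x) (act g y)"
    and q_le: "\<And>g j x y. g \<in> carrier ?G \<Longrightarrow> q j (act g x) (act g y) \<le> K * exp (w j * chi g) * q j x y"
    using wa.exists_scaling_character[OF quasi] by metis
  interpret sa: scaled_action w ?G T m act K chi
    by (intro scaled_action.intro graded_action.intro weighted_action.intro wa.amenable_action_axioms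
        weighted_coordinates_axioms weighted_action_axioms.intro graded_action_axioms.intro
        scaled_action_axioms.intro K chi q_ge q_le)
  obtain Q where Q: "compact Q" "Q \<subseteq> {(x, y). x \<noteq> y}" "{(x, y). x \<noteq> y} \<subseteq> (\<Union>\<gamma>\<in>\<Gamma>. map_prod \<gamma> \<gamma> ` Q)"
    using coco by (auto simp: cocompact_on_distinct_pairs_def)
  define Q' where "Q' = map_prod \<Phi> \<Phi> ` Q"
  have Q': "compact Q'" "Q' \<subseteq> {(x, y). x \<noteq> y}"
    "{(x, y). x \<noteq> y} \<subseteq> (\<Union>g\<in>carrier ?G. map_prod (act g) (act g) ` Q')"
  proof -
    have "continuous_on Q (\<lambda>z. (\<Phi> (fst z), \<Phi> (snd z)))"
      by (intro continuous_on_Pair continuous_on_compose2[OF \<Phi>\<Psi>(3)] continuous_on_fst continuous_on_snd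
          continuous_on_id subset_UNIV)
    then show "compact Q'"
      unfolding Q'_def map_prod_def split_def by (intro compact_continuous_image Q)
    show "Q' \<subseteq> {(x, y). x \<noteq> y}"
    proof -
      have "\<Phi> x \<noteq> \<Phi> y" if "x \<noteq> y" for x y
        using \<Phi>\<Psi>(2) that by metis
      then show ?thesis using Q(2) by (auto simp: Q'_def)
    qed
    show "{(x, y). x \<noteq> y} \<subseteq> (\<Union>g\<in>carrier ?G. map_prod (act g) (act g) ` Q')"
    proof clarify
      fix x y :: "real^'n" assume "x \<noteq> y"
      then have "\<Psi> x \<noteq> \<Psi> y" using \<Phi>\<Psi>(1) by metis
      then obtain \<gamma> u v where \<gamma>: "\<gamma> \<in> \<Gamma>" "(u, v) \<in> Q" "\<gamma> u = \<Psi> x" "\<gamma> v = \<Psi> y"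
        using Q(3) by (auto dest!: subsetD[where c = "(\<Psi> x, \<Psi> y)"])
      have "(x, y) = map_prod (act \<gamma>) (act \<gamma>) (\<Phi> u, \<Phi> v)"
        by (simp add: act_def \<Phi>\<Psi> \<gamma>)
      moreover have "(\<Phi> u, \<Phi> v) \<in> Q'"
        using \<gamma>(2) by (force simp: Q'_def)
      ultimately show "(x, y) \<in> (\<Union>g\<in>carrier ?G. map_prod (act g) (act g) ` Q')"
        using \<gamma>(1) by auto
    qed
  qed
  show thesis
  proof (rule sa.exists_similarity_chart[OF Q'])
    fix f f' assume f: "\<And>x. f (f' x) = x" "\<And>x. f' (f x) = x" "q_Lipschitz f" "q_Lipschitz f'"
      "\<And>h j x y. h \<in> carrier ?G \<Longrightarrow>
        norm (proj j (f (act h x)) - proj j (f (act h y))) = exp (w j * chi h) * norm (proj j (f x) - proj j (f y))"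
    obtain C C' where C: "C > 0" "\<And>j x y. q j (f x) (f y) \<le> C * q j x y"
      and C': "C' > 0" "\<And>j x y. q j (f' x) (f' y) \<le> C' * q j x y"
      using f(3,4) unfolding q_Lipschitz_def by blast
    define L where "L = 1 + C * c + c * C'"
    have d_nonneg: "d x y \<ge> 0" for x y
    proof -
      have "0 \<le> c * d x y" using c(3)[of x y] q_nonneg[of j0 "\<Phi> x" "\<Phi> y"] by linarith
      then show ?thesis using c(1) by (simp add: zero_le_mult_iff)
    qed
    show thesis
    proof (rule that)
      show "1 \<le> L" using C C' c(1) by (simp add: L_def)
      show "f (\<Phi> (\<Psi> (f' x))) = x" "\<Psi> (f' (f (\<Phi> x))) = x" for x
        by (simp_all add: f \<Phi>\<Psi>)
      show "q j0 (f (\<Phi> x)) (f (\<Phi> y)) \<le> L * d x y" for x y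
      proof -
        have "q j0 (f (\<Phi> x)) (f (\<Phi> y)) \<le> C * (c * d x y)"
          using C(2)[of j0 "\<Phi> x" "\<Phi> y"] mult_left_mono[OF c(3)[of x y] less_imp_le[OF C(1)]] by linarith
        also have "\<dots> \<le> L * d x y"
          using C C' c(1) d_nonneg[of x y] by (simp add: L_def algebra_simps)
        finally show ?thesis .
      qed
      show "d x y \<le> L * q j0 (f (\<Phi> x)) (f (\<Phi> y))" for x y
      proof -
        have "d x y \<le> c * q j0 (\<Phi> x) (\<Phi> y)" by (rule c)
        also have "\<dots> \<le> c * (C' * q j0 (f (\<Phi> x)) (f (\<Phi> y)))"
          using C'(2)[of j0 "f (\<Phi> x)" "f (\<Phi> y)"] c(1) by (intro mult_left_mono) (auto simp: f)
        also have "\<dots> \<le> L * q j0 (f (\<Phi> x)) (f (\<Phi> y))"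
          using C C' c(1) by (simp add: L_def algebra_simps)
        finally show ?thesis .
      qed
      show "norm (proj j (f (\<Phi> (\<gamma> x)) - f (\<Phi> (\<gamma> y)))) = exp (w j * chi \<gamma>) * norm (proj j (f (\<Phi> x) - f (\<Phi> y)))"
        if "\<gamma> \<in> \<Gamma>" for \<gamma> j x y
        using f(5)[of \<gamma> j "\<Phi> x" "\<Phi> y"] that by (simp add: proj_diff act_def \<Phi>\<Psi>)
    qed
  qed
qed

end

theorem theorem1p2:
  fixes A Abar :: "real^'n^'n"
    and J :: "complex^'n^'n"
    and \<Gamma> :: "(real^'n \<Rightarrow> real^'n) set"
    and T :: "(real^'n \<Rightarrow> real^'n) topology"
  assumes "diagonalizable_over_complex A"
    and "\<forall>c \<in> eigenvalues A. Re c > 0"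
    and "uniform_quasisimilarity_group (dist_mat A) \<Gamma>"
    and "locally_compact_group (bij_subgroup \<Gamma>) T"
    and "continuous_action T"
    and "amenable_group (bij_subgroup \<Gamma>) T"
    and "cocompact_on_distinct_pairs \<Gamma>"
    and "jordan_form_of_diagonalizable A J"
    and "Abar = real_part_matrix J"
  shows "\<exists>f :: real^'n \<Rightarrow> real^'n.
           bij f \<and> bilipschitz (dist_mat A) (dist_mat Abar) f \<and>
           similarity_group (dist_mat Abar) ((\<lambda>\<gamma>. f \<circ> \<gamma> \<circ> inv_into UNIV f) ` \<Gamma>)"
proof -
  obtain P where J: "diagonal_matrix J" and P: "invertible P" "J = matrix_inv P ** complexify A ** P"
    using assms(8) by (auto simp: jordan_form_of_diagonalizable_def complex_similar_def)
  have "complexify A ** P = P ** J"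
    by (simp add: P(2) matrix_mul_assoc matrix_inv_invertible[OF P(1)])
  then interpret eb: eigenbasis A J P
    using P(1) J by unfold_locales
  define w where "w = eb.w"
  interpret weighted_coordinates w
  proof
    show "w i > 0" for i
      using assms(2) eb.eigenvalues_eq by (auto simp: w_def eb.w_def)
  qed
  obtain Q where Q: "invertible Q" "\<And>i. column i Q \<in> real_part_subspace A (w i)"
    using eb.exists_adapted_real_basis unfolding w_def by blast
  have dA: "dist_mat A x y = max_dist Q (matrix_inv Q *v x - matrix_inv Q *v y)" for x y
    using eb.dist_mat_eq[OF Q(1)] Q(2) unfolding max_dist_def unfolding w_def by blast
  have "diagonal_matrix Abar"
    using J by (simp add: assms(9) real_part_matrix_def diagonal_matrix_def)
  moreover have w_Abar: "(\<lambda>i. Abar $ i $ i) = w"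
    by (simp add: fun_eq_iff w_def eb.w_def assms(9) real_part_matrix_def)
  ultimately have dAbar: "dist_mat Abar x y = max_dist (mat 1) (x - y)" for x y
    using dist_mat_real_diagonal[of Abar x y] unfolding w_Abar max_dist_def matrix_vector_mul_lid by blast
  obtain j0 where j0: "w j0 = Min (range w)" "\<And>k. w j0 \<le> w k"
    using exists_minimal_weight by blast
  obtain c where c_ge: "c \<ge> 1"
    and c_bounds: "\<And>x y. max_dist Q (x - y) \<le> c * q j0 x y"
    "\<And>x y. q j0 x y \<le> c * max_dist Q (x - y)"
    using max_dist_comparable_q[OF Q(1) j0(1)] by blast
  have c: "c \<ge> 1" "\<And>x y. dist_mat A x y \<le> c * q j0 (matrix_inv Q *v x) (matrix_inv Q *v y)"
    "\<And>x y. q j0 (matrix_inv Q *v x) (matrix_inv Q *v y) \<le> c * dist_mat A x y"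
    unfolding dA by (rule c_ge c_bounds)+
  have mat1: "invertible (mat 1 :: real^'n^'n)" by (auto simp: invertible_def intro: exI[of _ "mat 1"])
  obtain c' where c'_ge: "c' \<ge> 1"
    and c'_bounds: "\<And>x y. max_dist (mat 1) (x - y) \<le> c' * q j0 x y"
    "\<And>x y. q j0 x y \<le> c' * max_dist (mat 1) (x - y)"
    using max_dist_comparable_q[OF mat1 j0(1)] by blast
  have c': "c' \<ge> 1" "\<And>x y. dist_mat Abar x y \<le> c' * q j0 x y"
    "\<And>x y. q j0 x y \<le> c' * dist_mat Abar x y"
    unfolding dAbar by (rule c'_ge c'_bounds)+
  have sub: "subgroup \<Gamma> (BijGroup UNIV)"
    using assms(3) by (simp add: uniform_quasisimilarity_group_def)
  show ?thesis
  proof (rule conjugate_to_similarities[OF j0(2) _ _ _ _ c assms(3) _ assms(5,6,7)])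
    show "matrix_inv Q *v (Q *v x) = x" "Q *v (matrix_inv Q *v x) = x" for x
      by (simp_all add: matrix_vector_mul_assoc matrix_inv_invertible[OF Q(1)])
    show "continuous_on UNIV ((*v) (matrix_inv Q))" "continuous_on UNIV ((*v) Q)"
      by (intro linear_continuous_on matrix_vector_mul_bounded_linear)+
    show "topological_group (bij_subgroup \<Gamma>) T"
      using assms(4) by (simp add: locally_compact_group_def)
    fix F F' L s
    assume L: "L \<ge> 1" and FF': "\<And>x. F (F' x) = x" "\<And>x. F' (F x) = x"
      and F: "\<And>x y. q j0 (F x) (F y) \<le> L * dist_mat A x y" "\<And>x y. dist_mat A x y \<le> L * q j0 (F x) (F y)"
      and sim: "\<And>\<gamma> j x y. \<gamma> \<in> \<Gamma> \<Longrightarrow>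
        norm (proj j (F (\<gamma> x) - F (\<gamma> y))) = exp (w j * s \<gamma>) * norm (proj j (F x - F y))"
    have bij: "bij F" by (rule bij_betw_byWitness[where f' = F']) (auto simp: FF')
    have inv_F: "inv_into UNIV F = F'"
      using bij FF' by (intro ext inv_into_f_eq) (auto simp: bij_is_inj)
    have "bilipschitz (dist_mat A) (dist_mat Abar) F"
      unfolding bilipschitz_def
    proof (intro exI[of _ "L * c'"] conjI allI)
      show "L * c' \<ge> 1" using mult_mono[OF L c'(1)] L by simp
      fix x y
      have "dist_mat A x y \<le> L * (c' * dist_mat Abar (F x) (F y))"
        using F(2)[of x y] mult_left_mono[OF c'(3)[of "F x" "F y"], of L] L by linarith
      then show "dist_mat A x y / (L * c') \<le> dist_mat Abar (F x) (F y)"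
        using L c'(1) by (simp add: field_simps)
      have "dist_mat Abar (F x) (F y) \<le> c' * (L * dist_mat A x y)"
        using c'(2)[of "F x" "F y"] mult_left_mono[OF F(1)[of x y], of c'] c'(1) by linarith
      then show "dist_mat Abar (F x) (F y) \<le> L * c' * dist_mat A x y" by (simp add: mult_ac)
    qed
    moreover have "similarity (dist_mat Abar) (F \<circ> \<gamma> \<circ> F')" if \<gamma>: "\<gamma> \<in> \<Gamma>" for \<gamma>
    proof -
      define C where "C = exp (w j0 * s \<gamma>)"
      have C: "C > 0" by (simp add: C_def)
      have "dist_mat Abar (F (\<gamma> x)) (F (\<gamma> y)) = C * dist_mat Abar (F x) (F y)" for x y
      proof -
        \<comment> \<open>The exponent \<open>w j0 / a\<close> turns
          \<open>exp (a * s \<gamma>)\<close> into \<open>exp (w j0 * s \<gamma>)\<close>: the same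
          factor at every level, so the maximum is multiplied by it.\<close>
        have "norm (restr w a (F (\<gamma> x) - F (\<gamma> y))) powr (Min (range w) / a)
          = C * norm (restr w a (F x - F y)) powr (Min (range w) / a)" if a: "a \<in> range w" for a
        proof -
          obtain j where "a = w j" using a by blast
          then have "norm (restr w a (F (\<gamma> x) - F (\<gamma> y))) = exp (a * s \<gamma>) * norm (restr w a (F x - F y))"
            using sim[OF \<gamma>, of j x y] by (simp add: proj_eq_restr)
          then show ?thesis
            using \<open>a = w j\<close> by (simp add: powr_mult C_def j0(1) exp_powr_real)
        qed
        then have "(\<lambda>a. norm (restr w a (F (\<gamma> x) - F (\<gamma> y))) powr (Min (range w) / a)) ` range w
          = (*) C ` ((\<lambda>a. norm (restr w a (F x - F y)) powr (Min (range w) / a)) ` range w)"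
          unfolding image_image by (intro image_cong) auto
        moreover have "mono ((*) C)" using C by (intro monoI mult_left_mono) auto
        ultimately show ?thesis
          unfolding dAbar max_dist_def matrix_vector_mul_lid by (simp only: mono_Max_commute[symmetric] finite_imageI finite_class.finite
              image_is_empty UNIV_not_empty not_False_eq_True)
      qed
      from this[of "F' _" "F' _"] have "dist_mat Abar ((F \<circ> \<gamma> \<circ> F') x) ((F \<circ> \<gamma> \<circ> F') y) = C * dist_mat Abar x y" for x y
        by (simp add: FF')
      moreover have "bij (F \<circ> \<gamma> \<circ> F')"
        using bij bij_subgroup_facts(4)[OF sub \<gamma>] bij_imp_bij_inv[OF bij] inv_F by (intro bij_comp) auto
      ultimately have "quasisimilarity (dist_mat Abar) 1 C (F \<circ> \<gamma> \<circ> F')"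
        using C by (simp add: quasisimilarity_def)
      then show ?thesis unfolding similarity_def by blast
    qed
    ultimately show ?thesis
      using bij subgroup_conjugate_BijGroup[OF sub bij]
      by (intro exI[of _ F]) (auto simp: similarity_group_def inv_F)
  qed
qed

end
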